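(* Let $\theta\in\mathbb R$ and let $\phi:\mathbb{C}_\theta\to\mathbb{C}_{\frac12}$ be a function which is analytic on some half-plane and has there the form $\phi(s)=c_0s+\varphi(s)$ with $c_0\in\mathbb{N}\cup\{0\}$ and $\varphi\in\mathcal{D}$, and suppose that the composition operator $C_\phi:\mathcal{H}_+\to\mathcal{H}_+$, $C_\phi(D)=D\circ\phi$, is (well defined and) continuous; denote also by $\phi$ its analytic extension to $\mathbb{C}_+$. Then $C_\phi$ is a bounded operator on $\mathcal{H}_+$ if and only if there exists $\varepsilon>0$ such that 1. $\phi(\mathbb{C}_+)\subseteq\mathbb{C}_\varepsilon$ if $c_0\in\mathbb{N}$ (i.e. $c_0\ge1$); 2. $\phi(\mathbb{C}_+)\subseteq\mathbb{C}_{\frac12+\varepsilon}$ if $c_0=0$.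
   Context: For $\sigma\in\mathbb{R}$, $\mathbb{C}_\sigma=\{s\in\mathbb{C}:\operatorname{Re}s>\sigma\}$ and $\mathbb{C}_+=\mathbb{C}_0$. $\mathcal{D}$ is the space of Dirichlet series that converge at some point of $\mathbb{C}$. $\mathcal{H}_{+}$ is the space of Dirichlet series $D=\sum a_nn^{-s}$ such that $\|D\|_{2,k}:=\big(\sum_n|a_n|^2n^{-2/k}\big)^{1/2}<\infty$ for every $k\in\mathbb{N}$, with the Fréchet topology given by these seminorms; each such series converges absolutely on $\mathbb{C}_{\frac12}$. For $\phi$ as in the claim, $D\circ\phi$ is represented on some half-plane by a convergent Dirichlet series for each $D\in\mathcal{H}_+$, and $C_\phi(D)$ denotes this series. It is known that if $C_\phi:\mathcal{H}_+\to\mathcal{H}_+$ is continuous, then $\phi$ has an analytic extension to $\mathbb{C}_+$, with $\phi(\mathbb{C}_+)\subseteq\mathbb{C}_+$ if $c_0\ge1$ and $\phi(\mathbb{C}_+)\subseteq\mathbb{C}_{\frac12}$ if $c_0=0$. An operator $T:E\to F$ between locally convex spaces is bounded if there is a $0$-neighbourhood $U$ in $E$ such that $T(U)$ is bounded in $F$. *)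

theory Defs
  imports "HOL-Analysis.Analysis"
begin

definition half_plane :: "real \<Rightarrow> complex set" where
  "half_plane \<sigma> = {s. Re s > \<sigma>}"

text \<open>
  The Dirichlet series \<open>\<Sum>\<^sub>n a\<^sub>n n\<^sup>-\<^sup>s\<close> is identified with its coefficient sequence
  \<open>a :: nat \<Rightarrow> complex\<close>. Series start at \<open>n = 1\<close>: the index 0 is a dummy, for which
  \<open>dirichlet_term a s 0 = 0\<close> because \<open>0 powr z = 0\<close>; the spaces below require \<open>a 0 = 0\<close>
  so that a series has only one coefficient sequence.
\<close>

definition dirichlet_term :: "(nat \<Rightarrow> complex) \<Rightarrow> complex \<Rightarrow> nat \<Rightarrow> complex" where
  "dirichlet_term a s n = a n * of_nat n powr (- s)"

definition dirichlet_eval :: "(nat \<Rightarrow> complex) \<Rightarrow> complex \<Rightarrow> complex" where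
  "dirichlet_eval a s = (\<Sum>n. dirichlet_term a s n)"

definition dirichlet_space :: "(nat \<Rightarrow> complex) set" where
  "dirichlet_space = {a. a 0 = 0 \<and> (\<exists>s. summable (dirichlet_term a s))}"

definition hplus :: "(nat \<Rightarrow> complex) set" where
  "hplus = {a. a 0 = 0 \<and>
     (\<forall>k::nat. k \<ge> 1 \<longrightarrow> summable (\<lambda>n. (cmod (a n))\<^sup>2 * real n powr (- 2 / real k)))}"

definition hplus_seminorm :: "nat \<Rightarrow> (nat \<Rightarrow> complex) \<Rightarrow> real" where
  "hplus_seminorm k a = sqrt (\<Sum>n. (cmod (a n))\<^sup>2 * real n powr (- 2 / real k))"

definition hplus_ball :: "nat \<Rightarrow> (nat \<Rightarrow> complex) \<Rightarrow> real \<Rightarrow> (nat \<Rightarrow> complex) set" where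
  "hplus_ball k a r = {b \<in> hplus. hplus_seminorm k (\<lambda>n. b n - a n) < r}"

definition hplus_topology :: "(nat \<Rightarrow> complex) topology" where
  "hplus_topology =
     topology_generated_by {hplus_ball k a r | k a r. k \<ge> 1 \<and> a \<in> hplus \<and> r > 0}"

text \<open>
  The next three notions are meant for topological vector spaces whose carrier
  \<open>topspace X\<close> is a space of complex sequences with the pointwise operations.
\<close>

definition zero_neighbourhood :: "(nat \<Rightarrow> complex) topology \<Rightarrow> (nat \<Rightarrow> complex) set \<Rightarrow> bool" where
  "zero_neighbourhood X U \<longleftrightarrow>
     U \<subseteq> topspace X \<and> (\<exists>V. openin X V \<and> (\<lambda>_. 0) \<in> V \<and> V \<subseteq> U)"

text \<open>Bounded in the sense of von Neumann: absorbed by every neighbourhood of zero.\<close>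

definition tvs_bounded :: "(nat \<Rightarrow> complex) topology \<Rightarrow> (nat \<Rightarrow> complex) set \<Rightarrow> bool" where
  "tvs_bounded X B \<longleftrightarrow>
     B \<subseteq> topspace X \<and>
     (\<forall>V. zero_neighbourhood X V \<longrightarrow>
        (\<exists>t>0. \<forall>c::complex. cmod c \<ge> t \<longrightarrow> B \<subseteq> (\<lambda>v n. c * v n) ` V))"

definition bounded_operator ::
  "(nat \<Rightarrow> complex) topology \<Rightarrow> (nat \<Rightarrow> complex) topology \<Rightarrow>
   ((nat \<Rightarrow> complex) \<Rightarrow> (nat \<Rightarrow> complex)) \<Rightarrow> bool" where
  "bounded_operator X Y T \<longleftrightarrow> (\<exists>U. zero_neighbourhood X U \<and> tvs_bounded Y (T ` U))"

text \<open>
  \<open>represents_comp \<phi> a b\<close>: the convergent Dirichlet series \<open>b\<close> represents \<open>D \<circ> \<phi>\<close> on some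
  half-plane, \<open>D\<close> being the series of \<open>a\<close>. The half-plane may always be shrunk, so only the
  values of \<open>\<phi>\<close> far to the right matter.
\<close>

definition represents_comp ::
  "(complex \<Rightarrow> complex) \<Rightarrow> (nat \<Rightarrow> complex) \<Rightarrow> (nat \<Rightarrow> complex) \<Rightarrow> bool" where
  "represents_comp \<phi> a b \<longleftrightarrow>
     b \<in> dirichlet_space \<and>
     (\<exists>\<sigma>. \<forall>s\<in>half_plane \<sigma>. dirichlet_term b s sums dirichlet_eval a (\<phi> s))"

definition comp_op :: "(complex \<Rightarrow> complex) \<Rightarrow> (nat \<Rightarrow> complex) \<Rightarrow> (nat \<Rightarrow> complex)" where
  "comp_op \<phi> a = (THE b. represents_comp \<phi> a b)"

definition analytic_of_form :: "nat \<Rightarrow> (complex \<Rightarrow> complex) \<Rightarrow> bool" where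
  "analytic_of_form c\<^sub>0 \<phi> \<longleftrightarrow>
     (\<exists>\<sigma>. \<phi> analytic_on half_plane \<sigma> \<and>
        (\<exists>c\<in>dirichlet_space. \<forall>s\<in>half_plane \<sigma>.
           summable (dirichlet_term c s) \<and> \<phi> s = of_nat c\<^sub>0 * s + dirichlet_eval c s))"

text \<open>
  The analytic extension agrees with \<open>\<phi>\<close> on some half-plane; this determines it on
  \<open>half_plane 0\<close> by the identity theorem.
\<close>

definition analytic_extension :: "(complex \<Rightarrow> complex) \<Rightarrow> (complex \<Rightarrow> complex) \<Rightarrow> bool" where
  "analytic_extension \<phi> \<Phi> \<longleftrightarrow>
     \<Phi> analytic_on half_plane 0 \<and> (\<exists>\<sigma>. \<forall>s\<in>half_plane \<sigma>. \<Phi> s = \<phi> s)"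

end

theory Submission
  imports Defs "HOL-Complex_Analysis.Complex_Analysis"
begin

text \<open>
  Boundedness of the composition operator means that one seminorm \<open>\<parallel>\<cdot>\<parallel>\<^sub>2\<^sub>,\<^sub>k\<close> of \<open>D\<close> controls all
  seminorms of \<open>D \<circ> \<phi>\<close>.

  Necessity. Restricting a Dirichlet series to the \<open>d\<close>-smooth indices is multiplicative, and the
  restriction of a series in \<open>\<H>\<^sub>+\<close> converges absolutely on the right half-plane, where it is bounded
  by a seminorm. Applied to the images of \<open>(2\<^sup>j)\<^sup>-\<^sup>s\<close>, this bounds the \<open>j\<close>-th power of the smooth part
  of \<open>2\<^sup>-\<^sup>\<phi>\<close> by \<open>M 2\<^sup>-\<^sup>j\<^sup>/\<^sup>k\<close>, so this smooth part is at most \<open>2\<^sup>-\<^sup>1\<^sup>/\<^sup>k\<close>; a normal family argument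
  as \<open>d \<rightarrow> \<infinity>\<close> gives \<open>Re \<phi> \<ge> 1/k\<close>. If \<open>c\<^sub>0 = 0\<close>, the smooth parts of the functions \<open>n\<^sup>-\<^sup>\<phi>\<close> are
  themselves of the form \<open>n\<^sup>-\<^sup>h\<close> up to unimodular constants, and the boundedness of
  \<open>D \<mapsto> D(h(s))\<close> forces \<open>\<Sum> n\<^sup>-\<^sup>2 \<^sup>R\<^sup>e \<^sup>h\<^sup>(\<^sup>s\<^sup>)\<^sup>+\<^sup>2\<^sup>/\<^sup>k < \<infinity>\<close>, that is, \<open>Re h > 1/2 + 1/k\<close>.

  Sufficiency. By Bessel's inequality for means on vertical lines, the coefficients of \<open>D \<circ> \<phi>\<close>
  are controlled by the mean of \<open>|D \<circ> \<phi>|\<^sup>2\<close>. If \<open>c\<^sub>0 = 0\<close>, then \<open>D \<circ> \<phi>\<close> is bounded by a seminorm of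
  \<open>D\<close>. If \<open>c\<^sub>0 \<ge> 1\<close>, then \<open>\<phi> - \<epsilon>\<close> is a self-map of the right half-plane fixing infinity, and the mean
  does not grow, by Littlewood's subordination principle.
\<close>

section \<open>Dirichlet series\<close>

text \<open>The obstacle is the strip 0 < Re s \<le> 1/2. A series in \<open>hplus\<close> is only
  known to converge absolutely for Re s > 1/2, so a seminorm of \<open>C a\<close> does not control
  D o \<Phi> in the strip, and D cannot be evaluated at \<Phi>(s) when merely Re \<Phi>(s) >
  \<epsilon>.

  In the necessity part the strip is reached by keeping finitely many primes. The price is that the
  smooth part of n^(-\<Phi>) is no longer a function of \<Phi>(s): only identities between
  coefficient sequences survive. Multiplicativity is one of them. Another is the differential
  equation ln 2 (n^(-\<Phi>))' 2^(-\<Phi>) = ln n n^(-\<Phi>) (2^(-\<Phi>))', by which the smooth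
  parts are recognised as powers of one function when \<open>c\<^sub>0 = 0\<close>.

  In the sufficiency part with \<open>c\<^sub>0 \<ge> 1\<close> the estimate is made for Dirichlet
  polynomials, which can be composed with \<Phi> everywhere, and continuity of the operator carries
  it to \<open>hplus\<close>. The shift by \<epsilon> multiplies the n-th coefficient by
  n^(-\<epsilon>), and any k with 1/k < \<epsilon> makes the new coefficients controlled by the k-th
  seminorm.\<close>

definition abs_conv :: "(nat \<Rightarrow> complex) \<Rightarrow> real \<Rightarrow> bool" where
  "abs_conv a \<sigma> \<longleftrightarrow> summable (\<lambda>n. cmod (a n) * real n powr (-\<sigma>))"

lemma in_half_plane [simp]: "s \<in> half_plane \<sigma> \<longleftrightarrow> Re s > \<sigma>"
  by (simp add: half_plane_def)

lemma half_plane_props: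
  "open (half_plane \<sigma>)" "convex (half_plane \<sigma>)" "connected (half_plane \<sigma>)" "half_plane \<sigma> \<noteq> {}"
proof -
  show "open (half_plane \<sigma>)" by (simp add: half_plane_def open_halfspace_Re_gt)
  show c: "convex (half_plane \<sigma>)" by (simp add: half_plane_def convex_halfspace_Re_gt)
  show "connected (half_plane \<sigma>)" using c by (rule convex_connected)
  have "of_real (\<sigma> + 1) \<in> half_plane \<sigma>" by simp
  then show "half_plane \<sigma> \<noteq> {}" by blast
qed

lemma half_plane_mono: "\<sigma> \<le> \<tau> \<Longrightarrow> half_plane \<tau> \<subseteq> half_plane \<sigma>"
  by auto

lemma norm_nat_powr: "cmod (of_nat n powr z) = real n powr (Re z)"
  by (simp add: norm_powr_real_powr)

lemma norm_dirichlet_term: "cmod (dirichlet_term a s n) = cmod (a n) * real n powr (- Re s)"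
  by (simp add: dirichlet_term_def norm_mult norm_nat_powr)

lemma nat_powr_antimono: "\<sigma> \<le> \<tau> \<Longrightarrow> real n powr (-\<tau>) \<le> real n powr (-\<sigma>)"
  by (cases "n = 0") (auto intro: powr_mono)

lemma abs_conv_mono:
  assumes "abs_conv a \<sigma>" "\<sigma> \<le> \<tau>"
  shows "abs_conv a \<tau>"
  unfolding abs_conv_def
proof (rule summable_comparison_test'[where N=0])
  show "summable (\<lambda>n. cmod (a n) * real n powr (-\<sigma>))" using assms(1) by (simp add: abs_conv_def)
  show "norm (cmod (a n) * real n powr (-\<tau>)) \<le> cmod (a n) * real n powr (-\<sigma>)" for n
    using nat_powr_antimono[OF assms(2), of n] by (simp add: mult_left_mono)
qed

lemma abs_conv_summable_norm:
  assumes "abs_conv a \<sigma>" "\<sigma> \<le> Re s"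
  shows "summable (\<lambda>n. cmod (dirichlet_term a s n))"
  using abs_conv_mono[OF assms] by (simp add: abs_conv_def norm_dirichlet_term)

lemma abs_conv_sums:
  assumes "abs_conv a \<sigma>" "\<sigma> \<le> Re s"
  shows "dirichlet_term a s sums dirichlet_eval a s"
  unfolding dirichlet_eval_def
  by (rule summable_sums) (rule summable_norm_cancel[OF abs_conv_summable_norm[OF assms]])

lemma abs_conv_comparison:
  assumes "abs_conv a \<sigma>" "\<And>n. cmod (b n) \<le> K * cmod (a n)"
  shows "abs_conv b \<sigma>"
  unfolding abs_conv_def
proof (rule summable_comparison_test'[where N=0])
  show "summable (\<lambda>n. K * (cmod (a n) * real n powr (-\<sigma>)))"
    using assms(1) by (intro summable_mult) (simp add: abs_conv_def)
  show "norm (cmod (b n) * real n powr (-\<sigma>)) \<le> K * (cmod (a n) * real n powr (-\<sigma>))" for n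
    using mult_right_mono[OF assms(2)[of n], of "real n powr (-\<sigma>)"] by (simp add: mult.assoc)
qed

lemma abs_conv_finite_support:
  assumes "finite {n. a n \<noteq> 0}"
  shows "abs_conv a \<sigma>"
  unfolding abs_conv_def using assms by (intro summable_finite[where N="{n. a n \<noteq> 0}"]) auto

lemma abs_conv_diff:
  assumes "abs_conv a \<sigma>" "abs_conv b \<sigma>"
  shows "abs_conv (\<lambda>n. a n - b n) \<sigma>"
  unfolding abs_conv_def
proof (rule summable_comparison_test'[where N=0])
  show "summable (\<lambda>n. cmod (a n) * real n powr (-\<sigma>) + cmod (b n) * real n powr (-\<sigma>))"
    using assms by (intro summable_add) (simp_all add: abs_conv_def)
  show "norm (cmod (a n - b n) * real n powr (-\<sigma>))
      \<le> cmod (a n) * real n powr (-\<sigma>) + cmod (b n) * real n powr (-\<sigma>)" for n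
    using mult_right_mono[OF norm_triangle_ineq4[of "a n" "b n"], of "real n powr (-\<sigma>)"]
    by (simp add: distrib_right)
qed

lemma summable_nat_powr: "\<delta> > 1 \<Longrightarrow> summable (\<lambda>n. real n powr (-\<delta>))"
  by (simp add: summable_real_powr_iff)

text \<open>The terms of a convergent series are bounded, so moving two units to the right dominates
  them by a multiple of n^(-2).\<close>

lemma dirichlet_space_abs_conv:
  assumes "a \<in> dirichlet_space"
  obtains \<sigma> where "abs_conv a \<sigma>"
proof -
  obtain s where s: "summable (dirichlet_term a s)" using assms by (auto simp: dirichlet_space_def)
  obtain C where C: "\<And>n. cmod (dirichlet_term a s n) \<le> C"
    using summable_imp_bounded[OF s] by (auto simp: bounded_iff)
  have "abs_conv a (Re s + 2)"
    unfolding abs_conv_def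
  proof (rule summable_comparison_test'[where N=0])
    show "summable (\<lambda>n. C * real n powr (-2))" by (intro summable_mult summable_nat_powr) simp
    show "norm (cmod (a n) * real n powr (-(Re s + 2))) \<le> C * real n powr (-2)" for n
      using mult_right_mono[OF C[of n], of "real n powr (-2)"]
      by (simp add: norm_dirichlet_term mult.assoc flip: powr_add)
  qed
  then show ?thesis by (rule that)
qed

section \<open>Termwise differentiation, leading coefficients and uniqueness\<close>

lemma has_field_derivative_dirichlet_term:
  "((\<lambda>s. dirichlet_term a s n) has_field_derivative
     dirichlet_term (\<lambda>n. - of_real (ln (real n)) * a n) s n) (at s)"
proof (cases "n = 0")
  case True
  then show ?thesis by (simp add: dirichlet_term_def)
next
  case False
  then have "((\<lambda>s. a n * exp (- s * of_real (ln (real n)))) has_field_derivative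
      - of_real (ln (real n)) * a n * exp (- s * of_real (ln (real n)))) (at s)"
    by (auto intro!: derivative_eq_intros)
  then show ?thesis using False by (simp add: dirichlet_term_def powr_def Ln_of_nat)
qed

lemma dirichlet_eval_has_derivative:
  assumes "abs_conv a \<sigma>" "Re s > \<sigma>"
  shows "(dirichlet_eval a has_field_derivative
           dirichlet_eval (\<lambda>n. - of_real (ln (real n)) * a n) s) (at s)"
proof -
  have h: "summable (\<lambda>n. cmod (a n) * real n powr (-\<sigma>))" using assms by (simp add: abs_conv_def)
  have b: "\<forall>\<^sub>F n in sequentially. \<forall>s\<in>half_plane \<sigma>.
      cmod (dirichlet_term a s n) \<le> cmod (a n) * real n powr (-\<sigma>)"
    by (intro always_eventually) (auto simp: norm_dirichlet_term intro!: mult_left_mono nat_powr_antimono)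
  obtain g g' where g: "\<And>s. s \<in> half_plane \<sigma> \<Longrightarrow> (\<lambda>n. dirichlet_term a s n) sums g s"
      "\<And>s. s \<in> half_plane \<sigma> \<Longrightarrow>
        (\<lambda>n. dirichlet_term (\<lambda>n. - of_real (ln (real n)) * a n) s n) sums g' s"
      "\<And>s. s \<in> half_plane \<sigma> \<Longrightarrow> (g has_field_derivative g' s) (at s)"
    using series_and_derivative_comparison[OF half_plane_props(1) h
        has_field_derivative_dirichlet_term b] by metis
  have s: "s \<in> half_plane \<sigma>" using assms by simp
  have eq: "g z = dirichlet_eval a z" if "z \<in> half_plane \<sigma>" for z
    using sums_unique[OF g(1)[OF that]] by (simp add: dirichlet_eval_def)
  have eq': "g' s = dirichlet_eval (\<lambda>n. - of_real (ln (real n)) * a n) s"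
    using sums_unique[OF g(2)[OF s]] by (simp add: dirichlet_eval_def)
  show "(dirichlet_eval a has_field_derivative
           dirichlet_eval (\<lambda>n. - of_real (ln (real n)) * a n) s) (at s)"
    using has_field_derivative_transform_within_open[OF g(3)[OF s] half_plane_props(1) s eq] eq' by simp
qed

lemma dirichlet_eval_holomorphic: "abs_conv a \<sigma> \<Longrightarrow> dirichlet_eval a holomorphic_on half_plane \<sigma>"
  using dirichlet_eval_has_derivative[of a \<sigma>]
  by (force simp: holomorphic_on_open[OF half_plane_props(1)])

text \<open>The logarithm of n is at most n^\<delta>/\<delta>, so the differentiated series
  converges absolutely after an arbitrarily small move to the right.\<close>

lemma abs_conv_log:
  assumes "abs_conv a \<sigma>" "\<sigma> < \<tau>"
  shows "abs_conv (\<lambda>n. - of_real (ln (real n)) * a n) \<tau>"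
  unfolding abs_conv_def
proof (rule summable_comparison_test'[where N=0])
  define \<delta> where "\<delta> = \<tau> - \<sigma>"
  have \<delta>: "\<delta> > 0" using assms by (simp add: \<delta>_def)
  show "summable (\<lambda>n. 1/\<delta> * (cmod (a n) * real n powr (-\<sigma>)))"
    using assms by (intro summable_mult) (simp add: abs_conv_def)
  fix n :: nat
  show "norm (cmod (- of_real (ln (real n)) * a n) * real n powr (-\<tau>))
      \<le> 1/\<delta> * (cmod (a n) * real n powr (-\<sigma>))"
  proof (cases "n = 0")
    case False
    have l: "\<bar>ln (real n)\<bar> \<le> real n powr \<delta> / \<delta>"
      using ln_powr_bound[of "real n" \<delta>] False \<delta> by simp
    have "norm (cmod (- of_real (ln (real n)) * a n) * real n powr (-\<tau>))
        = \<bar>ln (real n)\<bar> * (cmod (a n) * real n powr (-\<tau>))" by (simp add: norm_mult)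
    also have "\<dots> \<le> real n powr \<delta> / \<delta> * (cmod (a n) * real n powr (-\<tau>))"
      by (intro mult_right_mono l) simp
    also have "\<dots> = 1/\<delta> * (cmod (a n) * (real n powr \<delta> * real n powr (-\<tau>)))" by simp
    also have "real n powr \<delta> * real n powr (-\<tau>) = real n powr (-\<sigma>)"
      by (simp add: \<delta>_def flip: powr_add)
    finally show ?thesis .
  qed simp
qed

text \<open>After multiplication by n^s every remaining term has index at least n + 1 and decays at
  least like (n/(n+1))^(Re s). The bound depends on Re s only; shifting vertical lines needs this
  uniformity in Im s.\<close>

lemma dirichlet_leading_coeff:
  assumes b: "abs_conv b \<sigma>\<^sub>1" and n: "n \<ge> 1" and lead: "\<And>m. m < n \<Longrightarrow> b m = 0"
  shows "\<exists>K\<ge>0. \<forall>s. Re s \<ge> \<sigma>\<^sub>1 \<longrightarrow>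
    cmod (of_nat n powr s * dirichlet_eval b s - b n) \<le> K * (real n / real (n+1)) powr (Re s - \<sigma>\<^sub>1)"
proof (intro exI conjI allI impI)
  define S where "S = (\<Sum>m. cmod (b m) * real m powr (-\<sigma>\<^sub>1))"
  have sm: "summable (\<lambda>m. cmod (b m) * real m powr (-\<sigma>\<^sub>1))" using b by (simp add: abs_conv_def)
  show "real n powr \<sigma>\<^sub>1 * S \<ge> 0" unfolding S_def using sm by (intro mult_nonneg_nonneg suminf_nonneg) auto
  fix s assume s: "Re s \<ge> \<sigma>\<^sub>1"
  define t where "t = Re s - \<sigma>\<^sub>1"
  define c where "c = (\<lambda>m. if m = n then 0 else b m)"
  have b': "dirichlet_term b s sums dirichlet_eval b s" by (rule abs_conv_sums[OF b s])
  have "(\<lambda>m. if m = n then dirichlet_term b s m else 0) sums dirichlet_term b s n"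
    by (rule sums_single)
  from sums_diff[OF b' this] have c: "dirichlet_term c s sums (dirichlet_eval b s - dirichlet_term b s n)"
    by (rule sums_cong[THEN iffD1, rotated]) (auto simp: c_def dirichlet_term_def)
  have le: "cmod (dirichlet_term c s m) \<le> real (n+1) powr (-t) * (cmod (b m) * real m powr (-\<sigma>\<^sub>1))" for m
  proof (cases "m \<le> n")
    case True
    then have "c m = 0" using lead[of m] by (auto simp: c_def)
    then show ?thesis by (simp add: dirichlet_term_def)
  next
    case False
    have "real m powr (-t) \<le> real (n+1) powr (-t)"
      using False s by (intro powr_mono2') (auto simp: t_def)
    then have "cmod (b m) * (real m powr (-t) * real m powr (-\<sigma>\<^sub>1))
        \<le> cmod (b m) * (real (n+1) powr (-t) * real m powr (-\<sigma>\<^sub>1))"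
      by (intro mult_left_mono mult_right_mono) auto
    then show ?thesis using False
      by (simp add: norm_dirichlet_term c_def t_def mult.left_commute flip: powr_add)
  qed
  have "cmod (dirichlet_eval b s - dirichlet_term b s n)
      \<le> (\<Sum>m. real (n+1) powr (-t) * (cmod (b m) * real m powr (-\<sigma>\<^sub>1)))"
    unfolding sums_unique[OF c] by (rule norm_suminf_le[OF le summable_mult[OF sm]])
  also have "\<dots> = real (n+1) powr (-t) * S" unfolding S_def by (rule suminf_mult[OF sm])
  finally have d: "cmod (dirichlet_eval b s - dirichlet_term b s n) \<le> real (n+1) powr (-t) * S" .
  have "of_nat n powr s * dirichlet_term b s n = b n"
    using n by (simp add: dirichlet_term_def powr_minus)
  then have "cmod (of_nat n powr s * dirichlet_eval b s - b n)
      = cmod (of_nat n powr s * (dirichlet_eval b s - dirichlet_term b s n))"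
    by (simp add: right_diff_distrib)
  also have "\<dots> = real n powr (Re s) * cmod (dirichlet_eval b s - dirichlet_term b s n)"
    by (simp add: norm_mult norm_nat_powr)
  also have "\<dots> \<le> real n powr (Re s) * (real (n+1) powr (-t) * S)"
    by (intro mult_left_mono d) simp
  also have "\<dots> = real n powr \<sigma>\<^sub>1 * S * (real n powr t * real (n+1) powr (-t))"
    by (simp add: t_def flip: powr_add)
  also have "real n powr t * real (n+1) powr (-t) = (real n / real (n+1)) powr t"
    by (simp add: powr_divide powr_minus_divide)
  finally show "cmod (of_nat n powr s * dirichlet_eval b s - b n)
      \<le> real n powr \<sigma>\<^sub>1 * S * (real n / real (n+1)) powr (Re s - \<sigma>\<^sub>1)"
    by (simp add: t_def)
qed

lemma powr_tendsto_zero: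
  assumes "0 < q" "q < 1"
  shows "((\<lambda>x::real. K * q powr (x - c)) \<longlongrightarrow> 0) at_top"
proof -
  have "filterlim (\<lambda>x::real. ln q * (x + (- c))) at_bot at_top"
    using assms filterlim_tendsto_add_at_top[OF tendsto_const filterlim_ident, of "- c"]
    by (intro filterlim_tendsto_neg_mult_at_bot[OF tendsto_const]) (auto simp: add.commute)
  then have "((\<lambda>x::real. exp (ln q * (x + (- c)))) \<longlongrightarrow> 0) at_top"
    by (rule filterlim_compose[OF exp_at_bot])
  then have "((\<lambda>x::real. K * exp (ln q * (x + (- c)))) \<longlongrightarrow> K * 0) at_top" by (intro tendsto_intros)
  then show ?thesis using assms by (simp add: powr_def mult.commute)
qed

lemma dirichlet_leading_coeff_uniform:
  assumes b: "abs_conv b \<sigma>\<^sub>1" and n: "n \<ge> 1" and lead: "\<And>m. m < n \<Longrightarrow> b m = 0" and "e > 0"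
  shows "\<exists>\<sigma>\<ge>\<sigma>\<^sub>1. \<forall>s. Re s \<ge> \<sigma> \<longrightarrow> cmod (of_nat n powr s * dirichlet_eval b s - b n) < e"
proof -
  obtain K where K: "\<And>s. Re s \<ge> \<sigma>\<^sub>1 \<Longrightarrow>
    cmod (of_nat n powr s * dirichlet_eval b s - b n) \<le> K * (real n / real (n+1)) powr (Re s - \<sigma>\<^sub>1)"
    using dirichlet_leading_coeff[OF b n lead] by blast
  have "((\<lambda>x::real. K * (real n / real (n+1)) powr (x - \<sigma>\<^sub>1)) \<longlongrightarrow> 0) at_top"
    using n by (intro powr_tendsto_zero) auto
  then have "\<forall>\<^sub>F x in at_top. K * (real n / real (n+1)) powr (x - \<sigma>\<^sub>1) < e"
    using \<open>e > 0\<close> by (rule order_tendstoD(2))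
  then obtain N where N: "\<And>x. x \<ge> N \<Longrightarrow> K * (real n / real (n+1)) powr (x - \<sigma>\<^sub>1) < e"
    by (auto simp: eventually_at_top_linorder)
  have "cmod (of_nat n powr s * dirichlet_eval b s - b n) < e" if "Re s \<ge> max N \<sigma>\<^sub>1" for s
  proof -
    have "cmod (of_nat n powr s * dirichlet_eval b s - b n) \<le> K * (real n / real (n+1)) powr (Re s - \<sigma>\<^sub>1)"
      using that by (intro K) simp
    also have "\<dots> < e" using that by (intro N) simp
    finally show ?thesis .
  qed
  then show ?thesis by (intro exI[of _ "max N \<sigma>\<^sub>1"]) auto
qed

lemma dirichlet_eval_diff:
  assumes "abs_conv a \<sigma>" "abs_conv b \<sigma>" "Re s \<ge> \<sigma>"
  shows "dirichlet_eval (\<lambda>n. a n - b n) s = dirichlet_eval a s - dirichlet_eval b s"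
proof -
  have "(\<lambda>n. dirichlet_term a s n - dirichlet_term b s n) sums (dirichlet_eval a s - dirichlet_eval b s)"
    using assms by (intro sums_diff abs_conv_sums)
  from sums_unique[OF this] show ?thesis
    by (simp add: dirichlet_eval_def dirichlet_term_def algebra_simps)
qed

text \<open>Strong induction on the index: multiplied by n^s, the vanishing difference tends to its
  first possibly nonzero coefficient. This gives sense to the \<open>THE\<close> in
  \<open>comp_op\<close> and turns identities of functions far to the right into identities of
  coefficients.\<close>

lemma dirichlet_series_unique:
  assumes a: "abs_conv a \<sigma>" and b: "abs_conv b \<sigma>" and "a 0 = b 0"
    and eq: "\<And>s. Re s > \<sigma> \<Longrightarrow> dirichlet_eval a s = dirichlet_eval b s"
  shows "a = b"
proof -
  define c where "c = (\<lambda>n. a n - b n)"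
  have c: "abs_conv c \<sigma>" unfolding c_def by (rule abs_conv_diff[OF a b])
  have c0: "dirichlet_eval c s = 0" if "Re s > \<sigma>" for s
    using that eq dirichlet_eval_diff[OF a b] by (simp add: c_def)
  have "c n = 0" for n
  proof (induction n rule: less_induct)
    case (less n)
    show ?case
    proof (cases "n = 0")
      case False
      show ?thesis
      proof (rule ccontr)
        assume "c n \<noteq> 0"
        then have "cmod (c n) > 0" by simp
        from dirichlet_leading_coeff_uniform[OF c _ less this] False
        obtain \<tau> where \<tau>: "\<And>s. Re s \<ge> \<tau> \<Longrightarrow>
            cmod (of_nat n powr s * dirichlet_eval c s - c n) < cmod (c n)"
          by (auto simp: Suc_le_eq)
        have "cmod (of_nat n powr s * dirichlet_eval c s - c n) < cmod (c n)"
          if "s = of_real (max \<tau> (\<sigma> + 1))" for s using that by (intro \<tau>) simp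
        moreover have "dirichlet_eval c (of_real (max \<tau> (\<sigma> + 1))) = 0" by (rule c0) simp
        ultimately show False by auto
      qed
    qed (simp add: c_def \<open>a 0 = b 0\<close>)
  qed
  then show ?thesis by (auto simp: c_def)
qed


section \<open>The seminorms and the topology\<close>

lemma L2_set_le_suminf:
  assumes "summable (\<lambda>n. (x n)\<^sup>2)" "finite A"
  shows "L2_set x A \<le> sqrt (\<Sum>n::nat. (x n)\<^sup>2)"
  unfolding L2_set_def by (intro real_sqrt_le_mono sum_le_suminf assms) auto

lemma suminf_le_of_L2_set:
  assumes "\<And>N. L2_set x {..<N} \<le> C"
  shows "summable (\<lambda>n::nat. (x n)\<^sup>2)" "sqrt (\<Sum>n. (x n)\<^sup>2) \<le> C"
proof -
  have C: "C \<ge> 0" using assms[of 0] by simp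
  have le: "(\<Sum>n<N. (x n)\<^sup>2) \<le> C\<^sup>2" for N
    using assms[of N] C by (simp add: L2_set_def real_sqrt_le_iff sqrt_le_D)
  show s: "summable (\<lambda>n. (x n)\<^sup>2)"
    by (rule summableI_nonneg_bounded[OF _ le]) simp
  have "(\<Sum>n. (x n)\<^sup>2) \<le> C\<^sup>2" by (rule suminf_le_const[OF s le])
  then show "sqrt (\<Sum>n. (x n)\<^sup>2) \<le> C" using C by (simp add: real_le_lsqrt)
qed

lemma summable_Cauchy_Schwarz:
  fixes x y :: "nat \<Rightarrow> real"
  assumes "summable (\<lambda>n. (x n)\<^sup>2)" "summable (\<lambda>n. (y n)\<^sup>2)"
  shows "summable (\<lambda>n. \<bar>x n\<bar> * \<bar>y n\<bar>)"
    and "(\<Sum>n. \<bar>x n\<bar> * \<bar>y n\<bar>) \<le> sqrt (\<Sum>n. (x n)\<^sup>2) * sqrt (\<Sum>n. (y n)\<^sup>2)"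
proof -
  have le: "(\<Sum>n<N. \<bar>x n\<bar> * \<bar>y n\<bar>) \<le> sqrt (\<Sum>n. (x n)\<^sup>2) * sqrt (\<Sum>n. (y n)\<^sup>2)" for N
    using L2_set_mult_ineq[of x y "{..<N}"]
      mult_mono[OF L2_set_le_suminf[OF assms(1)] L2_set_le_suminf[OF assms(2)], of "{..<N}" "{..<N}"]
    by (force simp: suminf_nonneg assms intro: order_trans)
  show s: "summable (\<lambda>n. \<bar>x n\<bar> * \<bar>y n\<bar>)"
    by (rule summableI_nonneg_bounded[OF _ le]) simp
  show "(\<Sum>n. \<bar>x n\<bar> * \<bar>y n\<bar>) \<le> sqrt (\<Sum>n. (x n)\<^sup>2) * sqrt (\<Sum>n. (y n)\<^sup>2)"
    by (rule suminf_le_const[OF s le])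
qed

lemma l2_triangle:
  fixes x y z :: "nat \<Rightarrow> real"
  assumes "summable (\<lambda>n. (x n)\<^sup>2)" "summable (\<lambda>n. (y n)\<^sup>2)" "\<And>n. \<bar>z n\<bar> \<le> \<bar>x n\<bar> + \<bar>y n\<bar>"
  shows "summable (\<lambda>n. (z n)\<^sup>2)"
    and "sqrt (\<Sum>n. (z n)\<^sup>2) \<le> sqrt (\<Sum>n. (x n)\<^sup>2) + sqrt (\<Sum>n. (y n)\<^sup>2)"
proof -
  have "L2_set z {..<N} \<le> sqrt (\<Sum>n. (x n)\<^sup>2) + sqrt (\<Sum>n. (y n)\<^sup>2)" for N
  proof -
    have "L2_set z {..<N} = L2_set (\<lambda>n. \<bar>z n\<bar>) {..<N}" by (simp add: L2_set_def)
    also have "\<dots> \<le> L2_set (\<lambda>n. \<bar>x n\<bar> + \<bar>y n\<bar>) {..<N}" by (rule L2_set_mono) (auto intro: assms)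
    also have "\<dots> \<le> L2_set (\<lambda>n. \<bar>x n\<bar>) {..<N} + L2_set (\<lambda>n. \<bar>y n\<bar>) {..<N}"
      by (rule L2_set_triangle_ineq)
    also have "\<dots> = L2_set x {..<N} + L2_set y {..<N}" by (simp add: L2_set_def)
    also have "\<dots> \<le> sqrt (\<Sum>n. (x n)\<^sup>2) + sqrt (\<Sum>n. (y n)\<^sup>2)"
      by (intro add_mono L2_set_le_suminf assms) auto
    finally show ?thesis .
  qed
  from suminf_le_of_L2_set[OF this]
  show "summable (\<lambda>n. (z n)\<^sup>2)"
    "sqrt (\<Sum>n. (z n)\<^sup>2) \<le> sqrt (\<Sum>n. (x n)\<^sup>2) + sqrt (\<Sum>n. (y n)\<^sup>2)" by auto
qed

text \<open>The weight is moved into the sequence, so that the k-th seminorm is an unweighted l2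
  norm to which Minkowski and Cauchy-Schwarz apply.\<close>

definition hplus_weighted :: "nat \<Rightarrow> (nat \<Rightarrow> complex) \<Rightarrow> nat \<Rightarrow> real" where
  "hplus_weighted k a n = cmod (a n) * real n powr (- 1 / real k)"

lemma hplus_weighted_square:
  "(hplus_weighted k a n)\<^sup>2 = (cmod (a n))\<^sup>2 * real n powr (- 2 / real k)"
  by (simp add: hplus_weighted_def power_mult_distrib power2_eq_square flip: powr_add)

lemma hplus_seminorm_eq: "hplus_seminorm k a = sqrt (\<Sum>n. (hplus_weighted k a n)\<^sup>2)"
  by (simp add: hplus_seminorm_def hplus_weighted_square)

lemma hplus_iff:
  "a \<in> hplus \<longleftrightarrow> a 0 = 0 \<and> (\<forall>k\<ge>1. summable (\<lambda>n. (hplus_weighted k a n)\<^sup>2))"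
  by (simp add: hplus_def hplus_weighted_square)

lemma hplus_weighted_summable: "a \<in> hplus \<Longrightarrow> k \<ge> 1 \<Longrightarrow> summable (\<lambda>n. (hplus_weighted k a n)\<^sup>2)"
  by (simp add: hplus_iff)

lemma hplus_finite_support:
  assumes "finite {n. a n \<noteq> 0}" "a 0 = 0"
  shows "a \<in> hplus"
  unfolding hplus_iff using assms
  by (auto intro!: summable_finite[where N="{n. a n \<noteq> 0}"] simp: hplus_weighted_def)

lemma hplus_zero [simp]: "(\<lambda>_. 0) \<in> hplus"
  by (rule hplus_finite_support) auto

lemma hplus_seminorm_nonneg: "a \<in> hplus \<Longrightarrow> k \<ge> 1 \<Longrightarrow> hplus_seminorm k a \<ge> 0"
  unfolding hplus_seminorm_eq by (simp add: suminf_nonneg hplus_weighted_summable)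

lemma hplus_seminorm_zero [simp]: "hplus_seminorm k (\<lambda>_. 0) = 0"
  by (simp add: hplus_seminorm_def)

lemma hplus_weighted_triangle:
  assumes "\<And>n. cmod (c n) \<le> cmod (a n) + cmod (b n)"
  shows "\<bar>hplus_weighted k c n\<bar> \<le> \<bar>hplus_weighted k a n\<bar> + \<bar>hplus_weighted k b n\<bar>"
  using mult_right_mono[OF assms[of n], of "real n powr (-1 / real k)"]
  by (simp add: hplus_weighted_def distrib_right)

text \<open>Pointwise domination in place of addition lets one statement serve for differences,
  truncations and estimates by a perturbation.\<close>

lemma hplus_triangle:
  assumes "a \<in> hplus" "b \<in> hplus" "\<And>n. cmod (c n) \<le> cmod (a n) + cmod (b n)"
  shows "c \<in> hplus" "k \<ge> 1 \<Longrightarrow> hplus_seminorm k c \<le> hplus_seminorm k a + hplus_seminorm k b"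
proof -
  have "c 0 = 0" using assms(3)[of 0] assms(1,2) by (simp add: hplus_def)
  then show "c \<in> hplus"
    using l2_triangle(1)[OF hplus_weighted_summable[OF assms(1)] hplus_weighted_summable[OF assms(2)]
        hplus_weighted_triangle[of c, OF assms(3)]] by (auto simp: hplus_iff)
  show "hplus_seminorm k c \<le> hplus_seminorm k a + hplus_seminorm k b" if "k \<ge> 1"
    using l2_triangle(2)[OF hplus_weighted_summable[OF assms(1) that] hplus_weighted_summable[OF assms(2) that]
        hplus_weighted_triangle[of c, OF assms(3)]] by (auto simp: hplus_seminorm_eq)
qed

lemma hplus_diff: "a \<in> hplus \<Longrightarrow> b \<in> hplus \<Longrightarrow> (\<lambda>n. a n - b n) \<in> hplus"
  by (rule hplus_triangle(1)[OF _ _ norm_triangle_ineq4])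

lemma hplus_seminorm_scale:
  assumes "a \<in> hplus" "k \<ge> 1"
  shows "hplus_seminorm k (\<lambda>n. c * a n) = cmod c * hplus_seminorm k a"
proof -
  have "(\<Sum>n. (hplus_weighted k (\<lambda>n. c * a n) n)\<^sup>2) = (\<Sum>n. (cmod c)\<^sup>2 * (hplus_weighted k a n)\<^sup>2)"
    by (simp add: hplus_weighted_def norm_mult power_mult_distrib mult.assoc)
  also have "\<dots> = (cmod c)\<^sup>2 * (\<Sum>n. (hplus_weighted k a n)\<^sup>2)"
    by (rule suminf_mult[OF hplus_weighted_summable[OF assms]])
  finally show ?thesis by (simp add: hplus_seminorm_eq real_sqrt_mult)
qed

lemma hplus_scale: "a \<in> hplus \<Longrightarrow> (\<lambda>n. c * a n) \<in> hplus"
  unfolding hplus_iff hplus_weighted_def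
  by (auto simp: norm_mult power_mult_distrib mult.assoc intro: summable_mult)

lemma hplus_weighted_mono:
  assumes "j \<le> k" "j \<ge> 1"
  shows "hplus_weighted j a n \<le> hplus_weighted k a n"
proof -
  have "1 / real k \<le> 1 / real j" using assms by (simp add: frac_le)
  then have "real n powr (-1 / real j) \<le> real n powr (-1 / real k)"
    using nat_powr_antimono[of "1 / real k" "1 / real j" n] by simp
  then show ?thesis by (simp add: hplus_weighted_def mult_left_mono)
qed

text \<open>A larger index damps less, since n^(-1/k) increases with k. The seminorms therefore form
  an increasing family, and a finite intersection of concentric balls contains a ball.\<close>

lemma hplus_seminorm_mono:
  assumes "a \<in> hplus" "j \<le> k" "j \<ge> 1"
  shows "hplus_seminorm j a \<le> hplus_seminorm k a"
  unfolding hplus_seminorm_eq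
  using assms hplus_weighted_mono[OF assms(2,3), of a]
  by (intro real_sqrt_le_mono suminf_le hplus_weighted_summable power_mono)
     (auto simp: hplus_weighted_def)

lemma hplus_ball_mono:
  assumes "a \<in> hplus" "j \<le> k" "j \<ge> 1" "r \<le> s"
  shows "hplus_ball k a r \<subseteq> hplus_ball j a s"
  using hplus_seminorm_mono[OF hplus_diff[OF _ assms(1)] assms(2,3)] assms(4)
  by (fastforce simp: hplus_ball_def)

section \<open>Zero neighbourhoods and von Neumann boundedness\<close>

lemma topspace_hplus [simp]: "topspace hplus_topology = hplus"
proof -
  have "x \<in> \<Union> {hplus_ball k a r | k a r. k \<ge> 1 \<and> a \<in> hplus \<and> r > 0}" if "x \<in> hplus" for x
  proof (rule UnionI)
    show "x \<in> hplus_ball 1 x 1" using that by (simp add: hplus_ball_def)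
    show "hplus_ball 1 x 1 \<in> {hplus_ball k a r | k a r. k \<ge> 1 \<and> a \<in> hplus \<and> r > 0}"
      using that zero_less_one le_refl by blast
  qed
  then have "\<Union> {hplus_ball k a r | k a r. k \<ge> 1 \<and> a \<in> hplus \<and> r > 0} = hplus"
    by (auto simp: hplus_ball_def)
  then show ?thesis by (simp add: hplus_topology_def)
qed

lemma openin_hplus_ball: "k \<ge> 1 \<Longrightarrow> a \<in> hplus \<Longrightarrow> r > 0 \<Longrightarrow> openin hplus_topology (hplus_ball k a r)"
  unfolding hplus_topology_def by (rule topology_generated_by_Basis) blast

text \<open>The defining balls are a mere subbase, so the argument is an induction over the
  generated topology: an intersection takes the larger index and the smaller radius, and a ball with
  another centre is handled by the triangle inequality.\<close>

lemma openin_hplus_contains_ball: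
  assumes "openin hplus_topology V" "x \<in> V"
  shows "\<exists>k r. k \<ge> 1 \<and> r > 0 \<and> hplus_ball k x r \<subseteq> V"
proof -
  have x: "x \<in> hplus" using openin_subset[OF assms(1)] assms(2) by auto
  have "generate_topology_on {hplus_ball k a r | k a r. k \<ge> 1 \<and> a \<in> hplus \<and> r > 0} V"
    using assms(1) by (simp add: hplus_topology_def openin_topology_generated_by_iff)
  then show ?thesis using assms(2)
  proof induction
    case (Int V W)
    then obtain k r l s where *: "k \<ge> 1" "r > 0" "hplus_ball k x r \<subseteq> V" "l \<ge> 1" "s > 0" "hplus_ball l x s \<subseteq> W"
      by auto
    have "hplus_ball (max k l) x (min r s) \<subseteq> hplus_ball k x r \<inter> hplus_ball l x s"
      using * by (intro Int_greatest hplus_ball_mono x) auto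
    then show ?case using * by (intro exI[of _ "max k l"] exI[of _ "min r s"]) auto
  next
    case (Basis V)
    then obtain k a r where V: "V = hplus_ball k a r" "k \<ge> 1" "a \<in> hplus" "r > 0" by auto
    define s where "s = r - hplus_seminorm k (\<lambda>n. x n - a n)"
    have s: "s > 0" using Basis V by (simp add: s_def hplus_ball_def)
    have "hplus_ball k x s \<subseteq> V"
    proof
      fix b assume b: "b \<in> hplus_ball k x s"
      have "hplus_seminorm k (\<lambda>n. b n - a n)
          \<le> hplus_seminorm k (\<lambda>n. b n - x n) + hplus_seminorm k (\<lambda>n. x n - a n)"
      proof (rule hplus_triangle(2)[OF hplus_diff hplus_diff])
        show "cmod (b n - a n) \<le> cmod (b n - x n) + cmod (x n - a n)" for n
          using norm_triangle_ineq[of "b n - x n" "x n - a n"] by simp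
      qed (use b V x in \<open>auto simp: hplus_ball_def\<close>)
      then show "b \<in> V" using b by (simp add: V hplus_ball_def s_def)
    qed
    then show ?case using V s by blast
  qed blast+
qed

lemma zero_neighbourhood_contains_ball:
  assumes "zero_neighbourhood hplus_topology U"
  shows "\<exists>k r. k \<ge> 1 \<and> r > 0 \<and> hplus_ball k (\<lambda>_. 0) r \<subseteq> U"
  using assms openin_hplus_contains_ball unfolding zero_neighbourhood_def by (meson subset_trans)

lemma zero_neighbourhood_ball:
  assumes "k \<ge> 1" "r > 0"
  shows "zero_neighbourhood hplus_topology (hplus_ball k (\<lambda>_. 0) r)"
  unfolding zero_neighbourhood_def
  using openin_hplus_ball[OF assms(1) hplus_zero assms(2)] assms
  by (auto simp: hplus_ball_def intro!: exI[of _ "hplus_ball k (\<lambda>_. 0) r"])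

text \<open>The zero neighbourhood fixes k before the target index m is chosen, whereas for
  continuity k could depend on m. Homogeneity converts boundedness on a ball into an inequality of
  seminorms.\<close>

lemma bounded_operator_hplus_iff:
  assumes T: "\<And>a. a \<in> hplus \<Longrightarrow> T a \<in> hplus"
    and hom: "\<And>a c. a \<in> hplus \<Longrightarrow> T (\<lambda>n. c * a n) = (\<lambda>n. c * T a n)"
  shows "bounded_operator hplus_topology hplus_topology T \<longleftrightarrow>
    (\<exists>k\<ge>1. \<forall>m\<ge>1. \<exists>C. \<forall>a\<in>hplus. hplus_seminorm m (T a) \<le> C * hplus_seminorm k a)"
proof
  assume "bounded_operator hplus_topology hplus_topology T"
  then obtain U where U: "zero_neighbourhood hplus_topology U" "tvs_bounded hplus_topology (T ` U)"
    by (auto simp: bounded_operator_def)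
  obtain k r where k: "k \<ge> 1" "r > 0" "hplus_ball k (\<lambda>_. 0) r \<subseteq> U"
    using zero_neighbourhood_contains_ball[OF U(1)] by auto
  have "\<exists>C. \<forall>a\<in>hplus. hplus_seminorm m (T a) \<le> C * hplus_seminorm k a" if m: "m \<ge> 1" for m
  proof -
    obtain t where t: "t > 0" "\<And>c::complex. cmod c \<ge> t \<Longrightarrow>
        T ` U \<subseteq> (\<lambda>v n. c * v n) ` hplus_ball m (\<lambda>_. 0) 1"
      using U(2) zero_neighbourhood_ball[OF m, of 1] unfolding tvs_bounded_def by (meson zero_less_one)
    have small: "hplus_seminorm m (T a) \<le> t" if "a \<in> hplus" "hplus_seminorm k a < r" for a
    proof -
      have "a \<in> U" using that k by (auto simp: hplus_ball_def)
      moreover have "cmod (of_real t) \<ge> t" using t by simp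
      ultimately obtain v where v: "v \<in> hplus_ball m (\<lambda>_. 0) 1" "T a = (\<lambda>n. of_real t * v n)"
        using t(2)[of "of_real t"] by fast
      then have "hplus_seminorm m (T a) = t * hplus_seminorm m v"
        using m t by (simp add: hplus_ball_def hplus_seminorm_scale)
      also have "\<dots> \<le> t * 1" using v t by (intro mult_left_mono) (auto simp: hplus_ball_def)
      finally show ?thesis by simp
    qed
    have "hplus_seminorm m (T a) \<le> (2 * t / r) * hplus_seminorm k a" if a: "a \<in> hplus" for a
    proof (rule field_le_epsilon)
      fix e :: real assume e: "e > 0"
      \<comment> \<open>The positive summand keeps N away from 0 when the seminorm of
        \<open>a\<close> vanishes and puts the rescaled series strictly inside the ball; its size
        makes the final error e / 2.\<close>
      define N where "N = hplus_seminorm k a + e * r / (2 * t)"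
      have N: "N > 0" "hplus_seminorm k a < N"
        using hplus_seminorm_nonneg[OF a k(1)] e k t by (auto simp: N_def add_nonneg_pos)
      define c where "c = r / N"
      have c: "c > 0" using N k by (simp add: c_def)
      have "hplus_seminorm k (\<lambda>n. of_real c * a n) = c * hplus_seminorm k a"
        using a k c by (simp add: hplus_seminorm_scale)
      also have "\<dots> < r" using N k by (simp add: c_def field_simps)
      finally have "hplus_seminorm m (T (\<lambda>n. of_real c * a n)) \<le> t"
        using a by (intro small hplus_scale)
      then have "c * hplus_seminorm m (T a) \<le> t"
        using hom[OF a, of "of_real c"] T[OF a] m c by (simp add: hplus_seminorm_scale)
      then have "hplus_seminorm m (T a) \<le> t / r * N" using N k by (simp add: c_def field_simps)
      also have "\<dots> = t / r * hplus_seminorm k a + e / 2" using k t by (simp add: N_def field_simps)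
      also have "\<dots> \<le> (2 * t / r) * hplus_seminorm k a + e"
        using e k t hplus_seminorm_nonneg[OF a k(1)] by (intro add_mono mult_right_mono divide_right_mono) auto
      finally show "hplus_seminorm m (T a) \<le> (2 * t / r) * hplus_seminorm k a + e" .
    qed
    then show ?thesis by blast
  qed
  then show "\<exists>k\<ge>1. \<forall>m\<ge>1. \<exists>C. \<forall>a\<in>hplus. hplus_seminorm m (T a) \<le> C * hplus_seminorm k a"
    using k(1) by blast
next
  assume "\<exists>k\<ge>1. \<forall>m\<ge>1. \<exists>C. \<forall>a\<in>hplus. hplus_seminorm m (T a) \<le> C * hplus_seminorm k a"
  then obtain k where k: "k \<ge> 1"
    "\<And>m. m \<ge> 1 \<Longrightarrow> \<exists>C. \<forall>a\<in>hplus. hplus_seminorm m (T a) \<le> C * hplus_seminorm k a" by auto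
  define U where "U = hplus_ball k (\<lambda>_. 0) 1"
  have Uh: "a \<in> hplus" if "a \<in> U" for a using that by (simp add: U_def hplus_ball_def)
  have "tvs_bounded hplus_topology (T ` U)"
    unfolding tvs_bounded_def
  proof (intro conjI allI impI)
    show "T ` U \<subseteq> topspace hplus_topology" using T Uh by auto
    fix V assume "zero_neighbourhood hplus_topology V"
    then obtain m r where m: "m \<ge> 1" "r > 0" "hplus_ball m (\<lambda>_. 0) r \<subseteq> V"
      using zero_neighbourhood_contains_ball by blast
    obtain C where C: "\<And>a. a \<in> hplus \<Longrightarrow> hplus_seminorm m (T a) \<le> C * hplus_seminorm k a"
      using k(2)[OF m(1)] by auto
    \<comment> \<open>The added 1 gives the strict inequality that membership in an open ball
      requires.\<close>
    define t where "t = (\<bar>C\<bar> + 1) / r"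
    have t: "t > 0" using m by (simp add: t_def)
    show "\<exists>t>0. \<forall>c::complex. cmod c \<ge> t \<longrightarrow> T ` U \<subseteq> (\<lambda>v n. c * v n) ` V"
    proof (intro exI[of _ t] conjI t allI impI)
      fix c :: complex assume c: "cmod c \<ge> t"
      then have c0: "c \<noteq> 0" using t by auto
      show "T ` U \<subseteq> (\<lambda>v n. c * v n) ` V"
      proof
        fix b assume "b \<in> T ` U"
        then obtain a where a: "a \<in> U" "b = T a" by auto
        define v where "v = (\<lambda>n. inverse c * b n)"
        have b: "b \<in> hplus" using a T Uh by auto
        have "hplus_seminorm m b \<le> C * hplus_seminorm k a" using C Uh a by auto
        also have "\<dots> \<le> \<bar>C\<bar> * 1"
          using a hplus_seminorm_nonneg[OF Uh k(1)]
          by (intro mult_mono) (auto simp: U_def hplus_ball_def)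
        also have "\<dots> < r * t" using m by (simp add: t_def)
        also have "\<dots> \<le> r * cmod c" using c m by simp
        finally have "inverse (cmod c) * hplus_seminorm m b < r"
          using c0 by (simp add: field_simps)
        then have "hplus_seminorm m v < r"
          using b m by (simp add: v_def hplus_seminorm_scale norm_inverse)
        then have "v \<in> V" using m b hplus_scale[OF b] by (auto simp: hplus_ball_def v_def)
        moreover have "b = (\<lambda>n. c * v n)" using c0 by (auto simp: v_def)
        ultimately show "b \<in> (\<lambda>v n. c * v n) ` V" by blast
      qed
    qed
  qed
  then show "bounded_operator hplus_topology hplus_topology T"
    using zero_neighbourhood_ball[OF k(1), of 1] by (auto simp: bounded_operator_def U_def)
qed

section \<open>Truncations and the half-plane of absolute convergence\<close>

definition truncate :: "nat set \<Rightarrow> (nat \<Rightarrow> complex) \<Rightarrow> nat \<Rightarrow> complex" where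
  "truncate S a n = (if n \<in> S then a n else 0)"

lemma truncate_hplus: "a \<in> hplus \<Longrightarrow> truncate S a \<in> hplus"
  by (rule hplus_triangle(1)[OF _ hplus_zero]) (auto simp: truncate_def)

lemma truncate_tendsto:
  assumes a: "a \<in> hplus" and k: "k \<ge> 1"
  shows "(\<lambda>N. hplus_seminorm k (\<lambda>n. truncate {..<N} a n - a n)) \<longlonglongrightarrow> 0"
proof -
  define f where "f = (\<lambda>n. (hplus_weighted k a n)\<^sup>2)"
  have f: "summable f" unfolding f_def by (rule hplus_weighted_summable[OF a k])
  have "(\<Sum>n. (hplus_weighted k (\<lambda>n. truncate {..<N} a n - a n) n)\<^sup>2) = suminf f - sum f {..<N}" for N
  proof -
    have "(\<lambda>n. if n \<in> {..<N} then f n else 0) sums sum f {..<N}"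
      by (rule sums_If_finite_set) simp
    from sums_diff[OF summable_sums[OF f] this]
    have "(\<lambda>n. (hplus_weighted k (\<lambda>n. truncate {..<N} a n - a n) n)\<^sup>2) sums (suminf f - sum f {..<N})"
      by (rule sums_cong[THEN iffD1, rotated]) (auto simp: f_def truncate_def hplus_weighted_def)
    then show ?thesis by (simp add: sums_iff)
  qed
  moreover have "(\<lambda>N. sqrt (suminf f - sum f {..<N})) \<longlonglongrightarrow> sqrt (suminf f - suminf f)"
    by (intro tendsto_intros summable_LIMSEQ f)
  ultimately show ?thesis by (simp add: hplus_seminorm_eq)
qed

text \<open>The truncations are Dirichlet polynomials that tend to \<open>a\<close> in every
  seminorm, so continuity of T along this one sequence carries estimates from polynomials to all of
  \<open>hplus\<close>.\<close>

lemma continuous_map_truncate_tendsto: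
  assumes T: "continuous_map hplus_topology hplus_topology T" and a: "a \<in> hplus" and m: "m \<ge> 1"
  shows "(\<lambda>N. hplus_seminorm m (\<lambda>n. T (truncate {..<N} a) n - T a n)) \<longlonglongrightarrow> 0"
proof (rule tendstoI)
  fix e :: real assume e: "e > 0"
  have Ta: "T a \<in> hplus" using T a by (auto simp: continuous_map_def)
  define W where "W = {x \<in> hplus. T x \<in> hplus_ball m (T a) e}"
  have W: "openin hplus_topology W"
    using T openin_hplus_ball[OF m Ta e] by (simp add: continuous_map_def W_def)
  have "a \<in> W" using a Ta e by (simp add: W_def hplus_ball_def)
  from openin_hplus_contains_ball[OF W this]
  obtain k r where k: "k \<ge> 1" "r > 0" "hplus_ball k a r \<subseteq> W" by auto
  have "\<forall>\<^sub>F N in sequentially. hplus_seminorm k (\<lambda>n. truncate {..<N} a n - a n) < r"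
    using truncate_tendsto[OF a k(1)] k(2) by (rule order_tendstoD(2))
  then show "\<forall>\<^sub>F N in sequentially. dist (hplus_seminorm m (\<lambda>n. T (truncate {..<N} a) n - T a n)) 0 < e"
  proof eventually_elim
    case (elim N)
    then have "truncate {..<N} a \<in> W" using k truncate_hplus[OF a] by (auto simp: hplus_ball_def)
    then show ?case using hplus_seminorm_nonneg[OF hplus_diff[OF _ Ta] m]
      by (auto simp: W_def hplus_ball_def)
  qed
qed

text \<open>Cauchy--Schwarz against \<open>(n\<^sup>-\<^sup>\<sigma>\<^sup>+\<^sup>1\<^sup>/\<^sup>k)\<close> restricted to \<open>S\<close>: a truncation to a thin set of indices
  converges further to the left than the series itself.\<close>

lemma hplus_truncate_bound:
  assumes a: "a \<in> hplus" and k: "k \<ge> 1"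
    and S: "summable (\<lambda>n. if n \<in> S then real n powr (-(2 * \<sigma> - 2 / real k)) else 0)"
  shows "abs_conv (truncate S a) \<sigma>"
    and "Re s \<ge> \<sigma> \<Longrightarrow> cmod (dirichlet_eval (truncate S a) s) \<le> hplus_seminorm k a *
      sqrt (\<Sum>n. if n \<in> S then real n powr (-(2 * \<sigma> - 2 / real k)) else 0)"
proof -
  \<comment> \<open>The complementary weight: n^(-1/k) times n^(1/k - \<sigma>) is
    n^(-\<sigma>).\<close>
  define y where "y = (\<lambda>n. if n \<in> S then real n powr (1 / real k - \<sigma>) else 0)"
  have y2: "(y n)\<^sup>2 = (if n \<in> S then real n powr (-(2 * \<sigma> - 2 / real k)) else 0)" for n
    by (simp add: y_def power2_eq_square flip: powr_add)
  have y: "summable (\<lambda>n. (y n)\<^sup>2)" using S by (simp add: y2)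
  have eq: "cmod (truncate S a n) * real n powr (-\<sigma>) = \<bar>hplus_weighted k a n\<bar> * \<bar>y n\<bar>" for n
    by (simp add: truncate_def y_def hplus_weighted_def mult.assoc flip: powr_add)
  note CS = summable_Cauchy_Schwarz[OF hplus_weighted_summable[OF a k] y]
  show ac: "abs_conv (truncate S a) \<sigma>" using CS(1) by (simp add: abs_conv_def eq)
  assume s: "Re s \<ge> \<sigma>"
  have "cmod (dirichlet_eval (truncate S a) s) \<le> (\<Sum>n. cmod (truncate S a n) * real n powr (-\<sigma>))"
    unfolding dirichlet_eval_def
    using ac s by (intro norm_suminf_le) (auto simp: norm_dirichlet_term abs_conv_def
        intro!: mult_left_mono nat_powr_antimono)
  also have "\<dots> \<le> hplus_seminorm k a * sqrt (\<Sum>n. (y n)\<^sup>2)"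
    using CS(2) by (simp add: eq hplus_seminorm_eq)
  finally show "cmod (dirichlet_eval (truncate S a) s) \<le> hplus_seminorm k a *
      sqrt (\<Sum>n. if n \<in> S then real n powr (-(2 * \<sigma> - 2 / real k)) else 0)" by (simp add: y2)
qed

lemma truncate_UNIV [simp]: "truncate UNIV a = a"
  by (auto simp: truncate_def)

lemma real_gt_inverse_nat:
  assumes "x > 0"
  obtains k :: nat where "k \<ge> 1" "1 / real k < x"
  using reals_Archimedean[OF assms] by (metis Suc_le_eq inverse_eq_divide zero_less_Suc One_nat_def)

text \<open>A k with 1/k below \<sigma> - 1/2 leaves the exponent 2\<sigma> - 2/k > 1, so
  Cauchy-Schwarz works without thinning the indices.\<close>

lemma hplus_abs_conv:
  assumes a: "a \<in> hplus" and \<sigma>: "\<sigma> > 1/2"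
  shows "abs_conv a \<sigma>"
proof -
  obtain k :: nat where k: "k \<ge> 1" "1 / real k < \<sigma> - 1/2" using real_gt_inverse_nat[of "\<sigma> - 1/2"] \<sigma> by auto
  have "summable (\<lambda>n. real n powr (-(2 * \<sigma> - 2 / real k)))" using k by (intro summable_nat_powr) auto
  from hplus_truncate_bound(1)[OF a k(1), of UNIV] this show ?thesis by simp
qed

section \<open>Dirichlet convolution and smooth numbers\<close>

definition dirichlet_conv :: "(nat \<Rightarrow> complex) \<Rightarrow> (nat \<Rightarrow> complex) \<Rightarrow> nat \<Rightarrow> complex" where
  "dirichlet_conv a b n = (if n = 0 then 0 else \<Sum>d | d dvd n. a d * b (n div d))"

lemma dirichlet_conv_0 [simp]: "dirichlet_conv a b 0 = 0"
  by (simp add: dirichlet_conv_def)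

lemma nat_powr_mult: "(of_nat (m * k) :: complex) powr z = of_nat m powr z * of_nat k powr z"
  using powr_times_real[of "of_nat m" "of_nat k" z] by simp

lemma norm_summable_on_Times:
  fixes f :: "'i \<Rightarrow> 'a::real_normed_div_algebra" and g :: "'j \<Rightarrow> 'a"
  assumes "(\<lambda>m. norm (f m)) summable_on A" "(\<lambda>k. norm (g k)) summable_on B"
  shows "(\<lambda>p. norm ((\<lambda>(m,k). f m * g k) p)) summable_on A \<times> B"
proof (rule summable_on_SigmaI)
  show "((\<lambda>k. norm ((\<lambda>(m,k). f m * g k) (m, k))) has_sum norm (f m) * infsum (\<lambda>k. norm (g k)) B) B" for m
    using has_sum_cmult_right[OF has_sum_infsum[OF assms(2)], of "norm (f m)"] by (simp add: norm_mult)
  show "(\<lambda>m. norm (f m) * infsum (\<lambda>k. norm (g k)) B) summable_on A"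
    by (intro summable_on_cmult_left assms)
qed auto

text \<open>The absolutely summable double family of products is regrouped by the product of its
  indices: a pair (m, k) of positive numbers is the same as n = m k together with its divisor
  m.\<close>

lemma dirichlet_conv_sums:
  assumes a: "abs_conv a \<sigma>" and b: "abs_conv b \<sigma>" and 0: "a 0 = 0" "b 0 = 0" and s: "\<sigma> \<le> Re s"
  shows "dirichlet_term (dirichlet_conv a b) s sums (dirichlet_eval a s * dirichlet_eval b s)"
proof -
  define A where "A = dirichlet_term a s"
  define B where "B = dirichlet_term b s"
  define D where "D = (SIGMA n:{1::nat..}. {d. d dvd n})"
  have nA: "summable (\<lambda>n. norm (A n))" and nB: "summable (\<lambda>n. norm (B n))"
    unfolding A_def B_def using abs_conv_summable_norm a b s by blast+
  have hA: "(A has_sum dirichlet_eval a s) UNIV" and hB: "(B has_sum dirichlet_eval b s) UNIV"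
    using norm_summable_imp_has_sum nA nB abs_conv_sums a b s unfolding A_def B_def by blast+
  have "(\<lambda>p. norm ((\<lambda>(m,k). A m * B k) p)) summable_on UNIV \<times> UNIV"
    using nA nB by (intro norm_summable_on_Times) (auto intro: summable_nonneg_imp_summable_on)
  then have "(\<lambda>(m,k). A m * B k) summable_on UNIV \<times> UNIV" by (rule abs_summable_summable)
  then have "((\<lambda>(m,k). A m * B k) has_sum (dirichlet_eval a s * dirichlet_eval b s)) (UNIV \<times> UNIV)"
    by (intro has_sum_SigmaI[where g = "\<lambda>m. A m * dirichlet_eval b s"])
       (auto intro: has_sum_cmult_right has_sum_cmult_left hA hB)
  then have "((\<lambda>(m,k). A m * B k) has_sum (dirichlet_eval a s * dirichlet_eval b s)) ({1..} \<times> {1..})"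
    by (rule has_sum_cong_neutral[THEN iffD1, rotated -1])
       (auto simp: A_def B_def dirichlet_term_def not_le 0 intro: Suc_leI)
  moreover have bij: "bij_betw (\<lambda>(n,d). (d, n div d)) D ({1..} \<times> {1..})"
    by (rule bij_betwI[where g = "\<lambda>(m,k). (m * k, m)"])
       (auto simp: D_def Suc_le_eq dvd_div_eq_0_iff intro: dvd_pos_nat elim!: dvdE)
  ultimately have "((\<lambda>x. (\<lambda>(m,k). A m * B k) ((\<lambda>(n,d). (d, n div d)) x)) has_sum
      (dirichlet_eval a s * dirichlet_eval b s)) D"
    by (simp only: has_sum_reindex_bij_betw[OF bij])
  then have h: "((\<lambda>(n,d). A d * B (n div d)) has_sum (dirichlet_eval a s * dirichlet_eval b s)) D"
    by (simp add: case_prod_unfold)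
  have "(dirichlet_term (dirichlet_conv a b) s has_sum (dirichlet_eval a s * dirichlet_eval b s)) {1..}"
  proof (rule has_sum_SigmaD[OF h[unfolded D_def]])
    fix n :: nat assume n: "n \<in> {1..}"
    then have fin: "finite {d. d dvd n}" by (intro finite_divisors_nat) auto
    have "(\<Sum>d | d dvd n. A d * B (n div d)) = (\<Sum>d | d dvd n. a d * b (n div d) * of_nat n powr (-s))"
    proof (intro sum.cong refl)
      fix d assume "d \<in> {d. d dvd n}"
      then have "n = d * (n div d)" by simp
      then have "(of_nat n :: complex) powr (-s) = of_nat d powr (-s) * of_nat (n div d) powr (-s)"
        using nat_powr_mult by metis
      then show "A d * B (n div d) = a d * b (n div d) * of_nat n powr (-s)"
        by (simp add: A_def B_def dirichlet_term_def)
    qed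
    also have "\<dots> = dirichlet_term (dirichlet_conv a b) s n"
      using n by (simp add: dirichlet_term_def dirichlet_conv_def sum_distrib_right)
    finally have "(\<Sum>d | d dvd n. A d * B (n div d)) = dirichlet_term (dirichlet_conv a b) s n" .
    then show "((\<lambda>y. case (n, y) of (n, d) \<Rightarrow> A d * B (n div d)) has_sum
        dirichlet_term (dirichlet_conv a b) s n) {d. d dvd n}"
      using has_sum_finite[OF fin, of "\<lambda>d. A d * B (n div d)"] by simp
  qed
  then have "(dirichlet_term (dirichlet_conv a b) s has_sum (dirichlet_eval a s * dirichlet_eval b s)) UNIV"
    by (rule has_sum_cong_neutral[THEN iffD1, rotated -1])
       (auto simp: dirichlet_term_def not_le)
  then show ?thesis by (rule has_sum_imp_sums)
qed

text \<open>At the real point \<sigma>, the product formula for the moduli of the coefficients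
  yields a convergent series with nonnegative terms that dominates the convolution.\<close>

lemma dirichlet_conv_abs_conv:
  assumes a: "abs_conv a \<sigma>" and b: "abs_conv b \<sigma>" and 0: "a 0 = 0" "b 0 = 0"
  shows "abs_conv (dirichlet_conv a b) \<sigma>"
proof -
  define a' b' where "a' = (\<lambda>n. of_real (cmod (a n)) :: complex)" "b' = (\<lambda>n. of_real (cmod (b n)) :: complex)"
  have ab: "abs_conv a' \<sigma>" "abs_conv b' \<sigma>"
    using a b by (auto simp: a'_b'_def abs_conv_def)
  define c where "c = (\<lambda>n. if n = 0 then 0 else \<Sum>d | d dvd n. cmod (a d) * cmod (b (n div d)))"
  have "dirichlet_conv a' b' n = of_real (c n)" for n
    by (simp add: dirichlet_conv_def c_def a'_b'_def)
  then have "dirichlet_term (dirichlet_conv a' b') (of_real \<sigma>) n = of_real (c n * real n powr (-\<sigma>))" for n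
    by (simp add: dirichlet_term_def) (metis Reals_of_real of_nat_0_le_iff of_real_of_nat_eq powr_of_real of_real_minus)
  then have "dirichlet_term (dirichlet_conv a' b') (of_real \<sigma>) = (\<lambda>n. of_real (c n * real n powr (-\<sigma>)))"
    by blast
  moreover have "summable (dirichlet_term (dirichlet_conv a' b') (of_real \<sigma>))"
    by (rule sums_summable[OF dirichlet_conv_sums[OF ab]]) (simp_all add: a'_b'_def 0)
  ultimately have "summable (\<lambda>n. of_real (c n * real n powr (-\<sigma>)) :: complex)" by simp
  then have sc: "summable (\<lambda>n. c n * real n powr (-\<sigma>))" by (simp only: summable_complex_of_real)
  have "cmod (dirichlet_conv a b n) \<le> c n" for n
    by (simp add: dirichlet_conv_def c_def norm_mult[symmetric] norm_sum)
  then show ?thesis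
    unfolding abs_conv_def
    by (intro summable_comparison_test'[OF sc, where N=0]) (simp add: mult_right_mono)
qed

lemma dirichlet_eval_conv:
  assumes "abs_conv a \<sigma>" "abs_conv b \<sigma>" "a 0 = 0" "b 0 = 0" "\<sigma> \<le> Re s"
  shows "dirichlet_eval (dirichlet_conv a b) s = dirichlet_eval a s * dirichlet_eval b s"
  using sums_unique[OF dirichlet_conv_sums[OF assms]] by (simp add: dirichlet_eval_def)

text \<open>The equivalence says that S is closed under products and divisors. All factorisations of
  an element of S stay in S, and every factorisation of a number outside S has a factor outside
  S.\<close>

lemma truncate_conv:
  assumes "\<And>m k. m * k \<in> S \<longleftrightarrow> m \<in> S \<and> k \<in> S"
  shows "truncate S (dirichlet_conv a b) = dirichlet_conv (truncate S a) (truncate S b)"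
proof
  fix n
  have "truncate S a d * truncate S b (n div d) = (if n \<in> S then a d * b (n div d) else 0)"
    if "d dvd n" for d using assms[of d "n div d"] that by (auto simp: truncate_def)
  then have "(\<Sum>d | d dvd n. truncate S a d * truncate S b (n div d)) =
      (\<Sum>d | d dvd n. if n \<in> S then a d * b (n div d) else 0)"
    by (intro sum.cong) auto
  then show "truncate S (dirichlet_conv a b) n = dirichlet_conv (truncate S a) (truncate S b) n"
    unfolding dirichlet_conv_def by (auto simp: truncate_def[of S "\<lambda>n. if n = 0 then 0 else _ n"])
qed

section \<open>Smooth numbers and smooth parts\<close>

definition smooth_numbers :: "nat \<Rightarrow> nat set" where
  "smooth_numbers d = {n. n > 0 \<and> (\<forall>p. prime p \<longrightarrow> p dvd n \<longrightarrow> p < d)}"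

lemma smooth_numbers_mult: "m * k \<in> smooth_numbers d \<longleftrightarrow> m \<in> smooth_numbers d \<and> k \<in> smooth_numbers d"
  by (auto simp: smooth_numbers_def prime_dvd_mult_iff)

lemma less_in_smooth_numbers: "0 < n \<Longrightarrow> n < d \<Longrightarrow> n \<in> smooth_numbers d"
  unfolding smooth_numbers_def by (auto dest: dvd_imp_le)

text \<open>A finite Euler product, built up one prime at a time: when d is prime, each number
  smooth for \<open>Suc d\<close> is uniquely a power of d times a d-smooth number, and the new
  factor is a geometric series. With finitely many primes this converges for every \<delta> > 0, not
  just for \<delta> > 1.\<close>

lemma summable_on_smooth_numbers:
  fixes \<delta> :: real
  assumes \<delta>: "\<delta> > 0"
  shows "(\<lambda>n. real n powr (-\<delta>)) summable_on smooth_numbers d"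
proof (induction d)
  case 0
  have "n = 1" if "n \<in> smooth_numbers 0" for n
  proof (rule ccontr)
    assume "n \<noteq> 1"
    then obtain p where "prime p" "p dvd n" using prime_factor_nat by blast
    then show False using that unfolding smooth_numbers_def by simp
  qed
  then have "smooth_numbers 0 \<subseteq> {1}" by blast
  then have "finite (smooth_numbers 0)" by (rule finite_subset) simp
  then show ?case by (rule summable_on_finite)
next
  case (Suc d)
  show ?case
  proof (cases "prime d")
    case False
    then have "smooth_numbers (Suc d) = smooth_numbers d"
      using less_Suc_eq by (auto simp: smooth_numbers_def)
    then show ?thesis using Suc by simp
  next
    case True
    define g where "g = (\<lambda>n. (multiplicity d n, n div d ^ multiplicity d n))"
    define F where "F = (\<lambda>(j::nat, m::nat). (real d powr (-\<delta>)) ^ j * real m powr (-\<delta>))"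
    have d: "d > 1" using True by (rule prime_gt_1_nat)
    have g_mult: "d ^ multiplicity d n * (n div d ^ multiplicity d n) = n" for n
      by (simp add: multiplicity_dvd)
    have g_in: "g n \<in> UNIV \<times> smooth_numbers d" if n: "n \<in> smooth_numbers (Suc d)" for n
    proof -
      define m where "m = n div d ^ multiplicity d n"
      have eq: "d ^ multiplicity d n * m = n" unfolding m_def by (rule g_mult)
      then have m: "m \<in> smooth_numbers (Suc d)" using n smooth_numbers_mult by metis
      have "\<not> d dvd m" using n d unfolding m_def
        by (intro multiplicity_decompose) (auto simp: smooth_numbers_def)
      then have "m \<in> smooth_numbers d" using m less_Suc_eq by (auto simp: smooth_numbers_def)
      then show ?thesis by (simp add: g_def m_def)
    qed
    have inj: "inj_on g (smooth_numbers (Suc d))"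
      by (rule inj_onI) (metis g_def g_mult prod.inject)
    have "(\<lambda>j. norm ((real d powr (-\<delta>)) ^ j)) summable_on UNIV"
    proof -
      have "real d powr (-\<delta>) < 1" using d \<delta> by (simp add: powr_minus_divide)
      then have "summable (\<lambda>j. (real d powr (-\<delta>)) ^ j)" by (intro summable_geometric) simp
      then show ?thesis by (simp add: norm_power summable_on_UNIV_nonneg_real_iff)
    qed
    moreover have "(\<lambda>n. norm (real n powr (-\<delta>))) summable_on smooth_numbers d" using Suc by simp
    ultimately have "(\<lambda>p. norm (F p)) summable_on UNIV \<times> smooth_numbers d"
      unfolding F_def by (rule norm_summable_on_Times)
    then have "F summable_on UNIV \<times> smooth_numbers d" by (rule abs_summable_summable)
    then have "F summable_on g ` smooth_numbers (Suc d)"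
      by (rule summable_on_subset_banach) (use g_in in blast)
    then have "(F \<circ> g) summable_on smooth_numbers (Suc d)" by (simp add: summable_on_reindex[OF inj])
    moreover have "(F \<circ> g) n = real n powr (-\<delta>)" for n
    proof -
      have "(F \<circ> g) n = real (d ^ multiplicity d n) powr (-\<delta>) * real (n div d ^ multiplicity d n) powr (-\<delta>)"
        using d by (simp add: F_def g_def powr_power powr_realpow[symmetric] powr_powr mult.commute)
      also have "\<dots> = real (d ^ multiplicity d n * (n div d ^ multiplicity d n)) powr (-\<delta>)"
        by (simp only: of_nat_mult) (simp add: powr_mult)
      finally show ?thesis by (simp only: g_mult)
    qed
    ultimately show ?thesis by (simp add: o_def)
  qed
qed

lemma summable_smooth_numbers:
  assumes "\<delta> > 0"
  shows "summable (\<lambda>n. if n \<in> smooth_numbers d then real n powr (-\<delta>) else 0)"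
proof -
  have "(\<lambda>n. if n \<in> smooth_numbers d then real n powr (-\<delta>) else 0) summable_on UNIV"
    using summable_on_smooth_numbers[OF assms, of d]
    by (rule summable_on_cong_neutral[THEN iffD1, rotated -1]) auto
  then show ?thesis by (rule summable_on_imp_summable)
qed

definition smooth_part :: "nat \<Rightarrow> (nat \<Rightarrow> complex) \<Rightarrow> nat \<Rightarrow> complex" where
  "smooth_part d = truncate (smooth_numbers d)"

lemma smooth_part_0 [simp]: "smooth_part d a 0 = 0"
  by (simp add: smooth_part_def truncate_def smooth_numbers_def)

text \<open>The reason for passing to smooth parts: they converge absolutely on the whole of
  \<open>half_plane 0\<close>, with a bound depending only on a seminorm.\<close>

lemma smooth_part_bound:
  assumes "\<sigma> > 0"
  obtains m K where "m \<ge> 1" "\<And>a s. a \<in> hplus \<Longrightarrow> Re s \<ge> \<sigma> \<Longrightarrow>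
    cmod (dirichlet_eval (smooth_part d a) s) \<le> K * hplus_seminorm m a"
proof -
  obtain m :: nat where m: "m \<ge> 1" "1 / real m < \<sigma>" using real_gt_inverse_nat assms by blast
  have "summable (\<lambda>n. if n \<in> smooth_numbers d then real n powr (-(2 * \<sigma> - 2 / real m)) else 0)"
    using m by (intro summable_smooth_numbers) (simp add: field_simps)
  note b = hplus_truncate_bound(2)[OF _ m(1) this]
  show ?thesis
  proof (rule that[OF m(1)])
    fix a s assume "a \<in> hplus" "Re s \<ge> \<sigma>"
    from b[OF this] show "cmod (dirichlet_eval (smooth_part d a) s) \<le>
      sqrt (\<Sum>n. if n \<in> smooth_numbers d then real n powr (-(2 * \<sigma> - 2 / real m)) else 0) * hplus_seminorm m a"
      by (simp only: smooth_part_def mult.commute)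
  qed
qed

lemma smooth_part_abs_conv:
  assumes "a \<in> hplus" "\<sigma> > 0"
  shows "abs_conv (smooth_part d a) \<sigma>"
proof -
  obtain m :: nat where m: "m \<ge> 1" "1 / real m < \<sigma>" using real_gt_inverse_nat assms by blast
  have "summable (\<lambda>n. if n \<in> smooth_numbers d then real n powr (-(2 * \<sigma> - 2 / real m)) else 0)"
    using m by (intro summable_smooth_numbers) (simp add: field_simps)
  from hplus_truncate_bound(1)[OF assms(1) m(1) this] show ?thesis by (simp add: smooth_part_def)
qed

lemma smooth_part_conv:
  "smooth_part d (dirichlet_conv a b) = dirichlet_conv (smooth_part d a) (smooth_part d b)"
  unfolding smooth_part_def by (rule truncate_conv[OF smooth_numbers_mult])

lemma smooth_part_eval_conv:
  assumes "a \<in> hplus" "b \<in> hplus" "Re s > 0"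
  shows "dirichlet_eval (smooth_part d (dirichlet_conv a b)) s =
    dirichlet_eval (smooth_part d a) s * dirichlet_eval (smooth_part d b) s"
  unfolding smooth_part_conv
  by (rule dirichlet_eval_conv[where \<sigma> = "Re s"]) (auto intro: smooth_part_abs_conv assms)

lemma smooth_part_holomorphic:
  assumes "a \<in> hplus"
  shows "dirichlet_eval (smooth_part d a) holomorphic_on half_plane 0"
  unfolding holomorphic_on_open[OF half_plane_props(1)]
proof
  fix s assume "s \<in> half_plane 0"
  then show "\<exists>f'. (dirichlet_eval (smooth_part d a) has_field_derivative f') (at s)"
    using dirichlet_eval_has_derivative[OF smooth_part_abs_conv[OF assms, of "Re s / 2"], of s] by auto
qed

text \<open>Every positive index below d is d-smooth, so the error is at most the tail from d on of
  the series of absolute values.\<close>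

lemma smooth_part_tendsto:
  assumes a: "abs_conv a \<sigma>" "a 0 = 0" and s: "Re s \<ge> \<sigma>"
  shows "(\<lambda>d. dirichlet_eval (smooth_part d a) s) \<longlonglongrightarrow> dirichlet_eval a s"
proof -
  define f where "f = (\<lambda>n. cmod (dirichlet_term a s n))"
  have f: "summable f" unfolding f_def by (rule abs_conv_summable_norm[OF a(1) s])
  have ac: "abs_conv (smooth_part d a) \<sigma>" for d
    by (rule abs_conv_comparison[OF a(1), where K=1]) (simp add: smooth_part_def truncate_def)
  have le: "norm (dirichlet_eval (smooth_part d a) s - dirichlet_eval a s) \<le> suminf f - sum f {..<d}" for d
  proof -
    have t: "(\<lambda>n. dirichlet_term (smooth_part d a) s n - dirichlet_term a s n) sums
        (dirichlet_eval (smooth_part d a) s - dirichlet_eval a s)"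
      using ac a s by (intro sums_diff abs_conv_sums)
    have "(\<lambda>n. if n \<in> {..<d} then f n else 0) sums sum f {..<d}"
      by (rule sums_If_finite_set) simp
    from sums_diff[OF summable_sums[OF f] this]
    have g: "(\<lambda>n. if n < d then 0 else f n) sums (suminf f - sum f {..<d})"
      by (rule sums_cong[THEN iffD1, rotated]) auto
    have "norm (dirichlet_term (smooth_part d a) s n - dirichlet_term a s n) \<le> (if n < d then 0 else f n)" for n
      using less_in_smooth_numbers[of n d] a(2)
      by (cases "n = 0") (auto simp: f_def dirichlet_term_def smooth_part_def truncate_def)
    from norm_suminf_le[OF this sums_summable[OF g]] show ?thesis
      by (simp only: sums_unique[OF t, symmetric] sums_unique[OF g, symmetric])
  qed
  have "(\<lambda>d. suminf f - sum f {..<d}) \<longlonglongrightarrow> suminf f - suminf f"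
    by (intro tendsto_intros summable_LIMSEQ f)
  then have "(\<lambda>d. suminf f - sum f {..<d}) \<longlonglongrightarrow> 0" by simp
  then have "(\<lambda>d. dirichlet_eval (smooth_part d a) s - dirichlet_eval a s) \<longlonglongrightarrow> 0"
    by (rule Lim_null_comparison[rotated]) (simp add: le)
  then show ?thesis by (rule LIM_zero_cancel)
qed

section \<open>Means on vertical lines\<close>

text \<open>Continuity is included so that all integrals over bounded intervals exist. The notion is
  a relation because the limit need not exist.\<close>

definition has_mean :: "(real \<Rightarrow> complex) \<Rightarrow> complex \<Rightarrow> bool" where
  "has_mean f L \<longleftrightarrow> continuous_on UNIV f \<and>
     ((\<lambda>T. integral {-T..T} f / of_real (2 * T)) \<longlongrightarrow> L) at_top"

lemma has_meanD:
  assumes "has_mean f L"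
  shows "continuous_on UNIV f" "((\<lambda>T. integral {-T..T} f / of_real (2 * T)) \<longlongrightarrow> L) at_top"
  using assms by (simp_all add: has_mean_def)

lemma continuous_on_UNIV_integrable:
  fixes f :: "real \<Rightarrow> complex"
  shows "continuous_on UNIV f \<Longrightarrow> f integrable_on {a..b}"
  by (rule integrable_continuous_interval) (rule continuous_on_subset, auto)

lemma has_mean_const: "has_mean (\<lambda>_. c) c"
  unfolding has_mean_def
proof
  have "\<forall>\<^sub>F T in at_top. c = integral {-T..T} (\<lambda>_. c) / of_real (2 * T)"
    using eventually_gt_at_top[of 0] by eventually_elim (simp add: scaleR_conv_of_real)
  then show "((\<lambda>T. integral {-T..T} (\<lambda>_. c) / of_real (2 * T)) \<longlongrightarrow> c) at_top"
    by (rule Lim_transform_eventually[OF tendsto_const])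
qed auto

lemma has_mean_cmult: "has_mean f L \<Longrightarrow> has_mean (\<lambda>t. c * f t) (c * L)"
  unfolding has_mean_def
  by (auto intro!: continuous_intros simp: integral_mult_right mult.assoc[symmetric] times_divide_eq_right[symmetric]
      simp del: times_divide_eq_right intro: tendsto_mult_left)

lemma has_mean_add:
  assumes "has_mean f L" "has_mean g M"
  shows "has_mean (\<lambda>t. f t + g t) (L + M)"
proof -
  have "integral {-T..T} (\<lambda>t. f t + g t) / of_real (2 * T)
      = integral {-T..T} f / of_real (2 * T) + integral {-T..T} g / of_real (2 * T)" for T :: real
    using assms by (simp add: has_mean_def integral_add continuous_on_UNIV_integrable add_divide_distrib)
  then show ?thesis using assms
    unfolding has_mean_def by (auto intro!: continuous_intros tendsto_add)
qed

lemma has_mean_diff: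
  assumes "has_mean f L" "has_mean g M"
  shows "has_mean (\<lambda>t. f t - g t) (L - M)"
  using has_mean_add[OF assms(1) has_mean_cmult[OF assms(2), of "-1"]] by simp

lemma has_mean_sum:
  assumes "finite I" "\<And>i. i \<in> I \<Longrightarrow> has_mean (f i) (L i)"
  shows "has_mean (\<lambda>t. \<Sum>i\<in>I. f i t) (\<Sum>i\<in>I. L i)"
  using assms by (induction I) (auto intro: has_mean_add has_mean_const)

lemma has_mean_cnj:
  assumes "has_mean f L"
  shows "has_mean (\<lambda>t. cnj (f t)) (cnj L)"
proof -
  have eq: "integral {-T..T} (\<lambda>t. cnj (f t)) / of_real (2 * T) = cnj (integral {-T..T} f / of_real (2 * T))" for T :: real
    by (simp add: integral_cnj)
  have "((\<lambda>T. cnj (integral {-T..T} f / of_real (2 * T))) \<longlongrightarrow> cnj L) at_top"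
    by (rule tendsto_cnj[OF has_meanD(2)[OF assms]])
  then show ?thesis
    unfolding has_mean_def eq by (intro conjI continuous_intros has_meanD(1)[OF assms])
qed

lemma has_mean_mono:
  assumes f: "has_mean f L" and g: "has_mean g M" and le: "\<And>t. Re (f t) \<le> Re (g t)"
  shows "Re L \<le> Re M"
proof (rule tendsto_le)
  show "((\<lambda>T. Re (integral {-T..T} f / of_real (2 * T))) \<longlongrightarrow> Re L) at_top"
    "((\<lambda>T. Re (integral {-T..T} g / of_real (2 * T))) \<longlongrightarrow> Re M) at_top"
    by (rule tendsto_Re[OF has_meanD(2)[OF f]] tendsto_Re[OF has_meanD(2)[OF g]])+
  show "\<forall>\<^sub>F T in at_top. Re (integral {-T..T} f / of_real (2 * T)) \<le> Re (integral {-T..T} g / of_real (2 * T))"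
    using eventually_gt_at_top[of 0]
  proof eventually_elim
    case (elim T)
    have i: "f integrable_on {-T..T}" "g integrable_on {-T..T}"
      using f g by (auto simp: has_mean_def continuous_on_UNIV_integrable)
    have "Re (integral {-T..T} f) = integral {-T..T} (\<lambda>t. Re (f t))"
      using integral_linear[OF i(1) bounded_linear_Re] by (simp add: o_def)
    also have "\<dots> \<le> integral {-T..T} (\<lambda>t. Re (g t))"
      using integrable_linear[OF i(1) bounded_linear_Re] integrable_linear[OF i(2) bounded_linear_Re] le
      by (intro integral_le) (auto simp: o_def)
    also have "\<dots> = Re (integral {-T..T} g)"
      using integral_linear[OF i(2) bounded_linear_Re] by (simp add: o_def)
    finally show ?case using elim by (simp add: Re_divide_of_real divide_right_mono flip: of_real_mult)
  qed
qed auto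

lemma vertical_line_continuous:
  assumes "f holomorphic_on half_plane 0" "\<sigma> > 0"
  shows "continuous_on UNIV (\<lambda>t. f (Complex \<sigma> t))"
proof (rule continuous_on_compose2[OF holomorphic_on_imp_continuous_on[OF assms(1)]])
  have "continuous_on UNIV (\<lambda>t. of_real \<sigma> + \<i> * of_real t)" by (intro continuous_intros)
  then show "continuous_on UNIV (Complex \<sigma>)" by (simp add: complex_eq_iff complex_eq[symmetric] Complex_eq)
qed (use assms in auto)

text \<open>With a primitive \<open>P\<close> of \<open>f\<close>, the integrals over the two vertical segments differ by the
  increments of \<open>P\<close> along two horizontal segments, whose length does not depend on \<open>T\<close>.\<close>

lemma vertical_means_close:
  assumes f: "f holomorphic_on half_plane 0" and \<sigma>: "0 < \<sigma>" "\<sigma> \<le> \<tau>"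
    and B: "\<And>s. \<sigma> \<le> Re s \<Longrightarrow> Re s \<le> \<tau> \<Longrightarrow> cmod (f s) \<le> B"
  shows "cmod (integral {-T..T} (\<lambda>t. f (Complex \<sigma> t)) - integral {-T..T} (\<lambda>t. f (Complex \<tau> t)))
    \<le> 2 * B * (\<tau> - \<sigma>)"
proof (cases "T \<ge> 0")
  case False
  have "0 \<le> B" using B[of "of_real \<sigma>"] \<sigma> norm_ge_zero order_trans by (metis Re_complex_of_real order_refl)
  then show ?thesis using False \<sigma> by simp
next
  case True
  obtain P where P: "\<And>s. s \<in> half_plane 0 \<Longrightarrow> (P has_field_derivative f s) (at s within half_plane 0)"
    using holomorphic_convex_primitive'[OF half_plane_props(2,1) f] by blast
  then have P': "(P has_field_derivative f s) (at s)" if "Re s > 0" for s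
    using P[of s] that at_within_open[OF _ half_plane_props(1), of s 0] by simp
  have int: "integral {-T..T} (\<lambda>t. f (Complex \<rho> t)) = (P (Complex \<rho> T) - P (Complex \<rho> (-T))) / \<i>"
    if \<rho>: "\<rho> > 0" for \<rho>
  proof -
    have "((\<lambda>t. P (of_real \<rho> + \<i> * of_real t) / \<i>) has_vector_derivative f (of_real \<rho> + \<i> * of_real t)) (at t within {-T..T})"
      for t
    proof -
      have "((\<lambda>z. P (of_real \<rho> + \<i> * z) / \<i>) has_field_derivative f (of_real \<rho> + \<i> * of_real t)) (at (of_real t))"
        using \<rho> by (auto intro!: derivative_eq_intros DERIV_chain2[OF P'] simp: mult.assoc)
      then show ?thesis
        by (rule has_vector_derivative_real_field)
    qed
    from fundamental_theorem_of_calculus[OF _ this] True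
    show ?thesis by (auto simp: Complex_eq diff_divide_distrib right_diff_distrib dest!: integral_unique)
  qed
  have step: "cmod (P (Complex \<tau> y) - P (Complex \<sigma> y)) \<le> B * (\<tau> - \<sigma>)" for y
  proof -
    have "cmod (P (Complex \<tau> y) - P (Complex \<sigma> y)) \<le> B * cmod (Complex \<tau> y - Complex \<sigma> y)"
    proof (rule field_differentiable_bound)
      show "convex ({s. \<sigma> \<le> Re s} \<inter> {s. Re s \<le> \<tau>})"
        by (intro convex_Int convex_halfspace_Re_ge convex_halfspace_Re_le)
      show "(P has_field_derivative f z) (at z within {s. \<sigma> \<le> Re s} \<inter> {s. Re s \<le> \<tau>})"
        if "z \<in> {s. \<sigma> \<le> Re s} \<inter> {s. Re s \<le> \<tau>}" for z
        by (rule has_field_derivative_at_within, rule P') (use that \<sigma> in auto)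
    qed (use B \<sigma> in auto)
    also have "cmod (Complex \<tau> y - Complex \<sigma> y) = \<tau> - \<sigma>"
      using \<sigma> by (simp add: complex_diff cmod_def)
    finally show ?thesis .
  qed
  have "integral {-T..T} (\<lambda>t. f (Complex \<sigma> t)) - integral {-T..T} (\<lambda>t. f (Complex \<tau> t))
    = ((P (Complex \<tau> (-T)) - P (Complex \<sigma> (-T))) - (P (Complex \<tau> T) - P (Complex \<sigma> T))) / \<i>"
    using \<sigma> by (simp only: int) (simp add: algebra_simps)
  then have "cmod (integral {-T..T} (\<lambda>t. f (Complex \<sigma> t)) - integral {-T..T} (\<lambda>t. f (Complex \<tau> t)))
    = cmod ((P (Complex \<tau> (-T)) - P (Complex \<sigma> (-T))) - (P (Complex \<tau> T) - P (Complex \<sigma> T)))"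
    by (simp only: norm_divide norm_ii div_by_1)
  also have "\<dots> \<le> B * (\<tau> - \<sigma>) + B * (\<tau> - \<sigma>)"
    by (rule order_trans[OF norm_triangle_ineq4 add_mono[OF step step]])
  finally show ?thesis by simp
qed

text \<open>The line of integration may be moved to the right before averaging.\<close>

lemma has_mean_of_limit_at_right:
  assumes f: "f holomorphic_on half_plane 0" and \<sigma>: "0 < \<sigma>"
    and bnd: "\<And>\<tau>. \<sigma> \<le> \<tau> \<Longrightarrow> \<exists>B. \<forall>s. \<sigma> \<le> Re s \<longrightarrow> Re s \<le> \<tau> \<longrightarrow> cmod (f s) \<le> B"
    and lim: "\<And>e. e > 0 \<Longrightarrow> \<exists>\<rho>. \<forall>s. Re s \<ge> \<rho> \<longrightarrow> cmod (f s - L) \<le> e"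
  shows "has_mean (\<lambda>t. f (Complex \<sigma> t)) L"
  unfolding has_mean_def
proof
  show "continuous_on UNIV (\<lambda>t. f (Complex \<sigma> t))" by (rule vertical_line_continuous[OF f \<sigma>])
  show "((\<lambda>T. integral {-T..T} (\<lambda>t. f (Complex \<sigma> t)) / of_real (2 * T)) \<longlongrightarrow> L) at_top"
  proof (rule tendstoI)
    fix e :: real assume e: "e > 0"
    obtain \<rho> where \<rho>: "\<And>s. Re s \<ge> \<rho> \<Longrightarrow> cmod (f s - L) \<le> e / 4" using lim[of "e/4"] e by auto
    define \<tau> where "\<tau> = max \<rho> \<sigma>"
    have \<tau>: "\<sigma> \<le> \<tau>" "\<tau> > 0" using \<sigma> by (auto simp: \<tau>_def)
    obtain B where B: "\<And>s. \<sigma> \<le> Re s \<Longrightarrow> Re s \<le> \<tau> \<Longrightarrow> cmod (f s) \<le> B" using bnd[OF \<tau>(1)] by auto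
    \<comment> \<open>The cost of moving the line does not grow with T, so it disappears after
      division by 2 * T.\<close>
    define M where "M = 2 * B * (\<tau> - \<sigma>)"
    have "((\<lambda>T. M / (2 * T)) \<longlongrightarrow> 0) at_top"
      by (intro tendsto_divide_0[OF tendsto_const] filterlim_at_top_imp_at_infinity
          filterlim_tendsto_pos_mult_at_top[OF tendsto_const _ filterlim_ident]) simp
    then have "\<forall>\<^sub>F T in at_top. M / (2 * T) < e / 4" using e by (intro order_tendstoD(2)) auto
    then show "\<forall>\<^sub>F T in at_top. dist (integral {-T..T} (\<lambda>t. f (Complex \<sigma> t)) / of_real (2 * T)) L < e"
      using eventually_gt_at_top[of 0]
    proof eventually_elim
      case (elim T)
      have i: "(\<lambda>t. f (Complex \<tau> t)) integrable_on {-T..T}"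
        by (intro continuous_on_UNIV_integrable vertical_line_continuous[OF f \<tau>(2)])
      have "cmod (integral {-T..T} (\<lambda>t. f (Complex \<tau> t) - L)) \<le> (e / 4) * (T - (-T))"
        using \<rho> elim
        by (intro integral_bound continuous_intros
            continuous_on_subset[OF vertical_line_continuous[OF f \<tau>(2)]]) (auto simp: \<tau>_def)
      then have 1: "cmod (integral {-T..T} (\<lambda>t. f (Complex \<tau> t)) - of_real (2 * T) * L) \<le> e / 4 * (2 * T)"
      proof -
        have "integral {-T..T} (\<lambda>t. f (Complex \<tau> t) - L)
            = integral {-T..T} (\<lambda>t. f (Complex \<tau> t)) - of_real (2 * T) * L"
          using elim by (subst integral_diff[OF i]) (auto simp: scaleR_conv_of_real)
        then show ?thesis using \<open>cmod (integral {-T..T} (\<lambda>t. f (Complex \<tau> t) - L)) \<le> _\<close> by simp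
      qed
      have 2: "cmod (integral {-T..T} (\<lambda>t. f (Complex \<sigma> t)) - integral {-T..T} (\<lambda>t. f (Complex \<tau> t))) \<le> M"
        unfolding M_def by (rule vertical_means_close[OF f \<sigma> \<tau>(1) B])
      have "dist (integral {-T..T} (\<lambda>t. f (Complex \<sigma> t)) / of_real (2 * T)) L
          = cmod ((integral {-T..T} (\<lambda>t. f (Complex \<sigma> t)) - of_real (2 * T) * L) / of_real (2 * T))"
        using elim by (simp add: dist_norm diff_divide_distrib)
      also have "\<dots> = cmod (integral {-T..T} (\<lambda>t. f (Complex \<sigma> t)) - of_real (2 * T) * L) / (2 * T)"
        using elim by (simp add: norm_divide norm_mult)
      also have "\<dots> \<le> (M + e / 4 * (2 * T)) / (2 * T)"
        using norm_triangle_ineq[of "integral {-T..T} (\<lambda>t. f (Complex \<sigma> t)) - integral {-T..T} (\<lambda>t. f (Complex \<tau> t))"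
            "integral {-T..T} (\<lambda>t. f (Complex \<tau> t)) - of_real (2 * T) * L"] 1 2 elim
        by (intro divide_right_mono) auto
      also have "\<dots> = M / (2 * T) + e / 4" using elim by (simp add: add_divide_distrib)
      also have "\<dots> < e" using elim e by simp
      finally show ?case .
    qed
  qed
qed

text \<open>For n < m the quotient (n/m)^s tends to 0 at the right, so shifting the line shows that
  the mean is 0. For n > m it grows there, but on the line Re s = \<sigma> it is the constant
  (n/m)^(2\<sigma>) times the conjugate of (m/n)^s.\<close>

lemma has_mean_nat_quotient:
  assumes mn: "m \<ge> 1" "n \<ge> 1" "m \<noteq> n" and \<sigma>: "\<sigma> > 0"
  shows "has_mean (\<lambda>t. of_nat n powr (Complex \<sigma> t) * of_nat m powr (- Complex \<sigma> t)) 0"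
proof -
  have less: "has_mean (\<lambda>t. of_nat k powr (Complex \<sigma> t) * of_nat l powr (- Complex \<sigma> t)) 0"
    if kl: "k \<ge> 1" "k < l" for k l :: nat
  proof (rule has_mean_of_limit_at_right[OF _ \<sigma>, where f = "\<lambda>s. of_nat k powr s * of_nat l powr (- s)"])
    show "(\<lambda>s. of_nat k powr s * of_nat l powr (- s)) holomorphic_on half_plane 0"
      using kl by (intro holomorphic_intros) auto
    have n: "cmod (of_nat k powr s * of_nat l powr (- s)) = (real k / real l) powr (Re s)" for s
    proof -
      have "cmod (of_nat k powr s * of_nat l powr (- s)) = real k powr Re s * real l powr (- Re s)"
        by (simp only: norm_mult norm_nat_powr) simp
      then show ?thesis by (simp add: powr_divide powr_minus_divide)
    qed
    show "\<exists>B. \<forall>s. \<sigma> \<le> Re s \<longrightarrow> Re s \<le> \<tau> \<longrightarrow> cmod (of_nat k powr s * of_nat l powr (- s)) \<le> B" for \<tau>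
      using kl \<sigma> unfolding n by (intro exI[of _ 1]) (auto intro!: powr_le1)
    fix e :: real assume "e > 0"
    have "((\<lambda>x::real. 1 * (real k / real l) powr (x - 0)) \<longlongrightarrow> 0) at_top"
      using kl by (intro powr_tendsto_zero) auto
    then have "\<forall>\<^sub>F x in at_top. (real k / real l) powr x < e"
      using \<open>e > 0\<close> by (auto dest: order_tendstoD(2))
    then show "\<exists>\<rho>. \<forall>s. Re s \<ge> \<rho> \<longrightarrow> cmod (of_nat k powr s * of_nat l powr (- s) - 0) \<le> e"
      unfolding diff_zero n eventually_at_top_linorder by (meson less_imp_le)
  qed
  show ?thesis
  proof (cases "n < m")
    case True
    then show ?thesis using less mn by blast
  next
    case False
    then have m: "m < n" using mn by simp
    define c :: complex where "c = of_real ((real n / real m) powr (2 * \<sigma>))"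
    have "of_nat n powr (Complex \<sigma> t) * of_nat m powr (- Complex \<sigma> t)
        = c * cnj (of_nat m powr (Complex \<sigma> t) * of_nat n powr (- Complex \<sigma> t))" for t
    proof -
      have "c = exp (of_real (2 * \<sigma> * (ln (real n) - ln (real m))))"
        using mn by (simp add: c_def powr_def ln_div exp_of_real[symmetric])
      then show ?thesis using mn
        by (simp add: powr_def exp_cnj Ln_of_nat flip: exp_add)
           (rule arg_cong[where f = exp], simp add: complex_eq_iff algebra_simps)
    qed
    then show ?thesis
      using has_mean_cmult[OF has_mean_cnj[OF less[OF mn(1) m]], of c] by simp
  qed
qed

section \<open>Bessel's inequality and contraction of Dirichlet polynomials\<close>

text \<open>The space H-infinity of Dirichlet series, with function and coefficients as a pair. The
  series has to represent G only far to the right; on lines near the imaginary axis the coefficients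
  are recovered from G itself by shifting lines.\<close>

definition bounded_dirichlet :: "(complex \<Rightarrow> complex) \<Rightarrow> (nat \<Rightarrow> complex) \<Rightarrow> bool" where
  "bounded_dirichlet G b \<longleftrightarrow> G holomorphic_on half_plane 0 \<and> b 0 = 0 \<and>
     (\<exists>B. \<forall>s. Re s > 0 \<longrightarrow> cmod (G s) \<le> B) \<and>
     (\<exists>\<sigma>. abs_conv b \<sigma> \<and> (\<forall>s. Re s > \<sigma> \<longrightarrow> G s = dirichlet_eval b s))"

lemma dirichlet_eval_finite:
  assumes "finite I" "\<And>n. n \<notin> I \<Longrightarrow> a n = 0"
  shows "dirichlet_eval a s = (\<Sum>n\<in>I. a n * of_nat n powr (- s))"
  unfolding dirichlet_eval_def using assms
  by (subst suminf_finite[OF assms(1)]) (auto simp: dirichlet_term_def)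

lemma norm_nat_powr_le_1: "Re s > 0 \<Longrightarrow> cmod (of_nat n powr (- s)) \<le> 1"
proof (cases "n = 0")
  case False
  assume "Re s > 0"
  then show ?thesis using False powr_mono[of "- Re s" 0 "real n"] unfolding norm_nat_powr by simp
qed simp

lemma nat_powr_holomorphic: "f holomorphic_on S \<Longrightarrow> (\<lambda>s. of_nat n powr (f s)) holomorphic_on S"
  by (cases "n = 0") (auto intro!: holomorphic_intros)

text \<open>The terms with index m < n can make n^s G(s) unbounded at the right. Once they are
  subtracted the limit there is the n-th coefficient, and each subtracted term is a multiple of
  (n/m)^s, whose mean is 0.\<close>

lemma bounded_dirichlet_coeff_mean:
  assumes G: "bounded_dirichlet G b" and n: "n \<ge> 1" and \<sigma>: "\<sigma> > 0"
  shows "has_mean (\<lambda>t. G (Complex \<sigma> t) * of_nat n powr (Complex \<sigma> t)) (b n)"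
proof -
  obtain B \<sigma>\<^sub>1 where hol: "G holomorphic_on half_plane 0" and b0: "b 0 = 0"
    and B: "\<And>s. Re s > 0 \<Longrightarrow> cmod (G s) \<le> B" and ac: "abs_conv b \<sigma>\<^sub>1"
    and eq: "\<And>s. Re s > \<sigma>\<^sub>1 \<Longrightarrow> G s = dirichlet_eval b s"
    using G unfolding bounded_dirichlet_def by blast
  define P where "P = (\<lambda>s. \<Sum>m\<in>{1..<n}. b m * of_nat m powr (- s))"
  define f where "f = (\<lambda>s. of_nat n powr s * (G s - P s))"
  define low where "low = (\<lambda>m. if m < n then b m else 0)"
  define c where "c = (\<lambda>m. b m - low m)"
  have acl: "abs_conv low \<sigma>\<^sub>1" by (rule abs_conv_comparison[OF ac, where K=1]) (simp add: low_def)
  have acc: "abs_conv c \<sigma>\<^sub>1" unfolding c_def by (rule abs_conv_diff[OF ac acl])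
  have low: "dirichlet_eval low s = P s" for s
    using b0 by (subst dirichlet_eval_finite[where I = "{1..<n}"]) (auto simp: P_def low_def not_le)
  have fc: "f s = of_nat n powr s * dirichlet_eval c s" if "Re s > \<sigma>\<^sub>1" for s
    using that eq by (simp add: f_def c_def dirichlet_eval_diff[OF ac acl] low)
  have "has_mean (\<lambda>t. f (Complex \<sigma> t)) (b n)"
  proof (rule has_mean_of_limit_at_right[OF _ \<sigma>])
    show "f holomorphic_on half_plane 0"
      unfolding f_def P_def by (intro holomorphic_intros hol nat_powr_holomorphic)
    show "\<exists>B. \<forall>s. \<sigma> \<le> Re s \<longrightarrow> Re s \<le> \<tau> \<longrightarrow> cmod (f s) \<le> B" for \<tau>
    proof (intro exI allI impI)
      fix s assume s: "\<sigma> \<le> Re s" "Re s \<le> \<tau>"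
      have "cmod (of_nat n powr s) \<le> real n powr \<tau>"
        using n s by (simp add: norm_nat_powr powr_mono)
      moreover have "cmod (P s) \<le> (\<Sum>m\<in>{1..<n}. cmod (b m) * 1)"
        unfolding P_def using s \<sigma>
        by (intro sum_norm_le) (auto simp: norm_mult simp del: mult_1_right intro!: mult_left_mono norm_nat_powr_le_1)
      moreover have "cmod (G s) \<le> B" using s \<sigma> by (intro B) simp
      ultimately show "cmod (f s) \<le> real n powr \<tau> * (B + (\<Sum>m\<in>{1..<n}. cmod (b m) * 1))"
        unfolding f_def norm_mult by (intro mult_mono order_trans[OF norm_triangle_ineq4] add_mono) auto
    qed
    fix e :: real assume "e > 0"
    from dirichlet_leading_coeff_uniform[OF acc n _ this]
    obtain \<rho> where \<rho>: "\<And>s. Re s \<ge> \<rho> \<Longrightarrow> cmod (of_nat n powr s * dirichlet_eval c s - c n) < e"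
      by (auto simp: c_def low_def)
    have "c n = b n" by (simp add: c_def low_def)
    then show "\<exists>\<rho>. \<forall>s. Re s \<ge> \<rho> \<longrightarrow> cmod (f s - b n) \<le> e"
      using \<rho> fc by (intro exI[of _ "max \<rho> (\<sigma>\<^sub>1 + 1)"]) (auto simp: less_imp_le)
  qed
  moreover have "has_mean (\<lambda>t. \<Sum>m\<in>{1..<n}. b m * (of_nat n powr (Complex \<sigma> t) * of_nat m powr (- Complex \<sigma> t)))
      (\<Sum>m\<in>{1..<n}. b m * 0)"
    using n \<sigma> by (intro has_mean_sum has_mean_cmult has_mean_nat_quotient) auto
  ultimately have "has_mean (\<lambda>t. f (Complex \<sigma> t) +
      (\<Sum>m\<in>{1..<n}. b m * (of_nat n powr (Complex \<sigma> t) * of_nat m powr (- Complex \<sigma> t))))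
      (b n + (\<Sum>m\<in>{1..<n}. b m * 0))" by (rule has_mean_add)
  then show ?thesis
    by (simp add: f_def P_def algebra_simps sum_distrib_left)
qed

text \<open>On a vertical line the conjugate of m^(-s) is a constant multiple of the holomorphic
  function m^s; thus inner products with Dirichlet polynomials become combinations of coefficient
  means.\<close>

lemma cnj_nat_powr:
  assumes "m \<ge> 1"
  shows "cnj (of_nat m powr (- s)) = of_real (real m powr (- 2 * Re s)) * of_nat m powr s"
proof -
  have "of_real (real m powr (- 2 * Re s)) = exp (complex_of_real (- 2 * Re s * ln (real m)))"
    using assms by (simp only: exp_of_real) (simp add: powr_def)
  moreover have "exp (- (cnj s * of_real (ln (real m))))
      = exp (complex_of_real (- 2 * Re s * ln (real m))) * exp (s * of_real (ln (real m)))"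
    unfolding exp_add[symmetric]
    by (rule arg_cong[where f = exp]) (simp add: complex_eq_iff algebra_simps)
  ultimately show ?thesis using assms
    by (simp add: powr_def exp_cnj Ln_of_nat)
qed

lemma bounded_dirichlet_polynomial:
  "bounded_dirichlet (\<lambda>s. \<Sum>n\<in>{1..<N}. p n * of_nat n powr (- s)) (\<lambda>n. if n \<in> {1..<N} then p n else 0)"
  unfolding bounded_dirichlet_def
proof (intro conjI exI allI impI)
  show "(\<lambda>s. \<Sum>n\<in>{1..<N}. p n * of_nat n powr (- s)) holomorphic_on half_plane 0"
    by (intro holomorphic_intros nat_powr_holomorphic)
  show "cmod (\<Sum>n\<in>{1..<N}. p n * of_nat n powr (- s)) \<le> (\<Sum>n\<in>{1..<N}. cmod (p n) * 1)" if "Re s > 0" for s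
    using that by (intro sum_norm_le)
      (auto simp: norm_mult simp del: mult_1_right intro!: mult_left_mono norm_nat_powr_le_1)
  show "abs_conv (\<lambda>n. if n \<in> {1..<N} then p n else 0) 0"
    by (rule abs_conv_finite_support, rule finite_subset[of _ "{1..<N}"]) auto
  show "(\<Sum>n\<in>{1..<N}. p n * of_nat n powr (- s)) = dirichlet_eval (\<lambda>n. if n \<in> {1..<N} then p n else 0) s" for s
    by (subst dirichlet_eval_finite[where I = "{1..<N}"]) auto
qed auto

lemma bounded_dirichlet_inner_mean:
  assumes G: "bounded_dirichlet G b" and \<sigma>: "\<sigma> > 0"
  shows "has_mean (\<lambda>t. G (Complex \<sigma> t) * cnj (\<Sum>n\<in>{1..<N}. p n * of_nat n powr (- Complex \<sigma> t)))
    (\<Sum>n\<in>{1..<N}. cnj (p n) * of_real (real n powr (- 2 * \<sigma>)) * b n)"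
proof -
  have "has_mean (\<lambda>t. \<Sum>n\<in>{1..<N}. (cnj (p n) * of_real (real n powr (- 2 * \<sigma>))) *
      (G (Complex \<sigma> t) * of_nat n powr (Complex \<sigma> t)))
    (\<Sum>n\<in>{1..<N}. cnj (p n) * of_real (real n powr (- 2 * \<sigma>)) * b n)"
    by (intro has_mean_sum has_mean_cmult bounded_dirichlet_coeff_mean[OF G _ \<sigma>]) auto
  moreover have "G (Complex \<sigma> t) * cnj (\<Sum>n\<in>{1..<N}. p n * of_nat n powr (- Complex \<sigma> t)) =
     (\<Sum>n\<in>{1..<N}. (cnj (p n) * of_real (real n powr (- 2 * \<sigma>))) * (G (Complex \<sigma> t) * of_nat n powr (Complex \<sigma> t)))" for t
    unfolding cnj_sum sum_distrib_left complex_cnj_mult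
    by (intro sum.cong refl) (simp add: cnj_nat_powr)
  ultimately show ?thesis by simp
qed

text \<open>The mean is taken of |G - P|^2 \<ge> 0, where P is the partial sum over n < N: G times
  the conjugate of P and |P|^2 both have the left-hand side as mean. The majorant Q stands in for
  |G|^2, whose own mean is not known to exist.\<close>

lemma bounded_dirichlet_Bessel:
  assumes G: "bounded_dirichlet G b" and \<sigma>: "\<sigma> > 0"
    and Q: "has_mean Q L" "\<And>t. (cmod (G (Complex \<sigma> t)))\<^sup>2 \<le> Re (Q t)"
  shows "(\<Sum>n\<in>{1..<N}. (cmod (b n))\<^sup>2 * real n powr (- 2 * \<sigma>)) \<le> Re L"
proof -
  define S where "S = (\<Sum>n\<in>{1..<N}. (cmod (b n))\<^sup>2 * real n powr (- 2 * \<sigma>))"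
  define P where "P = (\<lambda>s. \<Sum>n\<in>{1..<N}. b n * of_nat n powr (- s))"
  have S: "(\<Sum>n\<in>{1..<N}. cnj (b n) * of_real (real n powr (- 2 * \<sigma>)) * b n) = of_real S"
    unfolding S_def of_real_sum of_real_mult complex_norm_square by (intro sum.cong) auto
  have 1: "has_mean (\<lambda>t. G (Complex \<sigma> t) * cnj (P (Complex \<sigma> t))) (of_real S)"
    using bounded_dirichlet_inner_mean[OF G \<sigma>, of b N] by (simp only: S P_def)
  have "(\<Sum>n\<in>{1..<N}. cnj (b n) * of_real (real n powr (- 2 * \<sigma>)) * (if n \<in> {1..<N} then b n else 0)) = of_real S"
    unfolding S[symmetric] by (intro sum.cong) auto
  then have 2: "has_mean (\<lambda>t. P (Complex \<sigma> t) * cnj (P (Complex \<sigma> t))) (of_real S)"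
    using bounded_dirichlet_inner_mean[OF bounded_dirichlet_polynomial[of b N] \<sigma>, of b N]
    by (simp only: P_def)
  have "Re (2 * of_real S - of_real S) \<le> Re L"
  proof (rule has_mean_mono[OF has_mean_diff[OF has_mean_cmult[OF 1] 2] Q(1)])
    fix t
    define z w where "z = G (Complex \<sigma> t)" and "w = P (Complex \<sigma> t)"
    have "0 \<le> (cmod (z - w))\<^sup>2" by simp
    also have "\<dots> = (cmod z)\<^sup>2 - Re (2 * (z * cnj w) - w * cnj w)"
      unfolding cmod_power2 by (simp add: power2_eq_square algebra_simps)
    finally show "Re (2 * (z * cnj w) - w * cnj w) \<le> Re (Q t)" using Q(2)[of t] by (simp add: z_def)
  qed
  then show ?thesis by (simp add: S_def)
qed

text \<open>The form with matrix \<open>\<lambda>\<^sub>m\<^sub>i\<^sub>n\<^sub>(\<^sub>m\<^sub>,\<^sub>n\<^sub>)\<close> is \<open>\<Sum>\<^sub>j (\<lambda>\<^sub>j - \<lambda>\<^sub>j\<^sub>-\<^sub>1) |\<Sum>\<^sub>n\<^sub>\<ge>\<^sub>j x\<^sub>n|\<^sup>2\<close>, whose first summand is the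
  left-hand side.\<close>

lemma min_form_lower_bound:
  fixes x :: "nat \<Rightarrow> complex" and l :: "nat \<Rightarrow> real"
  assumes "\<And>m. l m \<le> l (Suc m)" "\<And>m. l m \<ge> 0"
  shows "l j * (cmod (\<Sum>n\<in>{j..<N}. x n))\<^sup>2
    \<le> (\<Sum>m\<in>{j..<N}. l m * ((cmod (x m))\<^sup>2 + 2 * Re (cnj (x m) * (\<Sum>n\<in>{Suc m..<N}. x n))))"
proof (induction "N - j" arbitrary: j)
  case 0
  then show ?case by simp
next
  case (Suc k)
  then have j: "j < N" and k: "k = N - Suc j" by auto
  define T where "T = (\<Sum>n\<in>{Suc j..<N}. x n)"
  have "l j * (cmod (\<Sum>n\<in>{j..<N}. x n))\<^sup>2 = l j * (cmod (x j + T))\<^sup>2"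
    using j by (simp add: sum.atLeast_Suc_lessThan T_def)
  also have "(cmod (x j + T))\<^sup>2 = (cmod (x j))\<^sup>2 + 2 * Re (cnj (x j) * T) + (cmod T)\<^sup>2"
    unfolding cmod_power2 by (simp add: power2_eq_square algebra_simps)
  also have "l j * \<dots> \<le> l j * ((cmod (x j))\<^sup>2 + 2 * Re (cnj (x j) * T)) + l (Suc j) * (cmod T)\<^sup>2"
    using mult_right_mono[OF assms(1)[of j], of "(cmod T)\<^sup>2"] by (simp add: distrib_left)
  also have "\<dots> \<le> l j * ((cmod (x j))\<^sup>2 + 2 * Re (cnj (x j) * T)) +
     (\<Sum>m\<in>{Suc j..<N}. l m * ((cmod (x m))\<^sup>2 + 2 * Re (cnj (x m) * (\<Sum>n\<in>{Suc m..<N}. x n))))"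
    using Suc(1)[OF k] by (simp add: T_def)
  finally show ?case using j by (simp add: sum.atLeast_Suc_lessThan[of j N] T_def)
qed

text \<open>The real part of \<open>majorant N a\<close> is the Poisson extension to \<open>half_plane 0\<close> of the boundary
  values of \<open>|D|\<^sup>2\<close>, where \<open>D\<close> is the Dirichlet polynomial with coefficients \<open>a\<close>.\<close>

definition majorant :: "nat \<Rightarrow> (nat \<Rightarrow> complex) \<Rightarrow> complex \<Rightarrow> complex" where
  "majorant N a w = (\<Sum>m\<in>{1..<N}. of_real ((cmod (a m))\<^sup>2) +
     2 * (\<Sum>n\<in>{Suc m..<N}. a n * cnj (a m) * (of_nat m powr w * of_nat n powr (- w))))"

text \<open>For the terms x n = a n * n^(-w) and the weights l m = m^(2 Re w), the product of l m,
  the conjugate of x m and x n is a n times the conjugate of a m times m^w n^(-w). Hence the real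
  part of the majorant is the form with weights l (min m n). These increase because Re w > 0, and l
  1 = 1.\<close>

lemma norm_square_le_majorant:
  assumes w: "Re w > 0"
  shows "(cmod (\<Sum>n\<in>{1..<N}. a n * of_nat n powr (- w)))\<^sup>2 \<le> Re (majorant N a w)"
proof -
  define x where "x = (\<lambda>n. a n * of_nat n powr (- w))"
  define l where "l = (\<lambda>n. real n powr (2 * Re w))"
  have "l 1 * (cmod (\<Sum>n\<in>{1..<N}. x n))\<^sup>2
    \<le> (\<Sum>m\<in>{1..<N}. l m * ((cmod (x m))\<^sup>2 + 2 * Re (cnj (x m) * (\<Sum>n\<in>{Suc m..<N}. x n))))"
    using w by (intro min_form_lower_bound) (auto simp: l_def intro: powr_mono2)
  also have "\<dots> = (\<Sum>m\<in>{1..<N}. Re (of_real ((cmod (a m))\<^sup>2) +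
     2 * (\<Sum>n\<in>{Suc m..<N}. a n * cnj (a m) * (of_nat m powr w * of_nat n powr (- w)))))"
  proof (intro sum.cong refl)
    fix m assume m: "m \<in> {1..<N}"
    have 1: "l m * (cmod (x m))\<^sup>2 = (cmod (a m))\<^sup>2"
    proof -
      have "cmod (x m) = cmod (a m) * real m powr (- Re w)"
        unfolding x_def norm_mult norm_nat_powr by simp
      then have "l m * (cmod (x m))\<^sup>2
          = (cmod (a m))\<^sup>2 * (real m powr (2 * Re w) * (real m powr (- Re w) * real m powr (- Re w)))"
        by (simp add: l_def power2_eq_square)
      also have "real m powr (2 * Re w) * (real m powr (- Re w) * real m powr (- Re w)) = 1"
        using m by (simp add: powr_add[symmetric] del: powr_minus)
      finally show ?thesis by simp
    qed
    have cx: "of_real (l m) * cnj (x m) = cnj (a m) * of_nat m powr w"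
    proof -
      have "complex_of_real (l m) * of_real (real m powr (- 2 * Re w)) = 1"
        using m by (simp add: l_def flip: of_real_mult powr_add)
      moreover have "cnj (of_nat m powr (- w)) = of_real (real m powr (- 2 * Re w)) * of_nat m powr w"
        using m by (intro cnj_nat_powr) auto
      moreover have "of_real (l m) * (cnj (a m) * (r * z)) = of_real (l m) * r * (cnj (a m) * z)" for r z
        by (simp only: mult_ac)
      ultimately show ?thesis by (simp only: x_def complex_cnj_mult mult_1)
    qed
    have "of_real (l m) * (cnj (x m) * (\<Sum>n\<in>{Suc m..<N}. x n)) =
        cnj (a m) * of_nat m powr w * (\<Sum>n\<in>{Suc m..<N}. x n)"
      by (simp only: cx mult.assoc[symmetric])
    also have "\<dots> = (\<Sum>n\<in>{Suc m..<N}. a n * cnj (a m) * (of_nat m powr w * of_nat n powr (- w)))"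
      unfolding x_def sum_distrib_left by (intro sum.cong) (auto simp: mult_ac)
    finally have "Re (of_real (l m) * (cnj (x m) * (\<Sum>n\<in>{Suc m..<N}. x n))) =
        Re (\<Sum>n\<in>{Suc m..<N}. a n * cnj (a m) * (of_nat m powr w * of_nat n powr (- w)))"
      by (rule arg_cong)
    then have 2: "l m * Re (cnj (x m) * (\<Sum>n\<in>{Suc m..<N}. x n)) =
        Re (\<Sum>n\<in>{Suc m..<N}. a n * cnj (a m) * (of_nat m powr w * of_nat n powr (- w)))"
      by (simp only: times_complex.sel(1) Re_complex_of_real Im_complex_of_real mult_zero_left diff_zero)
    show "l m * ((cmod (x m))\<^sup>2 + 2 * Re (cnj (x m) * (\<Sum>n\<in>{Suc m..<N}. x n))) =
      Re (of_real ((cmod (a m))\<^sup>2) +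
     2 * (\<Sum>n\<in>{Suc m..<N}. a n * cnj (a m) * (of_nat m powr w * of_nat n powr (- w))))"
      using 1 2 by (simp add: distrib_left)
  qed
  finally show ?thesis by (simp add: l_def x_def majorant_def)
qed

text \<open>Littlewood's subordination principle at infinity.\<close>

lemma has_mean_majorant_comp:
  assumes hol: "\<psi> holomorphic_on half_plane 0" and pos: "\<And>s. Re s > 0 \<Longrightarrow> Re (\<psi> s) > 0"
    and lim: "filterlim (\<lambda>s. Re (\<psi> s)) at_top (filtercomap Re at_top)" and \<sigma>: "\<sigma> > 0"
  shows "has_mean (\<lambda>t. majorant N a (\<psi> (Complex \<sigma> t))) (of_real (\<Sum>m\<in>{1..<N}. (cmod (a m))\<^sup>2))"
proof (rule has_mean_of_limit_at_right[OF _ \<sigma>, where f = "\<lambda>s. majorant N a (\<psi> s)"])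
  show "(\<lambda>s. majorant N a (\<psi> s)) holomorphic_on half_plane 0"
    unfolding majorant_def by (intro holomorphic_intros nat_powr_holomorphic hol)
  have n: "cmod (of_nat m powr w * of_nat n powr (- w)) = (real m / real n) powr (Re w)" for m n w
  proof -
    have "cmod (of_nat m powr w * of_nat n powr (- w)) = real m powr Re w * real n powr (- Re w)"
      by (simp only: norm_mult norm_nat_powr) simp
    then show ?thesis by (simp add: powr_divide powr_minus_divide)
  qed
  show "\<exists>B. \<forall>s. \<sigma> \<le> Re s \<longrightarrow> Re s \<le> \<tau> \<longrightarrow> cmod (majorant N a (\<psi> s)) \<le> B" for \<tau>
  proof (intro exI allI impI)
    fix s assume s: "\<sigma> \<le> Re s"
    show "cmod (majorant N a (\<psi> s)) \<le> (\<Sum>m\<in>{1..<N}. (cmod (a m))\<^sup>2 +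
        2 * (\<Sum>n\<in>{Suc m..<N}. cmod (a n) * cmod (a m) * 1))"
      unfolding majorant_def
    proof (intro sum_norm_le order_trans[OF norm_triangle_ineq] add_mono)
      fix m assume m: "m \<in> {1..<N}"
      have "cmod (\<Sum>n\<in>{Suc m..<N}. a n * cnj (a m) * (of_nat m powr \<psi> s * of_nat n powr (- \<psi> s)))
          \<le> (\<Sum>n\<in>{Suc m..<N}. cmod (a n) * cmod (a m) * 1)"
      proof (intro sum_norm_le)
        fix k assume k: "k \<in> {Suc m..<N}"
        have "(real m / real k) powr (Re (\<psi> s)) \<le> 1"
          using k m pos[of s] s \<sigma> by (intro powr_le1) auto
        then show "cmod (a k * cnj (a m) * (of_nat m powr \<psi> s * of_nat k powr (- \<psi> s)))
            \<le> cmod (a k) * cmod (a m) * 1"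
          unfolding norm_mult[of "a k * cnj (a m)"] n by (simp add: norm_mult mult_left_le)
      qed
      then show "cmod (2 * (\<Sum>n\<in>{Suc m..<N}. a n * cnj (a m) * (of_nat m powr \<psi> s * of_nat n powr (- \<psi> s))))
          \<le> 2 * (\<Sum>n\<in>{Suc m..<N}. cmod (a n) * cmod (a m) * 1)"
        by (simp add: norm_mult)
    qed (simp flip: of_real_power)
  qed
  \<comment> \<open>Off the diagonal the larger base has the negative exponent, so these terms decay
    as Re \<psi>(s) grows and the diagonal alone survives.\<close>
  have "((\<lambda>s. of_nat m powr (\<psi> s) * of_nat k powr (- \<psi> s)) \<longlongrightarrow> 0) (filtercomap Re at_top)"
    if "m \<ge> 1" "m < k" for m k :: nat
  proof (rule tendsto_norm_zero_cancel)
    have "((\<lambda>x::real. 1 * (real m / real k) powr (x - 0)) \<longlongrightarrow> 0) at_top"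
      using that by (intro powr_tendsto_zero) auto
    from filterlim_compose[OF this lim]
    show "((\<lambda>s. cmod (of_nat m powr (\<psi> s) * of_nat k powr (- \<psi> s))) \<longlongrightarrow> 0) (filtercomap Re at_top)"
      unfolding n by simp
  qed
  then have "((\<lambda>s. majorant N a (\<psi> s)) \<longlongrightarrow>
      (\<Sum>m\<in>{1..<N}. of_real ((cmod (a m))\<^sup>2) + 2 * (\<Sum>n\<in>{Suc m..<N}. a n * cnj (a m) * 0))) (filtercomap Re at_top)"
    unfolding majorant_def by (intro tendsto_intros) auto
  then have l: "((\<lambda>s. majorant N a (\<psi> s)) \<longlongrightarrow> of_real (\<Sum>m\<in>{1..<N}. (cmod (a m))\<^sup>2)) (filtercomap Re at_top)"
    by simp
  fix e :: real assume "e > 0"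
  from tendstoD[OF l this]
  show "\<exists>\<rho>. \<forall>s. Re s \<ge> \<rho> \<longrightarrow> cmod (majorant N a (\<psi> s) - of_real (\<Sum>m\<in>{1..<N}. (cmod (a m))\<^sup>2)) \<le> e"
    unfolding eventually_filtercomap_at_top_linorder dist_norm by (meson less_imp_le)
qed

text \<open>The composed majorant serves as Q in Bessel's inequality. Its mean is the same on every
  line, which is why the resulting bound will not depend on the target seminorm.\<close>

lemma dirichlet_polynomial_comp_contraction:
  assumes hol: "\<psi> holomorphic_on half_plane 0" and pos: "\<And>s. Re s > 0 \<Longrightarrow> Re (\<psi> s) > 0"
    and lim: "filterlim (\<lambda>s. Re (\<psi> s)) at_top (filtercomap Re at_top)" and \<sigma>: "\<sigma> > 0"
    and b: "bounded_dirichlet (\<lambda>s. \<Sum>n\<in>{1..<N}. a n * of_nat n powr (- \<psi> s)) b"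
  shows "(\<Sum>n\<in>{1..<M}. (cmod (b n))\<^sup>2 * real n powr (- 2 * \<sigma>)) \<le> (\<Sum>n\<in>{1..<N}. (cmod (a n))\<^sup>2)"
  using bounded_dirichlet_Bessel[OF b \<sigma> has_mean_majorant_comp[OF hol pos lim \<sigma>]
      norm_square_le_majorant[OF pos]] \<sigma> by simp

lemma bounded_dirichlet_coeff_bound:
  assumes b: "bounded_dirichlet G b" and B: "\<And>s. Re s > 0 \<Longrightarrow> cmod (G s) \<le> B" and \<sigma>: "\<sigma> > 0"
  shows "(\<Sum>n\<in>{1..<M}. (cmod (b n))\<^sup>2 * real n powr (- 2 * \<sigma>)) \<le> B\<^sup>2"
  using bounded_dirichlet_Bessel[OF b \<sigma> has_mean_const[of "of_real (B\<^sup>2)"]] B \<sigma>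
  by (simp add: power_mono)

section \<open>The composition operator\<close>

text \<open>Convergence on some half-plane is exchanged for absolute convergence on a smaller one,
  the form in which series can be multiplied and compared.\<close>

lemma represents_comp_iff:
  "represents_comp \<phi> a b \<longleftrightarrow>
    b 0 = 0 \<and> (\<exists>\<sigma>. abs_conv b \<sigma> \<and> (\<forall>s. Re s > \<sigma> \<longrightarrow> dirichlet_eval b s = dirichlet_eval a (\<phi> s)))"
proof
  assume "represents_comp \<phi> a b"
  then obtain \<tau> where b: "b \<in> dirichlet_space"
    and \<tau>: "\<And>s. Re s > \<tau> \<Longrightarrow> dirichlet_term b s sums dirichlet_eval a (\<phi> s)"
    unfolding represents_comp_def by (metis in_half_plane)
  obtain \<sigma> where "abs_conv b \<sigma>" using dirichlet_space_abs_conv[OF b] .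
  then have "abs_conv b (max \<sigma> \<tau>)" by (rule abs_conv_mono) simp
  moreover have "dirichlet_eval b s = dirichlet_eval a (\<phi> s)" if "Re s > max \<sigma> \<tau>" for s
    using sums_unique[OF \<tau>[of s]] that by (simp add: dirichlet_eval_def)
  ultimately show "b 0 = 0 \<and> (\<exists>\<sigma>. abs_conv b \<sigma> \<and> (\<forall>s. Re s > \<sigma> \<longrightarrow> dirichlet_eval b s = dirichlet_eval a (\<phi> s)))"
    using b by (auto simp: dirichlet_space_def)
next
  assume "b 0 = 0 \<and> (\<exists>\<sigma>. abs_conv b \<sigma> \<and> (\<forall>s. Re s > \<sigma> \<longrightarrow> dirichlet_eval b s = dirichlet_eval a (\<phi> s)))"
  then obtain \<sigma> where b: "b 0 = 0" "abs_conv b \<sigma>"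
    and eq: "\<And>s. Re s > \<sigma> \<Longrightarrow> dirichlet_eval b s = dirichlet_eval a (\<phi> s)" by auto
  have "summable (dirichlet_term b (of_real \<sigma>))"
    by (rule sums_summable[OF abs_conv_sums[OF b(2)]]) simp
  then have "b \<in> dirichlet_space" using b by (auto simp: dirichlet_space_def)
  moreover have "\<forall>s\<in>half_plane \<sigma>. dirichlet_term b s sums dirichlet_eval a (\<phi> s)"
    using abs_conv_sums[OF b(2)] eq by (metis in_half_plane less_imp_le)
  ultimately show "represents_comp \<phi> a b" by (auto simp: represents_comp_def)
qed

lemma represents_comp_unique:
  assumes "represents_comp \<phi> a b" "represents_comp \<phi> a c"
  shows "b = c"
proof -
  obtain \<sigma> \<tau> where *: "b 0 = 0" "c 0 = 0" "abs_conv b \<sigma>" "abs_conv c \<tau>"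
    "\<And>s. Re s > \<sigma> \<Longrightarrow> dirichlet_eval b s = dirichlet_eval a (\<phi> s)"
    "\<And>s. Re s > \<tau> \<Longrightarrow> dirichlet_eval c s = dirichlet_eval a (\<phi> s)"
    using assms unfolding represents_comp_iff by blast
  show ?thesis
    using * by (intro dirichlet_series_unique[where \<sigma> = "max \<sigma> \<tau>"]) (auto intro: abs_conv_mono)
qed

lemma comp_op_eq: "represents_comp \<phi> a b \<Longrightarrow> comp_op \<phi> a = b"
  unfolding comp_op_def by (rule the_equality) (auto intro: represents_comp_unique)

section \<open>Dirichlet monomials and finite combinations\<close>

definition unit_coeff :: "nat \<Rightarrow> nat \<Rightarrow> complex" where
  "unit_coeff n m = (if m = n then 1 else 0)"

lemma unit_coeff_hplus: "n \<ge> 1 \<Longrightarrow> unit_coeff n \<in> hplus"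
  by (rule hplus_finite_support, rule finite_subset[of _ "{n}"]) (auto simp: unit_coeff_def)

lemma unit_coeff_eval [simp]: "dirichlet_eval (unit_coeff n) s = of_nat n powr (- s)"
  by (subst dirichlet_eval_finite[where I = "{n}"]) (auto simp: unit_coeff_def)

lemma unit_coeff_seminorm:
  assumes "n \<ge> 1"
  shows "hplus_seminorm k (unit_coeff n) = real n powr (- 1 / real k)"
proof -
  have 1: "(\<lambda>m. (hplus_weighted k (unit_coeff n) m)\<^sup>2) = (\<lambda>m. if m = n then (real n powr (- 1 / real k))\<^sup>2 else 0)"
    by (auto simp: hplus_weighted_def unit_coeff_def)
  show ?thesis
    unfolding hplus_seminorm_eq 1
      sums_unique[OF sums_single[of n "\<lambda>_. (real n powr (- 1 / real k))\<^sup>2"], symmetric]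
    by simp
qed

lemma dirichlet_eval_scale:
  assumes "abs_conv a \<sigma>" "Re s \<ge> \<sigma>"
  shows "dirichlet_eval (\<lambda>n. c * a n) s = c * dirichlet_eval a s"
  using suminf_mult[OF sums_summable[OF abs_conv_sums[OF assms]], of c]
  by (simp add: dirichlet_eval_def dirichlet_term_def[abs_def] mult.assoc)

lemma dirichlet_eval_sum:
  assumes "finite I" "\<And>i. i \<in> I \<Longrightarrow> abs_conv (a i) \<sigma>" "Re s \<ge> \<sigma>"
  shows "abs_conv (\<lambda>n. \<Sum>i\<in>I. c i * a i n) \<sigma>"
    and "dirichlet_eval (\<lambda>n. \<Sum>i\<in>I. c i * a i n) s = (\<Sum>i\<in>I. c i * dirichlet_eval (a i) s)"
proof -
  show "abs_conv (\<lambda>n. \<Sum>i\<in>I. c i * a i n) \<sigma>"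
    unfolding abs_conv_def
  proof (rule summable_comparison_test'[where N=0])
    show "summable (\<lambda>n. \<Sum>i\<in>I. cmod (c i) * (cmod (a i n) * real n powr (-\<sigma>)))"
      using assms(2) by (intro summable_sum summable_mult) (auto simp: abs_conv_def)
    show "norm (cmod (\<Sum>i\<in>I. c i * a i n) * real n powr (-\<sigma>))
        \<le> (\<Sum>i\<in>I. cmod (c i) * (cmod (a i n) * real n powr (-\<sigma>)))" for n
      by (auto simp: mult.assoc[symmetric] sum_distrib_right[symmetric] norm_mult[symmetric]
          intro!: mult_right_mono norm_sum)
  qed
  have "(\<lambda>n. \<Sum>i\<in>I. c i * dirichlet_term (a i) s n) sums (\<Sum>i\<in>I. c i * dirichlet_eval (a i) s)"
    using assms by (intro sums_sum sums_mult abs_conv_sums)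
  then show "dirichlet_eval (\<lambda>n. \<Sum>i\<in>I. c i * a i n) s = (\<Sum>i\<in>I. c i * dirichlet_eval (a i) s)"
    unfolding dirichlet_eval_def[of "\<lambda>n. \<Sum>i\<in>I. c i * a i n"]
    by (simp add: dirichlet_term_def[abs_def] sum_distrib_right mult.assoc sums_iff)
qed

text \<open>The filter \<open>filtercomap Re at_top\<close> expresses that Re s tends to infinity,
  uniformly in Im s.\<close>

lemma dirichlet_eval_tendsto_first:
  assumes "abs_conv a \<sigma>" "a 0 = 0"
  shows "(dirichlet_eval a \<longlongrightarrow> a 1) (filtercomap Re at_top)"
proof (rule tendstoI)
  fix e :: real assume "e > 0"
  from dirichlet_leading_coeff_uniform[OF assms(1) order_refl _ this] assms(2)
  show "\<forall>\<^sub>F s in filtercomap Re at_top. dist (dirichlet_eval a s) (a 1) < e"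
    unfolding eventually_filtercomap_at_top_linorder dist_norm by fastforce
qed

lemma filtercomap_Re_at_top_neq_bot [simp]: "filtercomap Re at_top \<noteq> bot"
  by (rule filtercomap_neq_bot_surj, simp, rule surjI[of Re complex_of_real], simp)

lemma eventually_Re_gt: "\<forall>\<^sub>F s in filtercomap Re at_top. Re s > \<sigma>"
  using eventually_filtercomapI[OF eventually_gt_at_top[of \<sigma>], of Re] by simp

text \<open>The exponent belongs to the line Re s = 1/m: Bessel's inequality on this line bounds
  exactly the m-th seminorm.\<close>

lemma seminorm_le_of_coeff_bound:
  assumes "b 0 = 0" "m \<ge> 1" "R \<ge> 0"
    and le: "\<And>M. (\<Sum>n\<in>{1..<M}. (cmod (b n))\<^sup>2 * real n powr (- 2 * (1 / real m))) \<le> R\<^sup>2"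
  shows "hplus_seminorm m b \<le> R"
  unfolding hplus_seminorm_eq
proof (rule suminf_le_of_L2_set(2))
  fix N
  have "(\<Sum>n<N. (hplus_weighted m b n)\<^sup>2) = (\<Sum>n\<in>{1..<N}. (cmod (b n))\<^sup>2 * real n powr (- 2 * (1 / real m)))"
    using assms(1) by (intro sum.mono_neutral_cong_right) (auto simp: hplus_weighted_square not_le Suc_le_eq)
  also have "\<dots> \<le> R\<^sup>2" by (rule le)
  finally show "L2_set (hplus_weighted m b) {..<N} \<le> R"
    unfolding L2_set_def using assms(3) by (simp add: real_le_lsqrt)
qed

locale hplus_composition =
  fixes \<theta> :: real and \<phi> \<Phi> :: "complex \<Rightarrow> complex" and c\<^sub>0 :: nat
  assumes maps: "\<phi> ` half_plane \<theta> \<subseteq> half_plane (1/2)"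
    and form: "analytic_of_form c\<^sub>0 \<phi>"
    and well_defined: "\<forall>a\<in>hplus. \<exists>b\<in>hplus. represents_comp \<phi> a b"
    and extension: "analytic_extension \<phi> \<Phi>"
begin

abbreviation C where "C \<equiv> comp_op \<phi>"

section \<open>Images of series in terms of the analytic extension\<close>

lemma \<Phi>_holomorphic: "\<Phi> holomorphic_on half_plane 0"
  using extension by (auto simp: analytic_extension_def analytic_imp_holomorphic)

lemma far_right:
  obtains \<sigma> c where "\<sigma> > 0" "abs_conv c \<sigma>" "c 0 = 0" "\<And>s. Re s > \<sigma> \<Longrightarrow> \<Phi> s = \<phi> s"
    "\<And>s. Re s > \<sigma> \<Longrightarrow> \<Phi> s = of_nat c\<^sub>0 * s + dirichlet_eval c s" "\<And>s. Re s > \<sigma> \<Longrightarrow> Re (\<Phi> s) > 1/2"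
proof -
  obtain \<sigma>\<^sub>1 c where c: "c \<in> dirichlet_space"
    "\<And>s. s \<in> half_plane \<sigma>\<^sub>1 \<Longrightarrow> \<phi> s = of_nat c\<^sub>0 * s + dirichlet_eval c s"
    using form unfolding analytic_of_form_def by blast
  obtain \<sigma>\<^sub>2 where \<sigma>\<^sub>2: "abs_conv c \<sigma>\<^sub>2" using dirichlet_space_abs_conv[OF c(1)] .
  obtain \<sigma>\<^sub>3 where \<sigma>\<^sub>3: "\<And>s. s \<in> half_plane \<sigma>\<^sub>3 \<Longrightarrow> \<Phi> s = \<phi> s"
    using extension unfolding analytic_extension_def by blast
  define \<sigma> where "\<sigma> = Max {\<sigma>\<^sub>1, \<sigma>\<^sub>2, \<sigma>\<^sub>3, \<theta>, 1}"
  have \<sigma>: "\<sigma>\<^sub>1 \<le> \<sigma>" "\<sigma>\<^sub>2 \<le> \<sigma>" "\<sigma>\<^sub>3 \<le> \<sigma>" "\<theta> \<le> \<sigma>" "1 \<le> \<sigma>" by (auto simp: \<sigma>_def)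
  show ?thesis
  proof (rule that[of \<sigma> c])
    show "abs_conv c \<sigma>" by (rule abs_conv_mono[OF \<sigma>\<^sub>2 \<sigma>(2)])
    show "c 0 = 0" using c by (simp add: dirichlet_space_def)
    fix s assume s: "Re s > \<sigma>"
    show eq: "\<Phi> s = \<phi> s" using \<sigma>\<^sub>3 s \<sigma> by simp
    show "\<Phi> s = of_nat c\<^sub>0 * s + dirichlet_eval c s" using c(2) s \<sigma> eq by simp
    have "\<phi> s \<in> half_plane (1/2)" using maps s \<sigma> by (intro subsetD[OF maps] imageI) simp
    then show "Re (\<Phi> s) > 1/2" using eq by simp
  qed (use \<sigma> in auto)
qed

lemma C_represents:
  assumes "a \<in> hplus"
  shows "C a \<in> hplus" "represents_comp \<phi> a (C a)"
  using well_defined assms comp_op_eq by (metis, metis)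

lemma C_0 [simp]: "a \<in> hplus \<Longrightarrow> C a 0 = 0"
  using C_represents(1) by (simp add: hplus_def)

lemma C_eval_\<Phi>:
  assumes "a \<in> hplus"
  obtains \<sigma> where "\<sigma> > 0" "abs_conv (C a) \<sigma>" "\<And>s. Re s > \<sigma> \<Longrightarrow> dirichlet_eval (C a) s = dirichlet_eval a (\<Phi> s)"
proof -
  obtain \<sigma>\<^sub>1 where 1: "abs_conv (C a) \<sigma>\<^sub>1" "\<And>s. Re s > \<sigma>\<^sub>1 \<Longrightarrow> dirichlet_eval (C a) s = dirichlet_eval a (\<phi> s)"
    using C_represents(2)[OF assms] unfolding represents_comp_iff by blast
  obtain \<sigma>\<^sub>2 where 2: "\<sigma>\<^sub>2 > 0" "\<And>s. Re s > \<sigma>\<^sub>2 \<Longrightarrow> \<Phi> s = \<phi> s" using far_right by metis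
  show ?thesis
    using 1 2 by (intro that[of "max \<sigma>\<^sub>1 \<sigma>\<^sub>2"]) (auto intro: abs_conv_mono)
qed

lemma C_eqI:
  assumes b: "b 0 = 0" "abs_conv b \<sigma>" "\<And>s. Re s > \<sigma> \<Longrightarrow> dirichlet_eval b s = dirichlet_eval a (\<Phi> s)"
  shows "C a = b"
proof (rule comp_op_eq)
  obtain \<sigma>\<^sub>2 where 2: "\<sigma>\<^sub>2 > 0" "\<And>s. Re s > \<sigma>\<^sub>2 \<Longrightarrow> \<Phi> s = \<phi> s" using far_right by metis
  have "abs_conv b (max \<sigma> \<sigma>\<^sub>2)" using b by (auto intro: abs_conv_mono)
  then show "represents_comp \<phi> a b"
    unfolding represents_comp_iff using b 2 by (intro conjI exI[of _ "max \<sigma> \<sigma>\<^sub>2"]) auto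
qed

lemma C_scale:
  assumes a: "a \<in> hplus"
  shows "C (\<lambda>n. c * a n) = (\<lambda>n. c * C a n)"
proof -
  obtain \<sigma> where \<sigma>: "abs_conv (C a) \<sigma>" "\<And>s. Re s > \<sigma> \<Longrightarrow> dirichlet_eval (C a) s = dirichlet_eval a (\<Phi> s)"
    using C_eval_\<Phi>[OF a] by metis
  obtain \<sigma>\<^sub>2 where 2: "\<And>s. Re s > \<sigma>\<^sub>2 \<Longrightarrow> Re (\<Phi> s) > 1/2" using far_right by metis
  show ?thesis
  proof (rule C_eqI[where \<sigma> = "max \<sigma> \<sigma>\<^sub>2"])
    show "abs_conv (\<lambda>n. c * C a n) (max \<sigma> \<sigma>\<^sub>2)"
      by (rule abs_conv_mono[OF abs_conv_comparison[OF \<sigma>(1), where K = "cmod c"]]) (auto simp: norm_mult)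
    fix s assume s: "Re s > max \<sigma> \<sigma>\<^sub>2"
    have "abs_conv a (Re (\<Phi> s))" using s 2 by (intro hplus_abs_conv[OF a]) simp
    then show "dirichlet_eval (\<lambda>n. c * C a n) s = dirichlet_eval (\<lambda>n. c * a n) (\<Phi> s)"
      using s \<sigma> by (simp add: dirichlet_eval_scale[of _ \<sigma>] dirichlet_eval_scale[of a "Re (\<Phi> s)"])
  qed (use a in simp)
qed

lemma C_polynomial:
  "C (\<lambda>m. \<Sum>n\<in>{1..<N}. p n * unit_coeff n m) = (\<lambda>m. \<Sum>n\<in>{1..<N}. p n * C (unit_coeff n) m)"
proof -
  have ac: "abs_conv (C (unit_coeff n)) 1" if "n \<in> {1..<N}" for n
    using that by (intro hplus_abs_conv C_represents unit_coeff_hplus) auto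
  have "\<exists>\<sigma>. \<forall>s. Re s > \<sigma> \<longrightarrow> dirichlet_eval (C (unit_coeff n)) s = of_nat n powr (- \<Phi> s)" if "n \<in> {1..<N}" for n
    using C_eval_\<Phi>[OF unit_coeff_hplus, of n] that by (metis atLeastLessThan_iff unit_coeff_eval)
  then obtain S where S: "\<And>n s. n \<in> {1..<N} \<Longrightarrow> Re s > S n \<Longrightarrow> dirichlet_eval (C (unit_coeff n)) s = of_nat n powr (- \<Phi> s)"
    by metis
  define \<sigma> where "\<sigma> = Max (insert 1 (S ` {1..<N}))"
  have \<sigma>: "S n \<le> \<sigma>" if "n \<in> {1..<N}" for n using that unfolding \<sigma>_def by (intro Max_ge) auto
  have \<sigma>1: "1 \<le> \<sigma>" by (auto simp: \<sigma>_def)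
  show ?thesis
  proof (rule C_eqI)
    show "(\<Sum>n\<in>{1..<N}. p n * C (unit_coeff n) 0) = 0"
      by (intro sum.neutral) (simp add: unit_coeff_hplus)
    have ac': "abs_conv (C (unit_coeff n)) \<sigma>" if "n \<in> {1..<N}" for n
      by (rule abs_conv_mono[OF ac[OF that] \<sigma>1])
    show "abs_conv (\<lambda>m. \<Sum>n\<in>{1..<N}. p n * C (unit_coeff n) m) \<sigma>"
      by (rule dirichlet_eval_sum(1)[where s = "of_real \<sigma>"]) (auto intro: ac')
    fix s assume s: "Re s > \<sigma>"
    have "dirichlet_eval (\<lambda>m. \<Sum>n\<in>{1..<N}. p n * C (unit_coeff n) m) s =
        (\<Sum>n\<in>{1..<N}. p n * dirichlet_eval (C (unit_coeff n)) s)"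
      using s by (intro dirichlet_eval_sum(2)[where \<sigma> = \<sigma>] ac') auto
    also have "\<dots> = (\<Sum>n\<in>{1..<N}. p n * dirichlet_eval (unit_coeff n) (\<Phi> s))"
      using s by (intro sum.cong refl) (simp add: S le_less_trans[OF \<sigma> s])
    also have "\<dots> = dirichlet_eval (\<lambda>m. \<Sum>n\<in>{1..<N}. p n * unit_coeff n m) (\<Phi> s)"
      by (rule dirichlet_eval_sum(2)[where \<sigma> = "Re (\<Phi> s)", symmetric])
         (auto intro!: abs_conv_finite_support intro: finite_subset[of _ "{_}"] simp: unit_coeff_def)
    finally show "dirichlet_eval (\<lambda>m. \<Sum>n\<in>{1..<N}. p n * C (unit_coeff n) m) s = \<dots>" .
  qed
qed

text \<open>The identity (m n)^(-\<Phi>) = m^(-\<Phi>) n^(-\<Phi>) far to the right is read as one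
  between coefficients; in this form it passes to smooth parts and thereby to all of
  \<open>half_plane 0\<close>.\<close>

lemma C_unit_mult:
  assumes "m \<ge> 1" "n \<ge> 1"
  shows "C (unit_coeff (m * n)) = dirichlet_conv (C (unit_coeff m)) (C (unit_coeff n))"
proof -
  have m: "unit_coeff m \<in> hplus" "unit_coeff n \<in> hplus" using assms by (auto intro: unit_coeff_hplus)
  obtain \<sigma> where \<sigma>: "abs_conv (C (unit_coeff m)) \<sigma>"
    "\<And>s. Re s > \<sigma> \<Longrightarrow> dirichlet_eval (C (unit_coeff m)) s = of_nat m powr (- \<Phi> s)"
    using C_eval_\<Phi>[OF m(1)] by (metis unit_coeff_eval)
  obtain \<tau> where \<tau>: "abs_conv (C (unit_coeff n)) \<tau>"
    "\<And>s. Re s > \<tau> \<Longrightarrow> dirichlet_eval (C (unit_coeff n)) s = of_nat n powr (- \<Phi> s)"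
    using C_eval_\<Phi>[OF m(2)] by (metis unit_coeff_eval)
  have ac: "abs_conv (C (unit_coeff m)) (max \<sigma> \<tau>)" "abs_conv (C (unit_coeff n)) (max \<sigma> \<tau>)"
    using \<sigma> \<tau> by (auto intro: abs_conv_mono)
  show ?thesis
  proof (rule C_eqI[where \<sigma> = "max \<sigma> \<tau>"])
    show "abs_conv (dirichlet_conv (C (unit_coeff m)) (C (unit_coeff n))) (max \<sigma> \<tau>)"
      using ac m by (intro dirichlet_conv_abs_conv) auto
    fix s assume "Re s > max \<sigma> \<tau>"
    then show "dirichlet_eval (dirichlet_conv (C (unit_coeff m)) (C (unit_coeff n))) s
        = dirichlet_eval (unit_coeff (m * n)) (\<Phi> s)"
      using ac m \<sigma> \<tau> nat_powr_mult by (subst dirichlet_eval_conv[where \<sigma> = "max \<sigma> \<tau>"]) auto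
  qed simp
qed

subsection \<open>Sufficiency\<close>

lemma bounded_dirichlet_comp:
  assumes a: "a \<in> hplus" and hol: "(\<lambda>s. dirichlet_eval a (\<Phi> s)) holomorphic_on half_plane 0"
    and B: "\<And>s. Re s > 0 \<Longrightarrow> cmod (dirichlet_eval a (\<Phi> s)) \<le> B"
  shows "bounded_dirichlet (\<lambda>s. dirichlet_eval a (\<Phi> s)) (C a)"
  unfolding bounded_dirichlet_def using C_eval_\<Phi>[OF a] hol B a by (metis C_0)

text \<open>The Dirichlet series in \<Phi> tends to its first coefficient, so the linear term
  dominates.\<close>

lemma Re_\<Phi>_at_top:
  assumes "c\<^sub>0 \<ge> 1"
  shows "filterlim (\<lambda>s. Re (\<Phi> s)) at_top (filtercomap Re at_top)"
proof -
  obtain \<sigma> c where \<sigma>: "\<sigma> > 0" "abs_conv c \<sigma>" "c 0 = 0"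
    "\<And>s. Re s > \<sigma> \<Longrightarrow> \<Phi> s = of_nat c\<^sub>0 * s + dirichlet_eval c s" using far_right by metis
  have 1: "filterlim (\<lambda>s. Re (dirichlet_eval c s) + Re s) at_top (filtercomap Re at_top)"
    by (rule filterlim_tendsto_add_at_top[OF tendsto_Re[OF dirichlet_eval_tendsto_first[OF \<sigma>(2,3)]] filterlim_filtercomap])
  show ?thesis
  proof (rule filterlim_at_top_mono[OF 1])
    show "\<forall>\<^sub>F s in filtercomap Re at_top. Re (dirichlet_eval c s) + Re s \<le> Re (\<Phi> s)"
      using eventually_Re_gt[of \<sigma>]
    proof eventually_elim
      case (elim s)
      then have "1 * Re s \<le> real c\<^sub>0 * Re s" using assms \<sigma>(1) by (intro mult_right_mono) auto
      then show ?case using \<sigma>(4)[OF elim] by simp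
    qed
  qed
qed

text \<open>A series in \<open>hplus\<close> need not converge at \<Phi>(s) when only Re \<Phi>(s) >
  \<epsilon> is known, so the contraction estimate is applied to truncations, and continuity allows
  passage to the limit.\<close>

lemma C_bound_pos:
  assumes c0: "c\<^sub>0 \<ge> 1" and cont: "continuous_map hplus_topology hplus_topology C"
    and \<epsilon>: "\<Phi> ` half_plane 0 \<subseteq> half_plane \<epsilon>" and k: "k \<ge> 1" "1 / real k < \<epsilon>"
    and a: "a \<in> hplus" and m: "m \<ge> 1"
  shows "hplus_seminorm m (C a) \<le> hplus_seminorm k a"
proof -
  have pos: "Re (\<Phi> s) > \<epsilon>" if "Re s > 0" for s using \<epsilon> that by (auto simp: image_subset_iff)
  have \<epsilon>0: "\<epsilon> > 0" using k by (meson divide_nonneg_nonneg le_less_trans of_nat_0_le_iff zero_le_one)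
  \<comment> \<open>Removing \<epsilon> still leaves a self-map of the right half-plane. The factor
    n^(-\<epsilon>) thus released goes into the coefficients \<open>p\<close>, where 1/k <
    \<epsilon> bounds it by the weight n^(-1/k).\<close>
  define \<psi> where "\<psi> = (\<lambda>s. \<Phi> s - of_real \<epsilon>)"
  have \<psi>: "\<psi> holomorphic_on half_plane 0" "\<And>s. Re s > 0 \<Longrightarrow> Re (\<psi> s) > 0"
    using pos by (auto simp: \<psi>_def intro!: holomorphic_intros \<Phi>_holomorphic)
  have lim: "filterlim (\<lambda>s. Re (\<psi> s)) at_top (filtercomap Re at_top)"
    using filterlim_tendsto_add_at_top[OF tendsto_const[of "- \<epsilon>"] Re_\<Phi>_at_top[OF c0]]
    by (simp add: \<psi>_def)
  have poly: "hplus_seminorm m (C (truncate {..<N} a)) \<le> hplus_seminorm k a" for N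
  proof (rule seminorm_le_of_coeff_bound[OF _ m])
    define p where "p = (\<lambda>n. a n * of_real (real n powr (- \<epsilon>)))"
    have a0: "a 0 = 0" using a by (simp add: hplus_def)
    have ev: "dirichlet_eval (truncate {..<N} a) (\<Phi> s) = (\<Sum>n\<in>{1..<N}. p n * of_nat n powr (- \<psi> s))" for s
    proof -
      have "dirichlet_eval (truncate {..<N} a) (\<Phi> s) = (\<Sum>n\<in>{1..<N}. truncate {..<N} a n * of_nat n powr (- \<Phi> s))"
        using a0 by (intro dirichlet_eval_finite) (auto simp: truncate_def not_le Suc_le_eq)
      also have "\<dots> = (\<Sum>n\<in>{1..<N}. p n * of_nat n powr (- \<psi> s))"
      proof (intro sum.cong refl)
        fix n assume n: "n \<in> {1..<N}"
        have "complex_of_real (real n powr (- \<epsilon>)) = of_nat n powr (- of_real \<epsilon>)"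
          using n by (simp add: powr_of_real[symmetric])
        moreover have "(of_nat n :: complex) powr (- of_real \<epsilon>) * of_nat n powr (- \<psi> s) = of_nat n powr (- \<Phi> s)"
          using n by (subst powr_add[symmetric]) (simp add: \<psi>_def)
        ultimately show "truncate {..<N} a n * of_nat n powr (- \<Phi> s) = p n * of_nat n powr (- \<psi> s)"
          using n by (simp add: truncate_def p_def mult.assoc)
      qed
      finally show ?thesis .
    qed
    have bd: "bounded_dirichlet (\<lambda>s. \<Sum>n\<in>{1..<N}. p n * of_nat n powr (- \<psi> s)) (C (truncate {..<N} a))"
      unfolding ev[symmetric]
    proof (rule bounded_dirichlet_comp[OF truncate_hplus[OF a]])
      show "(\<lambda>s. dirichlet_eval (truncate {..<N} a) (\<Phi> s)) holomorphic_on half_plane 0"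
        unfolding ev by (intro holomorphic_intros nat_powr_holomorphic \<psi>)
      show "cmod (dirichlet_eval (truncate {..<N} a) (\<Phi> s)) \<le> (\<Sum>n\<in>{1..<N}. cmod (p n) * 1)" if "Re s > 0" for s
        unfolding ev using \<psi>(2)[OF that] by (intro sum_norm_le)
          (auto simp: norm_mult simp del: mult_1_right intro!: mult_left_mono norm_nat_powr_le_1)
    qed
    show "hplus_seminorm k a \<ge> 0" by (rule hplus_seminorm_nonneg[OF a k(1)])
    show "C (truncate {..<N} a) 0 = 0" by (simp add: truncate_hplus a)
    fix M
    have "(\<Sum>n\<in>{1..<M}. (cmod (C (truncate {..<N} a) n))\<^sup>2 * real n powr (- 2 * (1 / real m)))
        \<le> (\<Sum>n\<in>{1..<N}. (cmod (p n))\<^sup>2)"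
      using m by (intro dirichlet_polynomial_comp_contraction[OF \<psi> lim _ bd]) auto
    also have "\<dots> \<le> (\<Sum>n\<in>{1..<N}. (hplus_weighted k a n)\<^sup>2)"
      using k nat_powr_antimono[of "1 / real k" \<epsilon>]
      by (intro sum_mono power_mono) (auto simp: p_def hplus_weighted_def norm_mult intro!: mult_left_mono)
    also have "\<dots> \<le> (\<Sum>n. (hplus_weighted k a n)\<^sup>2)"
      by (intro sum_le_suminf hplus_weighted_summable[OF a k(1)]) auto
    also have "\<dots> = (hplus_seminorm k a)\<^sup>2"
      by (simp add: hplus_seminorm_eq suminf_nonneg hplus_weighted_summable[OF a k(1)])
    finally show "(\<Sum>n\<in>{1..<M}. (cmod (C (truncate {..<N} a) n))\<^sup>2 * real n powr (- 2 * (1 / real m)))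
        \<le> (hplus_seminorm k a)\<^sup>2" .
  qed
  have "hplus_seminorm m (C a) \<le> hplus_seminorm k a + hplus_seminorm m (\<lambda>n. C (truncate {..<N} a) n - C a n)" for N
  proof -
    have h: "C (truncate {..<N} a) \<in> hplus" "C a \<in> hplus" using C_represents(1) truncate_hplus a by auto
    have "hplus_seminorm m (C a) \<le> hplus_seminorm m (C (truncate {..<N} a)) +
        hplus_seminorm m (\<lambda>n. C (truncate {..<N} a) n - C a n)"
    proof (rule hplus_triangle(2)[OF h(1) hplus_diff[OF h] _ m])
      show "cmod (C a n) \<le> cmod (C (truncate {..<N} a) n) + cmod (C (truncate {..<N} a) n - C a n)" for n
        by (metis norm_minus_commute norm_triangle_sub)
    qed
    then show ?thesis using poly[of N] by simp
  qed
  moreover have "(\<lambda>N. hplus_seminorm k a + hplus_seminorm m (\<lambda>n. C (truncate {..<N} a) n - C a n))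
      \<longlonglongrightarrow> hplus_seminorm k a + 0"
    by (intro tendsto_intros continuous_map_truncate_tendsto[OF cont a m])
  ultimately show ?thesis
    by (intro tendsto_lowerbound[where f = "\<lambda>N. hplus_seminorm k a + hplus_seminorm m (\<lambda>n. C (truncate {..<N} a) n - C a n)"]) auto
qed

lemma C_bound_zero:
  assumes \<epsilon>: "\<Phi> ` half_plane 0 \<subseteq> half_plane (1/2 + \<epsilon>)" and k: "k \<ge> 1" "1 / real k < \<epsilon>"
  shows "\<exists>K. \<forall>m\<ge>1. \<forall>a\<in>hplus. hplus_seminorm m (C a) \<le> K * hplus_seminorm k a"
proof (intro exI allI impI ballI)
  \<comment> \<open>The Cauchy-Schwarz constant on the line Re s = 1/2 + \<epsilon>: the exponent 1
    + 2\<epsilon> - 2/k exceeds 1 because 1/k < \<epsilon>.\<close>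
  define K where "K = sqrt (\<Sum>n. if n \<in> UNIV then real n powr (-(2 * (1/2 + \<epsilon>) - 2 / real k)) else 0)"
  have sm: "summable (\<lambda>n. if n \<in> UNIV then real n powr (-(2 * (1/2 + \<epsilon>) - 2 / real k)) else 0)"
    using k by (simp only: UNIV_I if_True, intro summable_nat_powr) (simp add: field_simps)
  have K: "K \<ge> 0" unfolding K_def by (intro real_sqrt_ge_zero suminf_nonneg sm) auto
  fix m a assume m: "m \<ge> (1::nat)" and a: "a \<in> hplus"
  have pos: "Re (\<Phi> s) > 1/2 + \<epsilon>" if "Re s > 0" for s using \<epsilon> that by (auto simp: image_subset_iff)
  have \<epsilon>0: "\<epsilon> > 0" using k by (meson divide_nonneg_nonneg le_less_trans of_nat_0_le_iff zero_le_one)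
  have B: "cmod (dirichlet_eval a (\<Phi> s)) \<le> K * hplus_seminorm k a" if "Re s > 0" for s
    using hplus_truncate_bound(2)[OF a k(1) sm, of "\<Phi> s"] pos[OF that] by (simp add: K_def mult.commute)
  have "(dirichlet_eval a \<circ> \<Phi>) holomorphic_on half_plane 0"
    by (rule holomorphic_on_compose_gen[OF \<Phi>_holomorphic dirichlet_eval_holomorphic[OF hplus_abs_conv[OF a, of "1/2 + \<epsilon>"]]])
       (use \<epsilon>0 \<epsilon> in auto)
  then have "bounded_dirichlet (\<lambda>s. dirichlet_eval a (\<Phi> s)) (C a)"
    using B by (intro bounded_dirichlet_comp[OF a]) (auto simp: o_def)
  from bounded_dirichlet_coeff_bound[OF this B, of "1 / real m"] m
  show "hplus_seminorm m (C a) \<le> K * hplus_seminorm k a"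
    by (intro seminorm_le_of_coeff_bound m mult_nonneg_nonneg K hplus_seminorm_nonneg[OF a k(1)])
       (auto simp: a)
qed

end

section \<open>Necessity\<close>

lemma le_of_power_le:
  fixes x y M :: real
  assumes le: "\<And>j. x ^ j \<le> M * y ^ j" and y: "y > 0"
  shows "x \<le> y"
proof (rule ccontr)
  assume "\<not> x \<le> y"
  then have "x / y > 1" using y by simp
  from real_arch_pow[OF this, of M] obtain j where "M < (x / y) ^ j" by blast
  then have "M * y ^ j < x ^ j" using y by (simp add: power_divide field_simps)
  then show False using le[of j] by simp
qed

text \<open>Comparing orders of vanishing: they are integers, while \<open>ln 3 / ln 2\<close> is irrational.\<close>

lemma no_zero_of_proportional_log_derivatives:
  assumes S: "open S" "connected S" and f: "f holomorphic_on S" and g: "g holomorphic_on S"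
    and fz: "z\<^sub>1 \<in> S" "f z\<^sub>1 \<noteq> 0" and gz: "z\<^sub>2 \<in> S" "g z\<^sub>2 \<noteq> 0"
    and ode: "\<And>s. s \<in> S \<Longrightarrow> of_real (ln 2) * deriv g s * f s = of_real (ln 3) * g s * deriv f s"
    and z: "z \<in> S"
  shows "f z \<noteq> 0"
proof
  assume fz0: "f z = 0"
  have "\<not> f constant_on S" using fz0 fz z unfolding constant_on_def by metis
  from holomorphic_factor_zero_nonconstant[OF f S z fz0 this]
  obtain u r n where u: "n > 0" "r > 0" "ball z r \<subseteq> S" "u holomorphic_on ball z r"
    "\<And>w. w \<in> ball z r \<Longrightarrow> f w = (w - z) ^ n * u w" "\<And>w. w \<in> ball z r \<Longrightarrow> u w \<noteq> 0" by metis
  \<comment> \<open>The order m of g at z may be 0, in contrast to the order n of f.\<close>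
  have "\<exists>v r m. r > 0 \<and> ball z r \<subseteq> S \<and> v holomorphic_on ball z r \<and>
      (\<forall>w\<in>ball z r. g w = (w - z) ^ m * v w \<and> v w \<noteq> 0)"
  proof (cases "g z = 0")
    case True
    have "\<not> g constant_on S" using True gz z unfolding constant_on_def by metis
    from holomorphic_factor_zero_nonconstant[OF g S z True this] show ?thesis by metis
  next
    case False
    have "continuous_on S g" by (rule holomorphic_on_imp_continuous_on[OF g])
    then have "isCont g z" using S(1) z by (simp add: continuous_on_eq_continuous_at)
    from continuous_at_avoid[OF this False] obtain e where e: "e > 0" "\<And>w. dist z w < e \<Longrightarrow> g w \<noteq> 0" by auto
    obtain e' where e': "e' > 0" "ball z e' \<subseteq> S" using S(1) z open_contains_ball by blast
    have sub: "ball z (min e e') \<subseteq> S" using e' by auto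
    show ?thesis
      using e e' sub holomorphic_on_subset[OF g sub]
      by (intro exI[of _ g] exI[of _ "min e e'"] exI[of _ 0]) auto
  qed
  then obtain v r' m where v: "r' > 0" "ball z r' \<subseteq> S" "v holomorphic_on ball z r'"
    "\<And>w. w \<in> ball z r' \<Longrightarrow> g w = (w - z) ^ m * v w" "\<And>w. w \<in> ball z r' \<Longrightarrow> v w \<noteq> 0" by metis
  define B where "B = ball z (min r r')"
  have B: "open B" "z \<in> B" "B \<subseteq> ball z r" "B \<subseteq> ball z r'" using u v by (auto simp: B_def)
  have hu: "u holomorphic_on B" and hv: "v holomorphic_on B"
    using holomorphic_on_subset u(4) v(3) B by blast+
  \<comment> \<open>The two sides of the differential equation after multiplication by w - z and
    division by (w - z)^(m + n). Continuity extends their equality to w = z, where the derivatives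
    drop out and ln 2 * m = ln 3 * n remains after cancelling u and v.\<close>
  define L R where "L = (\<lambda>w. of_real (ln 2) * (of_nat m * v w + (w - z) * deriv v w) * u w)"
    and "R = (\<lambda>w. of_real (ln 3) * v w * (of_nat n * u w + (w - z) * deriv u w))"
  have LR: "L w = R w" if w: "w \<in> B" "w \<noteq> z" for w
  proof -
    have der: "(w - z) * deriv h w = (w - z) ^ k * (of_nat k * q w + (w - z) * deriv q w)"
      if q: "q holomorphic_on B" and eq: "\<And>w. w \<in> B \<Longrightarrow> h w = (w - z) ^ k * q w" for h q and k :: nat
    proof -
      have "((\<lambda>w. (w - z) ^ k * q w) has_field_derivative
          of_nat k * (w - z) ^ (k - 1) * q w + (w - z) ^ k * deriv q w) (at w)"
        by (auto intro!: derivative_eq_intros holomorphic_derivI[OF q B(1) w(1)])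
      then have "(h has_field_derivative
          of_nat k * (w - z) ^ (k - 1) * q w + (w - z) ^ k * deriv q w) (at w)"
        by (rule has_field_derivative_transform_within_open[OF _ B(1) w(1)]) (simp add: eq)
      then show ?thesis
        unfolding DERIV_imp_deriv[OF \<open>(h has_field_derivative _) (at w)\<close>]
        by (cases k) (simp_all add: distrib_left mult_ac del: of_nat_Suc)
    qed
    have df: "(w - z) * deriv f w = (w - z) ^ n * (of_nat n * u w + (w - z) * deriv u w)"
      using u(5) B by (intro der[OF hu]) blast
    have dg: "(w - z) * deriv g w = (w - z) ^ m * (of_nat m * v w + (w - z) * deriv v w)"
      using v(4) B by (intro der[OF hv]) blast
    have fw: "f w = (w - z) ^ n * u w" "g w = (w - z) ^ m * v w" using u(5) v(4) B w by blast+
    have "w \<in> S" using w B u by blast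
    from ode[OF this] have "of_real (ln 2) * ((w - z) * deriv g w) * f w = of_real (ln 3) * g w * ((w - z) * deriv f w)"
      by (simp add: algebra_simps)
    then have "(w - z) ^ m * (w - z) ^ n * L w = (w - z) ^ m * (w - z) ^ n * R w"
      unfolding df dg fw L_def R_def by (simp only: mult_ac)
    then show ?thesis using w by simp
  qed
  have "L holomorphic_on B" "R holomorphic_on B"
    unfolding L_def R_def by (intro holomorphic_intros hu hv B(1))+
  then have "continuous_on B L" "continuous_on B R"
    by (auto intro: holomorphic_on_imp_continuous_on)
  then have "L \<midarrow>z\<rightarrow> L z" "R \<midarrow>z\<rightarrow> R z"
    using B by (simp_all add: continuous_on_eq_continuous_at isCont_def)
  moreover have "\<forall>\<^sub>F w in at z. L w = R w"
    using LR B by (auto simp: eventually_at_topological)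
  ultimately have "L z = R z"
    using tendsto_cong[of L R "at z"] tendsto_unique[of "at z" R "L z" "R z"] by simp
  then have "of_real (ln 2) * of_nat m = (of_real (ln 3) * of_nat n :: complex)"
    using u(6) v(5) B by (auto simp: L_def R_def)
  then have "of_real (ln 2 * real m) = (of_real (ln 3 * real n) :: complex)" by simp
  then have "ln 2 * real m = ln 3 * real n" by (simp only: of_real_eq_iff)
  then have "ln ((2::real) ^ m) = ln (3 ^ n)" by (simp add: ln_realpow mult.commute)
  then have "(2::real) ^ m = 3 ^ n" by simp
  then have "real (2 ^ m) = real (3 ^ n)" by simp
  then have eq: "(2::nat) ^ m = 3 ^ n" by (simp only: of_nat_eq_iff)
  \<comment> \<open>Parity forces m = 0, hence 3^n = 1, against n > 0.\<close>
  have "odd ((3::nat) ^ n)" by simp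
  then have "m = 0" unfolding eq[symmetric] by simp
  then show False using eq u(1) one_less_power[of "3::nat" n] by simp
qed

context hplus_composition
begin

text \<open>The d-smooth part of n^(-\<Phi>). It is tied to n^(-\<Phi>) through coefficients and,
  far to the right, through the limit as d tends to infinity.\<close>

definition G :: "nat \<Rightarrow> nat \<Rightarrow> complex \<Rightarrow> complex" where
  "G d n = dirichlet_eval (smooth_part d (C (unit_coeff n)))"

lemma C_unit_hplus: "n \<ge> 1 \<Longrightarrow> C (unit_coeff n) \<in> hplus"
  by (intro C_represents unit_coeff_hplus)

lemma G_mult:
  assumes "m \<ge> 1" "n \<ge> 1" "Re s > 0"
  shows "G d (m * n) s = G d m s * G d n s"
  unfolding G_def C_unit_mult[OF assms(1,2)]
  using assms by (intro smooth_part_eval_conv C_unit_hplus)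

lemma G_holomorphic: "n \<ge> 1 \<Longrightarrow> G d n holomorphic_on half_plane 0"
  unfolding G_def by (intro smooth_part_holomorphic C_unit_hplus)

lemma G_power:
  assumes "Re s > 0"
  shows "G d (2 ^ Suc j) s = G d 2 s ^ Suc j"
proof (induction j)
  case (Suc j)
  have "G d (2 * 2 ^ Suc j) s = G d 2 s * G d (2 ^ Suc j) s"
    using assms by (intro G_mult) auto
  then show ?case using Suc by simp
qed simp

text \<open>Evaluating a smooth part at s costs a seminorm whose index m has to exceed 1 / Re s.
  Boundedness of the operator trades every such m for the same k, so k does not deteriorate as s
  approaches the imaginary axis; only M does.\<close>

lemma smooth_part_C_bound:
  assumes bd: "\<forall>m\<ge>1. \<exists>K. \<forall>a\<in>hplus. hplus_seminorm m (C a) \<le> K * hplus_seminorm k a"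
    and k: "k \<ge> 1" and s: "Re s > 0"
  obtains M where "M \<ge> 0" "\<And>a. a \<in> hplus \<Longrightarrow>
    cmod (dirichlet_eval (smooth_part d (C a)) s) \<le> M * hplus_seminorm k a"
proof -
  obtain m K where m: "m \<ge> 1" "\<And>a. a \<in> hplus \<Longrightarrow>
    cmod (dirichlet_eval (smooth_part d a) s) \<le> K * hplus_seminorm m a"
    using smooth_part_bound[OF s, of d] by (metis order_refl)
  obtain K' where K': "\<And>a. a \<in> hplus \<Longrightarrow> hplus_seminorm m (C a) \<le> K' * hplus_seminorm k a"
    using bd m(1) by blast
  show ?thesis
  proof (rule that[of "\<bar>K\<bar> * \<bar>K'\<bar>"])
    fix a assume a: "a \<in> hplus"
    have n: "hplus_seminorm m (C a) \<ge> 0" "hplus_seminorm k a \<ge> 0"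
      using hplus_seminorm_nonneg a k m(1) C_represents(1) by auto
    have "cmod (dirichlet_eval (smooth_part d (C a)) s) \<le> K * hplus_seminorm m (C a)"
      by (intro m(2) C_represents a)
    also have "\<dots> \<le> \<bar>K\<bar> * (\<bar>K'\<bar> * hplus_seminorm k a)"
    proof (intro mult_mono)
      have "hplus_seminorm m (C a) \<le> K' * hplus_seminorm k a" by (rule K'[OF a])
      also have "\<dots> \<le> \<bar>K'\<bar> * hplus_seminorm k a" using n by (intro mult_right_mono) auto
      finally show "hplus_seminorm m (C a) \<le> \<bar>K'\<bar> * hplus_seminorm k a" .
    qed (use n in auto)
    finally show "cmod (dirichlet_eval (smooth_part d (C a)) s) \<le> \<bar>K\<bar> * \<bar>K'\<bar> * hplus_seminorm k a"
      by (simp add: mult.assoc)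
  qed simp
qed

text \<open>Multiplicativity upgrades the seminorm bound to a sup-norm bound, by taking \<open>j\<close>-th roots in
  the bound for the image of \<open>(2\<^sup>j)\<^sup>-\<^sup>s\<close>.\<close>

lemma G_2_bound:
  assumes bd: "\<forall>m\<ge>1. \<exists>K. \<forall>a\<in>hplus. hplus_seminorm m (C a) \<le> K * hplus_seminorm k a"
    and k: "k \<ge> 1" and s: "Re s > 0"
  shows "cmod (G d 2 s) \<le> 2 powr (- 1 / real k)"
proof -
  obtain M where M: "M \<ge> 0" "\<And>a. a \<in> hplus \<Longrightarrow>
    cmod (dirichlet_eval (smooth_part d (C a)) s) \<le> M * hplus_seminorm k a"
    using smooth_part_C_bound[OF bd k s] by metis
  show ?thesis
  proof (rule le_of_power_le)
    fix j
    \<comment> \<open>The maximum with 1 covers j = 0, where the left-hand side is 1.\<close>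
    show "cmod (G d 2 s) ^ j \<le> max M 1 * (2 powr (- 1 / real k)) ^ j"
    proof (cases j)
      case (Suc i)
      have "cmod (G d 2 s) ^ j = cmod (G d (2 ^ j) s)" using G_power[OF s] Suc by (simp add: norm_mult norm_power)
      also have "\<dots> \<le> M * hplus_seminorm k (unit_coeff (2 ^ j))"
        unfolding G_def by (intro M unit_coeff_hplus) simp
      also have "\<dots> = M * (2 powr (- 1 / real k)) ^ j"
        by (simp add: unit_coeff_seminorm powr_realpow[symmetric] powr_powr mult.commute)
      also have "\<dots> \<le> max M 1 * (2 powr (- 1 / real k)) ^ j" by (intro mult_right_mono) auto
      finally show ?thesis .
    qed simp
  qed simp
qed

text \<open>Convergence of \<open>G d 2\<close> to 2^(-\<Phi>) is known only far to the right. The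
  bound, uniform in d, makes these functions a normal family, and analytic continuation identifies
  the limit of a subsequence on all of \<open>half_plane 0\<close>.\<close>

lemma \<Phi>_bound_of_G_bound:
  assumes bd: "\<And>d s. Re s > 0 \<Longrightarrow> cmod (G d 2 s) \<le> 2 powr (- r)" and s: "Re s > 0"
  shows "Re (\<Phi> s) \<ge> r"
proof -
  have S: "open (half_plane 0)" by (rule half_plane_props)
  obtain g t where g: "g holomorphic_on half_plane 0"
    and t: "strict_mono t" "\<And>x. x \<in> half_plane 0 \<Longrightarrow> (\<lambda>n. G (t n) 2 x) \<longlonglongrightarrow> g x"
  proof (rule Montel[OF S, of "range (\<lambda>d. G d 2)" "\<lambda>d. G d 2"])
    show "\<exists>B. \<forall>h\<in>range (\<lambda>d. G d 2). \<forall>z\<in>K. cmod (h z) \<le> B" if "compact K" "K \<subseteq> half_plane 0" for K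
      using bd that by (intro exI[of _ "2 powr (- r)"]) auto
  qed (use G_holomorphic in auto)
  obtain \<sigma> where \<sigma>: "\<sigma> > 0" "abs_conv (C (unit_coeff 2)) \<sigma>"
    "\<And>s. Re s > \<sigma> \<Longrightarrow> dirichlet_eval (C (unit_coeff 2)) s = 2 powr (- \<Phi> s)"
    using C_eval_\<Phi>[OF unit_coeff_hplus[of 2]] by (metis unit_coeff_eval of_nat_numeral one_le_numeral)
  have gx: "g x = 2 powr (- \<Phi> x)" if "x \<in> half_plane \<sigma>" for x
  proof -
    have "(\<lambda>d. G d 2 x) \<longlonglongrightarrow> dirichlet_eval (C (unit_coeff 2)) x"
      unfolding G_def using that by (intro smooth_part_tendsto[OF \<sigma>(2)] C_0 unit_coeff_hplus) auto
    then have "(\<lambda>n. G (t n) 2 x) \<longlonglongrightarrow> dirichlet_eval (C (unit_coeff 2)) x"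
      by (rule LIMSEQ_subseq_LIMSEQ[OF _ t(1), unfolded o_def])
    moreover have "(\<lambda>n. G (t n) 2 x) \<longlonglongrightarrow> g x" using that \<sigma>(1) by (intro t) simp
    ultimately have "g x = dirichlet_eval (C (unit_coeff 2)) x" by (rule LIMSEQ_unique[rotated])
    then show ?thesis using \<sigma>(3) that by simp
  qed
  have gs: "g s = 2 powr (- \<Phi> s)"
  proof (rule analytic_continuation_open[where s = "half_plane \<sigma>" and s' = "half_plane 0"
        and f = g and g = "\<lambda>x. 2 powr (- \<Phi> x)"])
    show "(\<lambda>x. 2 powr (- \<Phi> x)) holomorphic_on half_plane 0"
      by (intro holomorphic_intros \<Phi>_holomorphic) auto
    show "half_plane \<sigma> \<subseteq> half_plane 0" using \<sigma>(1) by (intro half_plane_mono) simp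
  qed (use gx g s half_plane_props in auto)
  have "cmod (g s) \<le> 2 powr (- r)"
    using tendsto_norm[OF t(2)[of s]] s bd by (intro tendsto_upperbound[where f = "\<lambda>n. cmod (G (t n) 2 s)"]) auto
  then have "2 powr (- Re (\<Phi> s)) \<le> (2::real) powr (- r)"
    using norm_nat_powr[of 2 "- \<Phi> s"] by (simp add: gs)
  then show ?thesis by simp
qed

section \<open>The case \<open>c\<^sub>0 = 0\<close>: smooth parts as powers of one function\<close>

lemma smooth_part_log:
  "smooth_part d (\<lambda>n. - of_real (ln (real n)) * a n) = (\<lambda>n. - of_real (ln (real n)) * smooth_part d a n)"
  by (auto simp: smooth_part_def truncate_def)

lemma smooth_part_scale: "smooth_part d (\<lambda>n. c * a n) = (\<lambda>n. c * smooth_part d a n)"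
  by (auto simp: smooth_part_def truncate_def)

lemma deriv_dirichlet_eval:
  assumes "abs_conv a \<sigma>" "Re s > \<sigma>"
  shows "deriv (dirichlet_eval a) s = dirichlet_eval (\<lambda>n. - of_real (ln (real n)) * a n) s"
  by (rule DERIV_imp_deriv[OF dirichlet_eval_has_derivative[OF assms]])

text \<open>Both sides are smooth parts of Dirichlet series, and the identity between the full series is
  clear from \<open>n\<^sup>-\<^sup>\<Phi> = exp (- ln n \<Phi>)\<close>.\<close>

lemma G_ode:
  assumes n: "n \<ge> 1" and s: "Re s > 0"
  shows "of_real (ln 2) * deriv (G d n) s * G d 2 s = of_real (ln (real n)) * G d n s * deriv (G d 2) s"
proof -
  define D where "D = (\<lambda>(a::nat\<Rightarrow>complex) n. - of_real (ln (real n)) * a n)"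
  define a b where "a = C (unit_coeff n)" and "b = C (unit_coeff 2)"
  have h: "a \<in> hplus" "b \<in> hplus" unfolding a_def b_def by (intro C_unit_hplus n) (intro C_unit_hplus, simp)
  have 0: "a 0 = 0" "b 0 = 0" "D a 0 = 0" "D b 0 = 0" using h by (simp_all add: hplus_def D_def)
  obtain \<sigma> where \<sigma>: "abs_conv a \<sigma>" "\<And>s. Re s > \<sigma> \<Longrightarrow> dirichlet_eval a s = of_nat n powr (- \<Phi> s)"
    unfolding a_def using C_eval_\<Phi>[OF unit_coeff_hplus[OF n]] by (metis unit_coeff_eval)
  obtain \<tau> where \<tau>: "abs_conv b \<tau>" "\<And>s. Re s > \<tau> \<Longrightarrow> dirichlet_eval b s = of_nat 2 powr (- \<Phi> s)"
    unfolding b_def using C_eval_\<Phi>[OF unit_coeff_hplus[of 2]] by (metis unit_coeff_eval one_le_numeral)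
  define \<rho> where "\<rho> = Max {\<sigma> + 1, \<tau> + 1, 0}"
  have \<rho>: "\<sigma> < \<rho>" "\<tau> < \<rho>" "0 \<le> \<rho>" by (auto simp: \<rho>_def)
  have ac: "abs_conv a \<rho>" "abs_conv b \<rho>" "abs_conv (D a) \<rho>" "abs_conv (D b) \<rho>"
    unfolding D_def
    by (rule abs_conv_mono[OF \<sigma>(1) less_imp_le[OF \<rho>(1)]] abs_conv_mono[OF \<tau>(1) less_imp_le[OF \<rho>(2)]]
        abs_conv_log[OF \<sigma>(1) \<rho>(1)] abs_conv_log[OF \<tau>(1) \<rho>(2)])+
  have L: "abs_conv (\<lambda>m. of_real (ln 2) * dirichlet_conv (D a) b m) \<rho>"
    "abs_conv (\<lambda>m. of_real (ln (real n)) * dirichlet_conv a (D b) m) \<rho>"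
    by (rule abs_conv_comparison[OF dirichlet_conv_abs_conv[OF ac(3,2) 0(3,2)], where K = "ln 2"],
        simp add: norm_mult,
        rule abs_conv_comparison[OF dirichlet_conv_abs_conv[OF ac(1,4) 0(1,4)], where K = "\<bar>ln (real n)\<bar>"],
        simp add: norm_mult)
  have der: "dirichlet_eval (D (C (unit_coeff k))) s = - of_real (ln (real k)) * deriv \<Phi> s * of_nat k powr (- \<Phi> s)"
    if k: "k \<ge> 1" and eq: "\<And>s. Re s > \<mu> \<Longrightarrow> dirichlet_eval (C (unit_coeff k)) s = of_nat k powr (- \<Phi> s)"
      and ack: "abs_conv (C (unit_coeff k)) \<mu>" and s: "Re s > \<mu>" "Re s > 0" for k \<mu> s
  proof -
    have "(\<Phi> has_field_derivative deriv \<Phi> s) (at s)"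
      using s by (intro holomorphic_derivI[OF \<Phi>_holomorphic half_plane_props(1)]) simp
    then have "((\<lambda>s. exp (- \<Phi> s * of_real (ln (real k)))) has_field_derivative
        - of_real (ln (real k)) * deriv \<Phi> s * exp (- \<Phi> s * of_real (ln (real k)))) (at s)"
      by (auto intro!: derivative_eq_intros)
    then have "((\<lambda>s. of_nat k powr (- \<Phi> s)) has_field_derivative
        - of_real (ln (real k)) * deriv \<Phi> s * of_nat k powr (- \<Phi> s)) (at s)"
      using k by (simp add: powr_def Ln_of_nat)
    then have "(dirichlet_eval (C (unit_coeff k)) has_field_derivative
        - of_real (ln (real k)) * deriv \<Phi> s * of_nat k powr (- \<Phi> s)) (at s)"
      by (rule has_field_derivative_transform_within_open[OF _ half_plane_props(1)[of \<mu>]]) (use s eq in auto)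
    from DERIV_unique[OF this dirichlet_eval_has_derivative[OF ack s(1)]]
    show ?thesis by (simp add: D_def)
  qed
  have eq: "(\<lambda>m. of_real (ln 2) * dirichlet_conv (D a) b m) = (\<lambda>m. of_real (ln (real n)) * dirichlet_conv a (D b) m)"
  proof (rule dirichlet_series_unique[OF L])
    fix z assume z: "Re z > \<rho>"
    have "dirichlet_eval (D a) z = - of_real (ln (real n)) * deriv \<Phi> z * of_nat n powr (- \<Phi> z)"
      unfolding a_def using z \<rho> \<sigma> n by (intro der[of n \<sigma>]) (auto simp: a_def)
    moreover have "dirichlet_eval (D b) z = - of_real (ln (real 2)) * deriv \<Phi> z * of_nat 2 powr (- \<Phi> z)"
      unfolding b_def using z \<rho> \<tau> by (intro der[of 2 \<tau>]) (auto simp: b_def)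
    moreover have "dirichlet_eval a z = of_nat n powr (- \<Phi> z)" "dirichlet_eval b z = of_nat 2 powr (- \<Phi> z)"
      using \<sigma>(2) \<tau>(2) z \<rho> by auto
    moreover have "dirichlet_eval (\<lambda>m. of_real (ln 2) * dirichlet_conv (D a) b m) z =
        of_real (ln 2) * (dirichlet_eval (D a) z * dirichlet_eval b z)"
      using z by (simp add: dirichlet_eval_scale[OF dirichlet_conv_abs_conv[OF ac(3,2) 0(3,2)]]
          dirichlet_eval_conv[OF ac(3,2) 0(3,2)])
    moreover have "dirichlet_eval (\<lambda>m. of_real (ln (real n)) * dirichlet_conv a (D b) m) z =
        of_real (ln (real n)) * (dirichlet_eval a z * dirichlet_eval (D b) z)"
      using z by (simp add: dirichlet_eval_scale[OF dirichlet_conv_abs_conv[OF ac(1,4) 0(1,4)]]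
          dirichlet_eval_conv[OF ac(1,4) 0(1,4)])
    ultimately show "dirichlet_eval (\<lambda>m. of_real (ln 2) * dirichlet_conv (D a) b m) z =
        dirichlet_eval (\<lambda>m. of_real (ln (real n)) * dirichlet_conv a (D b) m) z" by simp
  qed simp
  define A B where "A = smooth_part d a" and "B = smooth_part d b"
  have eqs: "(\<lambda>m. of_real (ln 2) * dirichlet_conv (D A) B m) = (\<lambda>m. of_real (ln (real n)) * dirichlet_conv A (D B) m)"
    using arg_cong[OF eq, of "smooth_part d"]
    by (simp only: smooth_part_scale smooth_part_conv) (simp only: smooth_part_log D_def A_def B_def)
  \<comment> \<open>Absolute convergence at Re s / 2 leaves room to differentiate at s, since the
    logarithm costs a move to the right.\<close>
  have acs: "abs_conv A (Re s / 2)" "abs_conv B (Re s / 2)"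
    unfolding A_def B_def using s h by (auto intro!: smooth_part_abs_conv)
  have acs': "abs_conv A (Re s)" "abs_conv B (Re s)" "abs_conv (D A) (Re s)" "abs_conv (D B) (Re s)"
    using abs_conv_mono[OF acs(1), of "Re s"] abs_conv_mono[OF acs(2), of "Re s"]
      abs_conv_log[OF acs(1), of "Re s"] abs_conv_log[OF acs(2), of "Re s"] s
    unfolding D_def by simp_all
  have z0: "A 0 = 0" "B 0 = 0" "D A 0 = 0" "D B 0 = 0" by (simp_all add: A_def B_def D_def)
  have "of_real (ln 2) * (dirichlet_eval (D A) s * dirichlet_eval B s) =
      of_real (ln (real n)) * (dirichlet_eval A s * dirichlet_eval (D B) s)"
    using arg_cong[OF eqs, of "\<lambda>c. dirichlet_eval c s"]
    by (simp add: dirichlet_eval_scale[OF dirichlet_conv_abs_conv[OF acs'(3,2) z0(3,2)]]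
          dirichlet_eval_conv[OF acs'(3,2) z0(3,2)]
          dirichlet_eval_scale[OF dirichlet_conv_abs_conv[OF acs'(1,4) z0(1,4)]]
          dirichlet_eval_conv[OF acs'(1,4) z0(1,4)])
  moreover have "deriv (G d n) s = dirichlet_eval (D A) s" "deriv (G d 2) s = dirichlet_eval (D B) s"
  proof -
    have "G d n = dirichlet_eval A" "G d 2 = dirichlet_eval B"
      by (simp_all add: G_def A_def B_def a_def b_def)
    then show "deriv (G d n) s = dirichlet_eval (D A) s" "deriv (G d 2) s = dirichlet_eval (D B) s"
      using deriv_dirichlet_eval[OF acs(1), of s] deriv_dirichlet_eval[OF acs(2), of s] s
      unfolding D_def by simp_all
  qed
  ultimately show ?thesis by (simp add: G_def A_def B_def a_def b_def mult.assoc)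
qed

text \<open>For \<open>c\<^sub>0 = 0\<close> the constant coefficient of \<open>n\<^sup>-\<^sup>\<Phi>\<close> is nonzero, and it survives in every smooth part.\<close>

lemma G_tendsto:
  assumes "c\<^sub>0 = 0"
  obtains w where "\<And>d n. n \<ge> 1 \<Longrightarrow> (G d n \<longlongrightarrow> of_nat n powr (- w)) (filtercomap Re at_top)"
proof -
  obtain \<sigma> c where c: "abs_conv c \<sigma>" "c 0 = 0" "\<And>s. Re s > \<sigma> \<Longrightarrow> \<Phi> s = dirichlet_eval c s"
    using far_right assms by (metis add_0 mult_zero_left of_nat_0)
  have \<Phi>: "(\<Phi> \<longlongrightarrow> c 1) (filtercomap Re at_top)"
    by (rule Lim_transform_eventually[OF dirichlet_eval_tendsto_first[OF c(1,2)]])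
       (use eventually_Re_gt[of \<sigma>] in \<open>eventually_elim, simp add: c(3)\<close>)
  show ?thesis
  proof (rule that)
    fix d n assume n: "n \<ge> (1::nat)"
    obtain \<tau> where \<tau>: "abs_conv (C (unit_coeff n)) \<tau>"
      "\<And>s. Re s > \<tau> \<Longrightarrow> dirichlet_eval (C (unit_coeff n)) s = of_nat n powr (- \<Phi> s)"
      using C_eval_\<Phi>[OF unit_coeff_hplus[OF n]] by (metis unit_coeff_eval)
    have "((\<lambda>s. of_nat n powr (- \<Phi> s)) \<longlongrightarrow> of_nat n powr (- c 1)) (filtercomap Re at_top)"
      using n by (intro tendsto_intros \<Phi>) auto
    moreover have "((\<lambda>s. of_nat n powr (- \<Phi> s)) \<longlongrightarrow> C (unit_coeff n) 1) (filtercomap Re at_top)"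
      by (rule Lim_transform_eventually[OF dirichlet_eval_tendsto_first[OF \<tau>(1) C_0[OF unit_coeff_hplus[OF n]]]])
         (use eventually_Re_gt[of \<tau>] in \<open>eventually_elim, simp add: \<tau>(2)\<close>)
    ultimately have "C (unit_coeff n) 1 = of_nat n powr (- c 1)"
      using tendsto_unique filtercomap_Re_at_top_neq_bot by blast
    moreover have "smooth_part d (C (unit_coeff n)) 1 = C (unit_coeff n) 1"
      by (auto simp: smooth_part_def truncate_def smooth_numbers_def)
    ultimately show "(G d n \<longlongrightarrow> of_nat n powr (- c 1)) (filtercomap Re at_top)"
      unfolding G_def
      using dirichlet_eval_tendsto_first[OF smooth_part_abs_conv[OF C_unit_hplus[OF n] zero_less_one] smooth_part_0, of d]
      by simp
  qed
qed

text \<open>\<open>G d 2\<close> has no zeros, so it equals exp h. By the differential equation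
  \<open>G d n\<close> times exp (-\<alpha> h) with \<alpha> = ln n / ln 2 has derivative 0. The
  modulus of this constant is found as Re s tends to infinity, where |G d n| and |G d 2|^\<alpha>
  both tend to n^(-Re w).\<close>

lemma G_norm_powr:
  assumes c0: "c\<^sub>0 = 0"
  obtains x where "\<And>n s. n \<ge> 1 \<Longrightarrow> Re s > 0 \<Longrightarrow> cmod (G d n s) = real n powr (- x s)"
proof -
  let ?F = "filtercomap Re at_top"
  obtain w where w: "\<And>n. n \<ge> 1 \<Longrightarrow> (G d n \<longlongrightarrow> of_nat n powr (- w)) ?F" using G_tendsto[OF c0] by metis
  have nz: "\<exists>z\<in>half_plane 0. G d n z \<noteq> 0" if n: "n \<ge> 1" for n
  proof -
    have "\<forall>\<^sub>F s in ?F. G d n s \<noteq> 0"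
      by (rule tendsto_imp_eventually_ne[OF w[OF n]]) (use n in auto)
    then have "\<forall>\<^sub>F s in ?F. G d n s \<noteq> 0 \<and> Re s > 0" using eventually_Re_gt[of 0] by (rule eventually_conj)
    from eventually_happens'[OF filtercomap_Re_at_top_neq_bot this] show ?thesis by auto
  qed
  obtain z\<^sub>1 z\<^sub>2 where z: "z\<^sub>1 \<in> half_plane 0" "G d 2 z\<^sub>1 \<noteq> 0" "z\<^sub>2 \<in> half_plane 0" "G d 3 z\<^sub>2 \<noteq> 0"
    using nz[of 2] nz[of 3] by auto
  \<comment> \<open>At a zero of \<open>G d 2\<close> the orders of \<open>G d 2\<close> and
    \<open>G d 3\<close> would be in the ratio ln 2 : ln 3. Neither function vanishes identically,
    because their limits at infinity are nonzero.\<close>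
  have G2: "G d 2 s \<noteq> 0" if "s \<in> half_plane 0" for s
  proof (rule no_zero_of_proportional_log_derivatives[where f = "G d 2" and g = "G d 3" and S = "half_plane 0",
        OF half_plane_props(1,3) _ _ z _ that])
    show "of_real (ln 2) * deriv (G d 3) s * G d 2 s = of_real (ln 3) * G d 3 s * deriv (G d 2) s"
      if "s \<in> half_plane 0" for s using G_ode[of 3 s d] that by simp
  qed (auto intro: G_holomorphic)
  obtain h where h: "h holomorphic_on half_plane 0" "\<And>s. s \<in> half_plane 0 \<Longrightarrow> exp (h s) = G d 2 s"
    using holomorphic_logarithm_exists[OF half_plane_props(2,1) G_holomorphic G2 z(1)] by (metis one_le_numeral)
  define x where "x = (\<lambda>s. - Re (h s) / ln 2)"
  have x2: "exp (Re (h s)) = 2 powr (- x s)" for s by (simp add: x_def powr_def)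
  show ?thesis
  proof (rule that[of x])
    fix n s assume n: "n \<ge> (1::nat)" and s: "Re s > 0"
    define \<alpha> where "\<alpha> = ln (real n) / ln 2"
    define q where "q = (\<lambda>s. G d n s * exp (- of_real \<alpha> * h s))"
    have "\<exists>c. \<forall>s\<in>half_plane 0. q s = c"
    proof (rule has_field_derivative_zero_constant[OF half_plane_props(2)])
      fix s assume s: "s \<in> half_plane 0"
      have dh: "(h has_field_derivative deriv h s) (at s)" by (rule holomorphic_derivI[OF h(1) half_plane_props(1) s])
      have dn: "(G d n has_field_derivative deriv (G d n) s) (at s)"
        by (rule holomorphic_derivI[OF G_holomorphic[OF n] half_plane_props(1) s])
      have "((\<lambda>s. exp (h s)) has_field_derivative exp (h s) * deriv h s) (at s)"
        using dh by (auto intro!: derivative_eq_intros)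
      then have "(G d 2 has_field_derivative exp (h s) * deriv h s) (at s)"
        by (rule has_field_derivative_transform_within_open[OF _ half_plane_props(1) s]) (rule h(2))
      from DERIV_imp_deriv[OF this] have d2: "deriv (G d 2) s = G d 2 s * deriv h s" using h(2)[OF s] by simp
      have "of_real (ln 2) * deriv (G d n) s * G d 2 s = of_real (ln (real n)) * G d n s * (G d 2 s * deriv h s)"
        using G_ode[OF n, of s d] s d2 by simp
      then have "of_real (ln 2) * deriv (G d n) s = of_real (ln (real n)) * G d n s * deriv h s"
        using G2[OF s] by (simp add: mult_ac)
      then have dgn: "deriv (G d n) s = of_real \<alpha> * G d n s * deriv h s"
        by (simp add: \<alpha>_def field_simps)
      have "(q has_field_derivative (deriv (G d n) s * exp (- of_real \<alpha> * h s) +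
          exp (- of_real \<alpha> * h s) * (- of_real \<alpha> * deriv h s) * G d n s)) (at s)"
        unfolding q_def using dn dh by (auto intro!: derivative_eq_intros)
      then have "(q has_field_derivative 0) (at s)" by (simp add: dgn algebra_simps)
      then show "(q has_field_derivative 0) (at s within half_plane 0)" by (rule has_field_derivative_at_within)
    qed
    then obtain c where c: "\<And>s. s \<in> half_plane 0 \<Longrightarrow> q s = c" by blast
    have Gc: "cmod (G d n s) = cmod c * real n powr (- x s)" if "s \<in> half_plane 0" for s
    proof -
      have "G d n s = c * exp (of_real \<alpha> * h s)" using c[OF that] by (auto simp: q_def exp_minus field_simps)
      then show ?thesis using n by (simp add: norm_mult \<alpha>_def x_def powr_def field_simps)
    qed
    have G2x: "cmod (G d 2 s) = 2 powr (- x s)" if "s \<in> half_plane 0" for s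
      using h(2)[OF that, symmetric] x2 by simp
    have F0: "\<forall>\<^sub>F s in ?F. s \<in> half_plane 0" using eventually_Re_gt[of 0] by simp
    have "((\<lambda>s. cmod (G d 2 s)) \<longlongrightarrow> 2 powr (- Re w)) ?F"
      using tendsto_norm[OF w[of 2]] norm_nat_powr[of 2 "- w"] by simp
    then have "((\<lambda>s. 2 powr (- x s)) \<longlongrightarrow> 2 powr (- Re w)) ?F"
      by (rule Lim_transform_eventually) (use F0 in \<open>eventually_elim, simp add: G2x\<close>)
    then have "((\<lambda>s. (2 powr (- x s)) powr \<alpha>) \<longlongrightarrow> (2 powr (- Re w)) powr \<alpha>) ?F"
      by (rule tendsto_powr[OF _ tendsto_const]) simp
    moreover have "(2 powr (- y)) powr \<alpha> = real n powr (- y)" for y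
      using n by (simp add: powr_powr \<alpha>_def) (simp add: powr_def)
    ultimately have "((\<lambda>s. real n powr (- x s)) \<longlongrightarrow> real n powr (- Re w)) ?F"
      by (simp only:)
    then have lim: "((\<lambda>s. cmod c * real n powr (- x s)) \<longlongrightarrow> cmod c * real n powr (- Re w)) ?F"
      by (rule tendsto_mult_left)
    have "((\<lambda>s. cmod (G d n s)) \<longlongrightarrow> real n powr (- Re w)) ?F"
      using tendsto_norm[OF w[OF n]] norm_nat_powr[of n "- w"] by simp
    then have "((\<lambda>s. cmod c * real n powr (- x s)) \<longlongrightarrow> real n powr (- Re w)) ?F"
      by (rule Lim_transform_eventually) (use F0 in \<open>eventually_elim, simp only: Gc\<close>)
    from tendsto_unique[OF filtercomap_Re_at_top_neq_bot lim this] have "cmod c = 1" using n by simp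
    then show "cmod (G d n s) = real n powr (- x s)" using Gc[of s] s by simp
  qed
qed

text \<open>Evaluating at the test polynomial that is dual to the point \<open>s\<close> bounds
  \<open>\<Sum>\<^sub>n |G d n s|\<^sup>2 n\<^sup>2\<^sup>/\<^sup>k\<close>.\<close>

lemma G_2_bound_zero:
  assumes bd: "\<forall>m\<ge>1. \<exists>K. \<forall>a\<in>hplus. hplus_seminorm m (C a) \<le> K * hplus_seminorm k a"
    and k: "k \<ge> 1" and s: "Re s > 0" and c0: "c\<^sub>0 = 0"
  shows "cmod (G d 2 s) \<le> 2 powr (- (1/2 + 1 / real k))"
proof -
  obtain M where M: "M \<ge> 0" "\<And>a. a \<in> hplus \<Longrightarrow>
    cmod (dirichlet_eval (smooth_part d (C a)) s) \<le> M * hplus_seminorm k a"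
    using smooth_part_C_bound[OF bd k s] by metis
  obtain x' where "\<And>n s. n \<ge> 1 \<Longrightarrow> Re s > 0 \<Longrightarrow> cmod (G d n s) = real n powr (- x' s)"
    using G_norm_powr[OF c0, of d] by metis
  then obtain x where x: "\<And>n. n \<ge> 1 \<Longrightarrow> cmod (G d n s) = real n powr (- x)" using s by metis
  define g where "g = (\<lambda>n. if n = 0 then 0 else real n powr (- (2 * x - 2 / real k)))"
  have bound: "sum g {..<N} \<le> M\<^sup>2" for N
  proof -
    \<comment> \<open>These coefficients represent evaluation at s in the inner product of the k-th
      seminorm, so that Cauchy-Schwarz is attained: the value at s and the square of the seminorm
      are the same sum X.\<close>
    define p where "p = (\<lambda>n. cnj (G d n s) * of_real (real n powr (2 / real k)))"
    define a where "a = (\<lambda>m. \<Sum>n\<in>{1..<N}. p n * unit_coeff n m)"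
    define X where "X = sum g {..<N}"
    have X0: "X \<ge> 0" unfolding X_def by (intro sum_nonneg) (simp add: g_def)
    have X1: "X = sum g {1..<N}"
      unfolding X_def by (rule sum.mono_neutral_right) (auto simp: g_def not_le Suc_le_eq)
    have am: "a m = (if m \<in> {1..<N} then p m else 0)" for m
    proof -
      have "a m = (\<Sum>n\<in>{1..<N}. if n = m then p n else 0)"
        unfolding a_def by (intro sum.cong) (auto simp: unit_coeff_def)
      then show ?thesis by simp
    qed
    have a: "a \<in> hplus"
      by (rule hplus_finite_support, rule finite_subset[of _ "{1..<N}"]) (auto simp: am)
    have gn: "(cmod (G d n s))\<^sup>2 * real n powr (2 / real k) = g n" if "n \<ge> 1" for n
      using that by (simp add: x g_def power2_eq_square flip: powr_add)
    have "(hplus_weighted k a n)\<^sup>2 = (if n \<in> {1..<N} then g n else 0)" for n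
    proof (cases "n \<in> {1..<N}")
      case True
      then have "(hplus_weighted k a n)\<^sup>2 = (cmod (G d n s))\<^sup>2 * ((real n powr (2 / real k))\<^sup>2 * real n powr (- 2 / real k))"
        by (simp add: hplus_weighted_square am p_def norm_mult power_mult_distrib)
      also have "(real n powr (2 / real k))\<^sup>2 * real n powr (- 2 / real k) = real n powr (2 / real k)"
        by (simp add: power2_eq_square flip: powr_add)
      finally show ?thesis using gn True by simp
    next
      case False
      then show ?thesis unfolding hplus_weighted_def am if_not_P[OF False] by simp
    qed
    then have sn: "hplus_seminorm k a = sqrt X"
      unfolding hplus_seminorm_eq X1 using sums_unique[OF sums_If_finite_set[of "{1..<N}" g]] by simp
    have ac: "abs_conv (smooth_part d (C (unit_coeff n))) (Re s)" if "n \<in> {1..<N}" for n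
      using that s by (intro smooth_part_abs_conv C_unit_hplus) auto
    have "smooth_part d (C a) = (\<lambda>m. \<Sum>n\<in>{1..<N}. p n * smooth_part d (C (unit_coeff n)) m)"
      unfolding a_def C_polynomial by (auto simp: smooth_part_def truncate_def)
    then have "dirichlet_eval (smooth_part d (C a)) s = (\<Sum>n\<in>{1..<N}. p n * G d n s)"
      using dirichlet_eval_sum(2)[OF finite_atLeastLessThan ac] by (simp add: G_def)
    also have "\<dots> = (\<Sum>n\<in>{1..<N}. of_real (g n))"
    proof (intro sum.cong refl)
      fix n assume n: "n \<in> {1..<N}"
      have "p n * G d n s = of_real ((cmod (G d n s))\<^sup>2 * real n powr (2 / real k))"
        unfolding of_real_mult complex_norm_square by (simp add: p_def mult_ac)
      also have "(cmod (G d n s))\<^sup>2 * real n powr (2 / real k) = g n" using n by (intro gn) simp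
      finally show "p n * G d n s = of_real (g n)" .
    qed
    also have "\<dots> = of_real X" by (simp add: X1)
    finally have "cmod (dirichlet_eval (smooth_part d (C a)) s) = X" using X0 by simp
    \<comment> \<open>Dividing by the root leaves a bound on X by M^2, in which M does not depend on
      N.\<close>
    then have "X \<le> M * sqrt X" using M(2)[OF a] sn by simp
    then have "sqrt X * sqrt X \<le> M * sqrt X" using X0 by simp
    then have "sqrt X \<le> M"
      using M(1) X0 mult_right_le_imp_le[of "sqrt X" "sqrt X" M] by (cases "X = 0") auto
    then show ?thesis using X0 by (simp add: X_def sqrt_le_D)
  qed
  have "summable g" by (rule summableI_nonneg_bounded[OF _ bound]) (simp add: g_def)
  then have "summable (\<lambda>n. real n powr (- (2 * x - 2 / real k)))"
    by (rule summable_cong[THEN iffD1, rotated]) (use eventually_gt_at_top[of "0::nat"] in \<open>eventually_elim, simp add: g_def\<close>)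
  \<comment> \<open>Convergence requires the exponent 2x - 2/k to exceed 1; this is the origin of
    the extra 1/2.\<close>
  then have "x > 1/2 + 1 / real k" by (simp add: summable_real_powr_iff)
  then show ?thesis using x[of 2] by simp
qed

end

theorem theorem4p4:
  fixes \<theta> :: real and \<phi> \<Phi> :: "complex \<Rightarrow> complex" and c\<^sub>0 :: nat
  assumes "\<phi> ` half_plane \<theta> \<subseteq> half_plane (1/2)"
    and "analytic_of_form c\<^sub>0 \<phi>"
    and well_defined: "\<forall>a\<in>hplus. \<exists>b\<in>hplus. represents_comp \<phi> a b"
    and continuous: "continuous_map hplus_topology hplus_topology (comp_op \<phi>)"
    and extension: "analytic_extension \<phi> \<Phi>"
  shows "bounded_operator hplus_topology hplus_topology (comp_op \<phi>) \<longleftrightarrow>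
    (\<exists>\<epsilon>>0. (c\<^sub>0 \<ge> 1 \<longrightarrow> \<Phi> ` half_plane 0 \<subseteq> half_plane \<epsilon>) \<and>
            (c\<^sub>0 = 0 \<longrightarrow> \<Phi> ` half_plane 0 \<subseteq> half_plane (1/2 + \<epsilon>)))"
proof -
  interpret hplus_composition \<theta> \<phi> \<Phi> c\<^sub>0
    using assms by unfold_locales
  have iff: "bounded_operator hplus_topology hplus_topology (comp_op \<phi>) \<longleftrightarrow>
    (\<exists>k\<ge>1. \<forall>m\<ge>1. \<exists>K. \<forall>a\<in>hplus. hplus_seminorm m (C a) \<le> K * hplus_seminorm k a)"
    by (intro bounded_operator_hplus_iff C_represents C_scale)
  show ?thesis
    unfolding iff
  proof
    assume "\<exists>k\<ge>1. \<forall>m\<ge>1. \<exists>K. \<forall>a\<in>hplus. hplus_seminorm m (C a) \<le> K * hplus_seminorm k a"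
    then obtain k where k: "k \<ge> 1"
      and bd: "\<forall>m\<ge>1. \<exists>K. \<forall>a\<in>hplus. hplus_seminorm m (C a) \<le> K * hplus_seminorm k a" by blast
    \<comment> \<open>The limit argument yields weak inequalities with 1/k; halving turns them into
      the strict ones of open half-planes.\<close>
    define \<epsilon> where "\<epsilon> = 1 / (2 * real k)"
    have \<epsilon>: "\<epsilon> > 0" "\<epsilon> < 1 / real k" using k by (auto simp: \<epsilon>_def field_simps)
    have "Re (\<Phi> s) \<ge> 1 / real k" if "Re s > 0" for s
      using \<Phi>_bound_of_G_bound[OF _ that, of "1 / real k"] G_2_bound[OF bd k] by simp
    then have 1: "\<Phi> ` half_plane 0 \<subseteq> half_plane \<epsilon>" using \<epsilon> by force
    have "Re (\<Phi> s) \<ge> 1/2 + 1 / real k" if "Re s > 0" "c\<^sub>0 = 0" for s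
      using \<Phi>_bound_of_G_bound[OF _ that(1)] G_2_bound_zero[OF bd k _ that(2)] by blast
    then have 2: "c\<^sub>0 = 0 \<longrightarrow> \<Phi> ` half_plane 0 \<subseteq> half_plane (1/2 + \<epsilon>)" using \<epsilon> by force
    show "\<exists>\<epsilon>>0. (c\<^sub>0 \<ge> 1 \<longrightarrow> \<Phi> ` half_plane 0 \<subseteq> half_plane \<epsilon>) \<and>
            (c\<^sub>0 = 0 \<longrightarrow> \<Phi> ` half_plane 0 \<subseteq> half_plane (1/2 + \<epsilon>))"
      using \<epsilon>(1) 1 2 by blast
  next
    assume "\<exists>\<epsilon>>0. (c\<^sub>0 \<ge> 1 \<longrightarrow> \<Phi> ` half_plane 0 \<subseteq> half_plane \<epsilon>) \<and>
            (c\<^sub>0 = 0 \<longrightarrow> \<Phi> ` half_plane 0 \<subseteq> half_plane (1/2 + \<epsilon>))"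
    then obtain \<epsilon> where \<epsilon>: "\<epsilon> > 0" "c\<^sub>0 \<ge> 1 \<Longrightarrow> \<Phi> ` half_plane 0 \<subseteq> half_plane \<epsilon>"
      "c\<^sub>0 = 0 \<Longrightarrow> \<Phi> ` half_plane 0 \<subseteq> half_plane (1/2 + \<epsilon>)" by blast
    obtain k :: nat where k: "k \<ge> 1" "1 / real k < \<epsilon>" using real_gt_inverse_nat[OF \<epsilon>(1)] .
    have "\<exists>K. \<forall>m\<ge>1. \<forall>a\<in>hplus. hplus_seminorm m (C a) \<le> K * hplus_seminorm k a"
    proof (cases "c\<^sub>0 = 0")
      case True
      then show ?thesis using C_bound_zero[OF \<epsilon>(3) k] by simp
    next
      case False
      then have c: "c\<^sub>0 \<ge> 1" by simp
      show ?thesis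
        using C_bound_pos[OF c continuous \<epsilon>(2)[OF c] k] by (intro exI[of _ 1]) simp
    qed
    then show "\<exists>k\<ge>1. \<forall>m\<ge>1. \<exists>K. \<forall>a\<in>hplus. hplus_seminorm m (C a) \<le> K * hplus_seminorm k a"
      using k(1) by blast
  qed
qed

end
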